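(* Let $\mathcal G\in\mathbf G_{\mathrm{fin}}$ be a metric graph with edge set $\mathcal E$ and vertex set $\mathcal V$, and let $p>2$ with $p\neq6$. Let $(W_n),(\rho_n)\subseteq L^\infty(\mathcal G)$ be such that: (i) there exists $\bar W\in\mathbb R$ such that $|W_n(x)|\le \bar W$ for almost all $x\in\mathcal G$ and all $n\in\mathbb N$; (ii) there exists $b>0$ such that $0\le\rho_n(x)\le b$ for almost all $x\in\mathcal G$ and all $n\in\mathbb N$; (iii) there exists $a\in(0,b)$ such that for every edge $e\in\mathcal E$, either $\rho_n\ge a$ a.e. on $e$ for all $n\in\mathbb N$, or $\rho_n\equiv0$ on $e$ for all $n\in\mathbb N$. Let $(\lambda_n)\subseteq\mathbb R$ and let $(u_n)\subseteq H^1(\mathcal G)$ be such that, for each $n$, $u_n$ is a solution of $$\begin{cases}-u_n''+W_n(x)u_n+\lambda_nu_n=\rho_n(x)|u_n|^{p-2}u_n&\text{on every edge } e\in\mathcal E,\\ u_n\text{ is continuous on }\mathcal G,\\ \sum_{e\succ v}\frac{d u_{n,e}}{dx}(v)=0&\text{at every vertex }v\in\mathcal V.\end{cases}$$ Assume that for some $c>0$ and $m^*>0$, for all $n\in\mathbb N$, $$\int_{\mathcal G}|u_n|^2\,dx=c\quad\text{and}\quad \mathrm m(u_n)\le m^*,$$ where $\mathrm m(u_n)$ is the Morse index of $u_n$. Then the sequence $(\lambda_n)\subseteq\mathbb R$ is bounded from above.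
   Context: Metric graphs: $\mathcal G=(\mathcal E,\mathcal V)$ with edges $\mathcal E$ and vertices $\mathcal V$; each bounded edge $e$ is identified with an interval $[0,\ell_e]$ and each unbounded edge (half-line) with $[0,+\infty)$. $\mathbf G$ is the class of metric graphs that are connected, have at most countably many edges, all of whose vertices are adjacent to finitely many edges, and for which the infimum of the lengths of all edges is positive. $\mathbf G_{\mathrm{fin}}$ is the class of graphs in $\mathbf G$ with finitely many vertices and edges. $u_e$ is the restriction of $u$ to the edge $e$. $H^1(\mathcal G)$ is the space of continuous $u:\mathcal G\to\mathbb R$ with $u_e\in H^1(0,\ell_e)$ for every edge (with $\ell_e=+\infty$ for half-lines) and $\|u\|_{H^1(\mathcal G)}^2=\sum_e(\|u_e'\|_{L^2(e)}^2+\|u_e\|_{L^2(e)}^2)<\infty$. $C_c(\mathcal G)$ is the space of continuous functions with compact support in $\mathcal G$. The notation $e\succ v$ means that the edge $e$ is incident to $v$, and $\frac{du_e}{dx}(v)$ is the derivative along $e$ at $v$ directed away from $v$ (Kirchhoff condition). Solutions are understood in the weak sense: $\int_{\mathcal G}(u_n'\varphi'+(W_n+\lambda_n)u_n\varphi)\,dx=\int_{\mathcal G}\rho_n|u_n|^{p-2}u_n\varphi\,dx$ for all $\varphi\in H^1(\mathcal G)\cap C_c(\mathcal G)$. The Morse index $\mathrm m(u_n)$ is the maximal dimension $m$ (or $+\infty$ if there is no maximal integer) of a subspace $X\subset H^1(\mathcal G)\cap C_c(\mathcal G)$ such that for all $\varphi\in X\setminus\{0\}$, $$\int_{\mathcal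 G}\bigl(|\varphi'|^2+(W_n+\lambda_n)\varphi^2-(p-1)\rho_n|u_n|^{p-2}\varphi^2\bigr)dx<0.$$ *)

theory Defs
  imports "HOL-Analysis.Analysis" "HOL-Library.Function_Algebras"
begin

section \<open>Metric graphs\<close>

text \<open>
  Multiple edges and loops are allowed. A bounded edge \<open>e\<close> is parametrised by \<open>[0, len e]\<close> from
  \<open>tail e\<close> to \<open>head e\<close>; a half-line (\<open>len e = \<infinity>\<close>) is parametrised by \<open>[0, \<infinity>)\<close> starting at
  \<open>tail e\<close>, and its \<open>head\<close> is never used.
\<close>

record ('v, 'e) metric_graph =
  verts :: "'v set"
  edges :: "'e set"
  tail :: "'e \<Rightarrow> 'v"
  head :: "'e \<Rightarrow> 'v"
  len :: "'e \<Rightarrow> ereal"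

definition edge_ends :: "('v, 'e) metric_graph \<Rightarrow> 'e \<Rightarrow> 'v set" where
  "edge_ends G e = (if len G e = \<infinity> then {tail G e} else {tail G e, head G e})"

definition wf_metric_graph :: "('v, 'e) metric_graph \<Rightarrow> bool" where
  "wf_metric_graph G \<longleftrightarrow> (\<forall>e\<in>edges G. 0 < len G e \<and> edge_ends G e \<subseteq> verts G)"

definition edge_interval :: "('v, 'e) metric_graph \<Rightarrow> 'e \<Rightarrow> real set" where
  "edge_interval G e = {x. 0 \<le> x \<and> ereal x \<le> len G e}"

datatype ('v, 'e) gpoint = Vertex 'v | Inner 'e real

definition gpoints :: "('v, 'e) metric_graph \<Rightarrow> ('v, 'e) gpoint set" where
  "gpoints G = Vertex ` verts G \<union> {Inner e x |e x. e \<in> edges G \<and> 0 < x \<and> ereal x < len G e}"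

definition edge_point :: "('v, 'e) metric_graph \<Rightarrow> 'e \<Rightarrow> real \<Rightarrow> ('v, 'e) gpoint" where
  "edge_point G e x =
     (if x = 0 then Vertex (tail G e)
      else if ereal x = len G e then Vertex (head G e)
      else Inner e x)"

definition on_edge :: "('v, 'e) metric_graph \<Rightarrow> (('v, 'e) gpoint \<Rightarrow> real) \<Rightarrow> 'e \<Rightarrow> real \<Rightarrow> real" where
  "on_edge G u e = (\<lambda>x. u (edge_point G e x))"

text \<open>
  The quotient topology obtained by gluing the edges at the vertices. For locally finite graphs whose
  edge lengths are bounded away from zero it is the topology of the shortest-path distance.
\<close>

definition graph_topology :: "('v, 'e) metric_graph \<Rightarrow> ('v, 'e) gpoint topology" where
  "graph_topology G = topology (\<lambda>U. U \<subseteq> gpoints G \<and>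
     (\<forall>e\<in>edges G. openin (top_of_set (edge_interval G e))
                    {x \<in> edge_interval G e. edge_point G e x \<in> U}))"

lemma openin_graph_topology:
  "openin (graph_topology G) U \<longleftrightarrow> U \<subseteq> gpoints G \<and>
     (\<forall>e\<in>edges G. openin (top_of_set (edge_interval G e))
                    {x \<in> edge_interval G e. edge_point G e x \<in> U})"
proof -
  have "istopology (\<lambda>U. U \<subseteq> gpoints G \<and>
     (\<forall>e\<in>edges G. openin (top_of_set (edge_interval G e))
                    {x \<in> edge_interval G e. edge_point G e x \<in> U}))"
    (is "istopology ?P")
    unfolding istopology_def
  proof (rule conjI; intro allI impI)
    fix S T assume "?P S" "?P T"
    moreover have "{x \<in> edge_interval G e. edge_point G e x \<in> S \<inter> T} =
        {x \<in> edge_interval G e. edge_point G e x \<in> S} \<inter>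
        {x \<in> edge_interval G e. edge_point G e x \<in> T}" for e
      by auto
    ultimately show "?P (S \<inter> T)"
      by (auto intro!: openin_Int)
  next
    fix K assume K: "\<forall>U\<in>K. ?P U"
    have "openin (top_of_set (edge_interval G e))
            {x \<in> edge_interval G e. edge_point G e x \<in> \<Union>K}" if "e \<in> edges G" for e
    proof -
      have "{x \<in> edge_interval G e. edge_point G e x \<in> \<Union>K} =
          \<Union>((\<lambda>U. {x \<in> edge_interval G e. edge_point G e x \<in> U}) ` K)"
        by auto
      then show ?thesis
        using K that by (metis (no_types, lifting) imageE openin_Union)
    qed
    then show "?P (\<Union>K)"
      using K by blast
  qed
  then show ?thesis
    unfolding graph_topology_def by (simp add: topology_inverse')
qed

lemma topspace_graph_topology:
  assumes "wf_metric_graph G"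
  shows "topspace (graph_topology G) = gpoints G"
proof -
  have "{x \<in> edge_interval G e. edge_point G e x \<in> gpoints G} = edge_interval G e"
    if "e \<in> edges G" for e
    using assms that
    by (fastforce simp: wf_metric_graph_def edge_ends_def edge_interval_def edge_point_def gpoints_def
        split: if_splits)
  then have "openin (graph_topology G) (gpoints G)"
    by (simp add: openin_graph_topology)
  then show ?thesis
    by (metis openin_graph_topology openin_subset openin_topspace subset_antisym)
qed

definition graphs :: "('v, 'e) metric_graph set" where
  "graphs = {G. wf_metric_graph G \<and> connected_space (graph_topology G) \<and> countable (edges G) \<and>
     (\<forall>v\<in>verts G. finite {e \<in> edges G. v \<in> edge_ends G e}) \<and>
     0 < (INF e\<in>edges G. len G e)}"

definition graphs_fin :: "('v, 'e) metric_graph set" where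
  "graphs_fin = {G \<in> graphs. finite (verts G) \<and> finite (edges G)}"


section \<open>Function spaces\<close>

definition square_integrable_on :: "(real \<Rightarrow> real) \<Rightarrow> real set \<Rightarrow> bool" where
  "square_integrable_on f I \<longleftrightarrow> f \<in> borel_measurable (lebesgue_on I) \<and>
     integrable (lebesgue_on I) (\<lambda>x. (f x)\<^sup>2)"

text \<open>
  The test functions of the weak derivative are the \<open>C\<^sup>1\<close> functions with compact support in the
  interior of \<open>I\<close>, extended by zero to the real line.
\<close>

definition has_weak_derivative :: "(real \<Rightarrow> real) \<Rightarrow> (real \<Rightarrow> real) \<Rightarrow> real set \<Rightarrow> bool" where
  "has_weak_derivative f g I \<longleftrightarrow>
     (\<forall>\<phi>::real \<Rightarrow> real. \<phi> C1_differentiable_on UNIV \<longrightarrow>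
        (\<exists>K. compact K \<and> K \<subseteq> interior I \<and> (\<forall>x. x \<notin> K \<longrightarrow> \<phi> x = 0)) \<longrightarrow>
        (LINT x|lebesgue_on I. f x * deriv \<phi> x) = - (LINT x|lebesgue_on I. g x * \<phi> x))"

definition H1_on :: "real set \<Rightarrow> (real \<Rightarrow> real) set" where
  "H1_on I = {f. square_integrable_on f I \<and>
     (\<exists>g. square_integrable_on g I \<and> has_weak_derivative f g I)}"

text \<open>For \<open>f \<in> H1_on I\<close> the weak derivative is unique up to null sets; this picks a representative.\<close>

definition weak_derivative :: "(real \<Rightarrow> real) \<Rightarrow> real set \<Rightarrow> real \<Rightarrow> real" where
  "weak_derivative f I = (SOME g. square_integrable_on g I \<and> has_weak_derivative f g I)"

definition edge_deriv :: "('v, 'e) metric_graph \<Rightarrow> (('v, 'e) gpoint \<Rightarrow> real) \<Rightarrow> 'e \<Rightarrow> real \<Rightarrow> real" where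
  "edge_deriv G u e = weak_derivative (on_edge G u e) (edge_interval G e)"

definition graph_integral :: "('v, 'e) metric_graph \<Rightarrow> ('e \<Rightarrow> real \<Rightarrow> real) \<Rightarrow> real" where
  "graph_integral G f = (\<Sum>\<^sub>\<infinity>e\<in>edges G. LINT x|lebesgue_on (edge_interval G e). f e x)"

definition AE_on_edge ::
  "('v, 'e) metric_graph \<Rightarrow> 'e \<Rightarrow> (('v, 'e) gpoint \<Rightarrow> bool) \<Rightarrow> bool" where
  "AE_on_edge G e P \<longleftrightarrow> (AE x in lebesgue_on (edge_interval G e). P (edge_point G e x))"

definition AE_on_graph :: "('v, 'e) metric_graph \<Rightarrow> (('v, 'e) gpoint \<Rightarrow> bool) \<Rightarrow> bool" where
  "AE_on_graph G P \<longleftrightarrow> (\<forall>e\<in>edges G. AE_on_edge G e P)"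

definition Linfty :: "('v, 'e) metric_graph \<Rightarrow> (('v, 'e) gpoint \<Rightarrow> real) set" where
  "Linfty G = {f.
     (\<forall>e\<in>edges G. on_edge G f e \<in> borel_measurable (lebesgue_on (edge_interval G e))) \<and>
     (\<exists>C. AE_on_graph G (\<lambda>x. \<bar>f x\<bar> \<le> C))}"

definition H1 :: "('v, 'e) metric_graph \<Rightarrow> (('v, 'e) gpoint \<Rightarrow> real) set" where
  "H1 G = {u. continuous_map (graph_topology G) euclideanreal u \<and>
     (\<forall>e\<in>edges G. on_edge G u e \<in> H1_on (edge_interval G e)) \<and>
     (\<lambda>e. (LINT x|lebesgue_on (edge_interval G e). (edge_deriv G u e x)\<^sup>2) +
          (LINT x|lebesgue_on (edge_interval G e). (on_edge G u e x)\<^sup>2)) summable_on edges G}"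

text \<open>
  The type \<open>gpoint\<close> also contains elements that are not points of \<open>G\<close>; requiring the value zero there
  makes elements of \<open>Cc G\<close> equal as soon as they agree on \<open>G\<close>.
\<close>

definition Cc :: "('v, 'e) metric_graph \<Rightarrow> (('v, 'e) gpoint \<Rightarrow> real) set" where
  "Cc G = {u. continuous_map (graph_topology G) euclideanreal u \<and>
     compactin (graph_topology G) (graph_topology G closure_of {x \<in> gpoints G. u x \<noteq> 0}) \<and>
     (\<forall>x. x \<notin> gpoints G \<longrightarrow> u x = 0)}"


section \<open>Solutions and the Morse index\<close>

text \<open>
  Weak form of \<open>-u'' + W u + lam u = \<rho> |u|\<^sup>p\<^sup>-\<^sup>2 u\<close> on every edge with continuity and the Kirchhoff
  condition at every vertex.
\<close>

definition weak_solution ::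
  "('v, 'e) metric_graph \<Rightarrow> real \<Rightarrow> (('v, 'e) gpoint \<Rightarrow> real) \<Rightarrow> real \<Rightarrow>
   (('v, 'e) gpoint \<Rightarrow> real) \<Rightarrow> (('v, 'e) gpoint \<Rightarrow> real) \<Rightarrow> bool" where
  "weak_solution G p W lam \<rho> u \<longleftrightarrow> u \<in> H1 G \<and>
     (\<forall>\<phi> \<in> H1 G \<inter> Cc G.
        graph_integral G (\<lambda>e x. edge_deriv G u e x * edge_deriv G \<phi> e x +
          (on_edge G W e x + lam) * on_edge G u e x * on_edge G \<phi> e x) =
        graph_integral G (\<lambda>e x. on_edge G \<rho> e x * \<bar>on_edge G u e x\<bar> powr (p - 2) *
          on_edge G u e x * on_edge G \<phi> e x))"

definition morse_form ::
  "('v, 'e) metric_graph \<Rightarrow> real \<Rightarrow> (('v, 'e) gpoint \<Rightarrow> real) \<Rightarrow> real \<Rightarrow>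
   (('v, 'e) gpoint \<Rightarrow> real) \<Rightarrow> (('v, 'e) gpoint \<Rightarrow> real) \<Rightarrow> (('v, 'e) gpoint \<Rightarrow> real) \<Rightarrow> real" where
  "morse_form G p W lam \<rho> u \<phi> =
     graph_integral G (\<lambda>e x. (edge_deriv G \<phi> e x)\<^sup>2 +
       (on_edge G W e x + lam) * (on_edge G \<phi> e x)\<^sup>2 -
       (p - 1) * on_edge G \<rho> e x * \<bar>on_edge G u e x\<bar> powr (p - 2) * (on_edge G \<phi> e x)\<^sup>2)"

interpretation fun_vs: vector_space "\<lambda>(c::real) (f :: 'a \<Rightarrow> real) x. c * f x"
  by unfold_locales (auto simp: fun_eq_iff algebra_simps)

definition subspace_dim :: "('a \<Rightarrow> real) set \<Rightarrow> enat" where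
  "subspace_dim X = (if \<exists>B. finite B \<and> X \<subseteq> fun_vs.span B then enat (fun_vs.dim X) else \<infinity>)"

definition morse_index ::
  "('v, 'e) metric_graph \<Rightarrow> real \<Rightarrow> (('v, 'e) gpoint \<Rightarrow> real) \<Rightarrow> real \<Rightarrow>
   (('v, 'e) gpoint \<Rightarrow> real) \<Rightarrow> (('v, 'e) gpoint \<Rightarrow> real) \<Rightarrow> enat" where
  "morse_index G p W lam \<rho> u =
     (SUP X \<in> {X. fun_vs.subspace X \<and> X \<subseteq> H1 G \<inter> Cc G \<and>
                  (\<forall>\<phi> \<in> X - {0}. morse_form G p W lam \<rho> u \<phi> < 0)}. subspace_dim X)"

end

theory Submission
  imports Defs "HOL-Real_Asymp.Real_Asymp"
begin

text \<open>
  Suppose that \<open>lam\<close> is large. Testing the equation with the solution \<open>u\<close> itself (cut off on the half-lines) gives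
  \<open>\<integral> u'\<^sup>2 + (lam - Wbar) c \<le> \<integral> \<rho> |u|\<^sup>p\<close>. If \<open>p < 6\<close>, the Gagliardo--Nirenberg inequality bounds the right hand
  side by a power smaller than one of \<open>\<integral> u'\<^sup>2\<close>, so that \<open>lam\<close> is bounded without any use of the Morse index.

  If \<open>p > 6\<close>, write \<open>q = p - 2\<close> and consider an edge on which \<open>\<rho> \<ge> a\<close>. For \<open>\<phi> = u \<eta>\<close> with \<open>\<eta>\<close> supported inside the
  edge, the quadratic form of the Morse index is \<open>\<integral> u\<^sup>2 \<eta>'\<^sup>2 - q \<integral> \<rho> |u|\<^sup>p \<eta>\<^sup>2\<close>. It is negative for \<open>\<eta> = 1\<close> between two
  zeros of \<open>u\<close>. If \<open>sup |u|\<^sup>q\<close> were much larger than \<open>lam\<close>, then the rescaled solution would be close to an oscillator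
  \<open>- v'' = \<rho> |v|\<^sup>q v\<close> and would have many zeros, hence a large Morse index. So \<open>|u|\<^sup>q\<close> is at most of order \<open>lam\<close>.
  With a tent function \<open>\<eta>\<close> of width \<open>d\<close> of order \<open>1 / sqrt lam\<close> the form is also negative around every point where
  \<open>|u|\<^sup>q \<ge> lam / (2 b)\<close>, so these points lie in boundedly many intervals of length of order \<open>d\<close>. Off these points
  \<open>\<rho> |u|\<^sup>p \<le> (lam / 2) u\<^sup>2\<close>, and on them the integral of \<open>\<rho> |u|\<^sup>p\<close> is of order
  \<open>lam powr (p / q - 1 / 2)\<close>, which is \<open>o(lam)\<close>. This contradicts the energy inequality.
\<close>

section \<open>Oscillation of solutions of second-order equations\<close>

text \<open>The coefficients are only bounded and measurable, so a solution has no pointwise second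
  derivative. The equation is used in integrated form: \<open>second_antiderivative_on\<close> asks
  that \<open>v\<close> have derivative \<open>dv\<close> everywhere and that the increments of
  \<open>dv\<close> be integrals of \<open>h\<close>. All arguments about slopes, zeros and
  integration by parts rest on this form, which the lemma of du Bois-Reymond extracts from the weak
  formulation. The rescaled coefficients need not converge, so no limit profile is taken. The
  oscillation argument is quantitative instead: the length \<open>R\<close> and the tolerance
  \<open>\<epsilon>\<close> depend only on \<open>a\<close>, \<open>b\<close>, \<open>q\<close>, the
  initial height and the number of zeros. Functions that bound the Morse index from below vanish at
  the vertices; the vertex conditions enter through the energy identity alone. Both absorptions
  break down at 6: the kinetic energy appears with exponent \<open>q / 4\<close>, which is below 1
  for \<open>p < 6\<close>, and the exceptional set with the exponent
  \<open>p / q - 1 / 2 = 1 / 2 + 2 / q\<close> of \<open>lam\<close>, which is below 1 for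
  \<open>p > 6\<close>.\<close>

definition second_antiderivative_on ::
  "real set \<Rightarrow> (real \<Rightarrow> real) \<Rightarrow> (real \<Rightarrow> real) \<Rightarrow> (real \<Rightarrow> real) \<Rightarrow> bool" where
  "second_antiderivative_on I v dv h \<longleftrightarrow>
     (\<forall>t\<in>I. (v has_real_derivative dv t) (at t within I)) \<and>
     (\<forall>s\<in>I. \<forall>t\<in>I. s \<le> t \<longrightarrow> (h has_integral (dv t - dv s)) {s..t})"

lemma second_antiderivative_on_subset:
  "second_antiderivative_on I v dv h \<Longrightarrow> J \<subseteq> I \<Longrightarrow> second_antiderivative_on J v dv h"
  unfolding second_antiderivative_on_def by (auto intro: DERIV_subset)

lemma second_antiderivative_on_continuous:
  "second_antiderivative_on I v dv h \<Longrightarrow> continuous_on I v"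
  unfolding second_antiderivative_on_def continuous_on_eq_continuous_within by (auto intro: DERIV_continuous)

lemma second_antiderivative_on_MVT:
  assumes "second_antiderivative_on {s..t} v dv h" "s < t"
  obtains x where "x \<in> {s..t}" "v t - v s = dv x * (t - s)"
proof -
  have d: "(v has_real_derivative dv x) (at x within {s..t})" if "s \<le> x" "x \<le> t" for x
    using assms that by (auto simp: second_antiderivative_on_def)
  from mvt_simple[OF \<open>s < t\<close>, of v "\<lambda>x y. dv x * y"] d
  obtain x where "x \<in> {s<..<t}" "v t - v s = dv x * (t - s)"
    by (auto simp: has_field_derivative_def)
  then show thesis using that[of x] by simp
qed

lemma second_antiderivative_on_deriv_le:
  assumes "second_antiderivative_on {s..t} v dv h" "s \<le> t" "\<And>x. x \<in> {s..t} \<Longrightarrow> h x \<le> k"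
  shows "dv t \<le> dv s + k * (t - s)"
proof -
  have "(h has_integral (dv t - dv s)) {s..t}"
    using assms by (auto simp: second_antiderivative_on_def)
  moreover have "((\<lambda>x. k) has_integral (k * (t - s))) {s..t}"
    using has_integral_const_real[of k s t] assms(2) by (simp add: mult.commute)
  ultimately have "dv t - dv s \<le> k * (t - s)"
    using has_integral_le assms(3) by blast
  then show ?thesis by simp
qed

lemma second_antiderivative_on_uminus:
  "second_antiderivative_on I v dv h \<Longrightarrow> second_antiderivative_on I (\<lambda>x. - v x) (\<lambda>x. - dv x) (\<lambda>x. - h x)"
  unfolding second_antiderivative_on_def
proof (intro conjI ballI impI)
  fix t assume *: "(\<forall>t\<in>I. (v has_real_derivative dv t) (at t within I)) \<and>
      (\<forall>s\<in>I. \<forall>t\<in>I. s \<le> t \<longrightarrow> (h has_integral (dv t - dv s)) {s..t})" and t: "t \<in> I"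
  then show "((\<lambda>x. - v x) has_real_derivative - dv t) (at t within I)"
    by (auto intro: DERIV_minus)
  fix s assume "s \<in> I" "t \<le> s"
  then have "(h has_integral (dv s - dv t)) {t..s}" using * t by blast
  from has_integral_neg[OF this] show "((\<lambda>x. - h x) has_integral (- dv s - - dv t)) {t..s}"
    by simp
qed

text \<open>The mean value theorem gives one point where the slope is at most
  \<open>2 * M / (t - s)\<close>, and the bound on \<open>h\<close> controls how far the slope can
  move from there. Balancing the two terms later dictates windows of length
  \<open>1 / sqrt lam\<close>.\<close>

lemma second_antiderivative_on_deriv_abs_le:
  assumes v: "second_antiderivative_on {s..t} v dv h" and st: "s < t"
    and x: "x \<in> {s..t}"
    and h: "\<And>x. x \<in> {s..t} \<Longrightarrow> \<bar>h x\<bar> \<le> k" and M: "\<And>x. x \<in> {s..t} \<Longrightarrow> \<bar>v x\<bar> \<le> M"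
  shows "\<bar>dv x\<bar> \<le> 2 * M / (t - s) + k * (t - s)"
proof -
  obtain y where y: "y \<in> {s..t}" "v t - v s = dv y * (t - s)"
    using second_antiderivative_on_MVT[OF v st] by blast
  have k0: "0 \<le> k" using h[of s] st by auto
  have le: "\<bar>dv r - dv q\<bar> \<le> k * (t - s)" if "q \<in> {s..t}" "r \<in> {s..t}" "q \<le> r" for q r
  proof -
    have sub: "second_antiderivative_on {q..r} v dv h"
      using second_antiderivative_on_subset[OF v] that by simp
    have "dv r \<le> dv q + k * (r - q)"
      by (rule second_antiderivative_on_deriv_le[OF sub \<open>q \<le> r\<close>]) (metis abs_le_D1 abs_le_D2 atLeastAtMost_iff h order_trans that(1,2))
    moreover have "- dv r \<le> - dv q + k * (r - q)"
      by (rule second_antiderivative_on_deriv_le[OF second_antiderivative_on_uminus[OF sub] \<open>q \<le> r\<close>])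
        (metis abs_le_D1 abs_le_D2 atLeastAtMost_iff h order_trans that(1,2))
    moreover have "k * (r - q) \<le> k * (t - s)" using k0 that by (intro mult_left_mono) auto
    ultimately show ?thesis by linarith
  qed
  have "\<bar>dv x - dv y\<bar> \<le> k * (t - s)"
    using le[of x y] le[of y x] x y(1) by (cases "x \<le> y") (auto simp: abs_minus_commute)
  moreover have "\<bar>dv y\<bar> \<le> 2 * M / (t - s)"
  proof -
    have "\<bar>dv y\<bar> * (t - s) = \<bar>v t - v s\<bar>" using y st by (simp add: abs_mult)
    also have "\<dots> \<le> 2 * M" using M[of s] M[of t] st by auto
    finally show ?thesis using st by (simp add: pos_le_divide_eq)
  qed
  ultimately show ?thesis by linarith
qed

text \<open>The points at level \<open>l\<close> form a nonempty compact set, and its least element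
  works: a smaller value of \<open>v\<close> before it would, by the intermediate value theorem,
  produce an earlier point at that level.\<close>

lemma first_hitting_point:
  fixes v :: "real \<Rightarrow> real"
  assumes "continuous_on {s..t} v" "s \<le> t" "l < v s" "v t \<le> l"
  obtains z where "s < z" "z \<le> t" "v z = l" "\<And>x. x \<in> {s..z} \<Longrightarrow> l \<le> v x"
proof -
  define Z where "Z = {x \<in> {s..t}. v x = l}"
  have "\<exists>x\<ge>s. x \<le> t \<and> v x = l"
    using IVT2'[of v t l s] assms by auto
  then have "Z \<noteq> {}" by (auto simp: Z_def)
  moreover have "compact Z"
  proof -
    have "closed Z" using continuous_closed_preimage_constant[OF assms(1)] unfolding Z_def by blast
    moreover have "bounded Z"
      unfolding Z_def by (rule bounded_subset[OF bounded_closed_interval[of s t]]) blast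
    ultimately show ?thesis by (simp only: compact_eq_bounded_closed)
  qed
  ultimately obtain z where z: "z \<in> Z" "\<And>x. x \<in> Z \<Longrightarrow> z \<le> x"
    using compact_attains_inf[of Z] by blast
  have "l \<le> v x" if x: "x \<in> {s..z}" for x
  proof (rule ccontr)
    assume "\<not> l \<le> v x"
    moreover have "continuous_on {s..x} v"
      using assms(1) by (rule continuous_on_subset) (use x z(1) Z_def in auto)
    ultimately obtain y where "y \<ge> s" "y \<le> x" "v y = l"
      using IVT2'[of v x l s] assms x by auto
    then have "y \<in> Z" using x z(1) by (auto simp: Z_def)
    then have "x = z" using z(2) \<open>y \<le> x\<close> x by fastforce
    then show False using \<open>\<not> l \<le> v x\<close> z(1) by (auto simp: Z_def)
  qed
  moreover have "s < z" using z(1) assms(3) by (cases "s = z") (auto simp: Z_def)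
  ultimately show thesis using that z(1) by (auto simp: Z_def)
qed

text \<open>This is the rescaled equation \<open>v'' = g v\<close>, with \<open>g\<close> within
  \<open>\<epsilon>\<close> of the band between \<open>- b |v|^q\<close> and
  \<open>- a |v|^q\<close>. Asking for a band rather than a formula absorbs the unknown
  coefficients, so constants obtained for oscillators are uniform. The bound by 1 normalises the
  height of the peak.\<close>

definition oscillator ::
  "real \<Rightarrow> real \<Rightarrow> real \<Rightarrow> real \<Rightarrow> real set \<Rightarrow> (real \<Rightarrow> real) \<Rightarrow> (real \<Rightarrow> real) \<Rightarrow> (real \<Rightarrow> real) \<Rightarrow> bool" where
  "oscillator a b q \<epsilon> I v dv g \<longleftrightarrow> second_antiderivative_on I v dv (\<lambda>x. g x * v x) \<and>
     (\<forall>x\<in>I. \<bar>v x\<bar> \<le> 1 \<and> g x \<le> \<epsilon> - a * \<bar>v x\<bar> powr q \<and> - \<epsilon> - b * \<bar>v x\<bar> powr q \<le> g x)"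

lemma oscillator_subset:
  "oscillator a b q \<epsilon> I v dv g \<Longrightarrow> J \<subseteq> I \<Longrightarrow> \<epsilon> \<le> \<delta> \<Longrightarrow> oscillator a b q \<delta> J v dv g"
  using second_antiderivative_on_subset[of I v dv "\<lambda>x. g x * v x" J]
  unfolding oscillator_def by (smt (verit, best) subset_eq)

lemma oscillator_uminus:
  "oscillator a b q \<epsilon> I v dv g \<Longrightarrow> oscillator a b q \<epsilon> I (\<lambda>x. - v x) (\<lambda>x. - dv x) g"
  unfolding oscillator_def using second_antiderivative_on_uminus[of I v dv "\<lambda>x. g x * v x"] by auto

text \<open>Above height \<open>r / 2\<close> the concavity is bounded below, so the bounded
  function \<open>v\<close> must come down in time \<open>T\<close>. It crosses \<open>r / 2\<close>
  with a definite negative slope, which survives down to a zero because \<open>v''\<close> is at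
  most \<open>\<epsilon>\<close> on the way, and survives for a short time beyond it. The depth
  \<open>r'\<close> reached after the zero is the starting height for the next sign change.\<close>

lemma oscillator_sign_change:
  fixes a b q r :: real
  assumes "0 < a" "0 < b" "0 < q" "0 < r"
  obtains R r' \<epsilon> where "0 < R" "0 < r'" "0 < \<epsilon>"
    "\<And>v dv g y. oscillator a b q \<epsilon> {y..y + R} v dv g \<Longrightarrow> r \<le> v y \<Longrightarrow>
       \<exists>z y'. y < z \<and> z < y' \<and> y' \<le> y + R \<and> v z = 0 \<and> v y' \<le> - r'"
proof -
  \<comment> \<open>\<open>B\<close> bounds \<open>|v''|\<close>, \<open>C\<close> the slope at
    \<open>y\<close>, and \<open>k\<close> is the concavity above \<open>r / 2\<close>. In the first
    half of \<open>T\<close> the slope drops from \<open>C\<close> to at most -1, in the second half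
    \<open>v\<close> falls by at least 1. \<open>\<sigma>\<close> is the slope of a descent from
    \<open>r\<close> to \<open>r / 2\<close> in time \<open>T\<close>; \<open>T2\<close> is the time
    to fall by \<open>r / 2\<close> at slope \<open>\<sigma> / 2\<close>; during
    \<open>\<tau>\<close> the slope changes by at most \<open>\<sigma> / 4\<close>. The three
    entries of \<open>\<epsilon>\<close> serve \<open>B\<close>, \<open>k\<close> and the loss of
    slope during \<open>T2\<close>.\<close>
  define B where "B = 1 + b"
  define C where "C = 2 + B"
  define k where "k = a / 2 * (r / 2) powr q * (r / 2)"
  define T where "T = 2 * (C + 1) / k + 2"
  define \<sigma> where "\<sigma> = r / (2 * T)"
  define T2 where "T2 = r / \<sigma>"
  define \<tau> where "\<tau> = \<sigma> / (4 * B)"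
  define \<epsilon> where "\<epsilon> = min 1 (min (a / 2 * (r / 2) powr q) (\<sigma> / (2 * T2)))"
  define R where "R = T + T2 + \<tau>"
  have pos: "0 < B" "0 < C" "0 < k" using assms by (auto simp: B_def C_def k_def)
  then have "T \<ge> 2" by (simp add: T_def)
  then have "0 < \<sigma>" using assms by (simp add: \<sigma>_def)
  then have "0 < T2" "0 < \<tau>" using assms pos by (auto simp: T2_def \<tau>_def)
  have "0 < \<epsilon>" using assms \<open>0 < \<sigma>\<close> \<open>0 < T2\<close> by (simp add: \<epsilon>_def)
  have eps: "\<epsilon> \<le> 1" "\<epsilon> \<le> a / 2 * (r / 2) powr q" "\<epsilon> \<le> \<sigma> / (2 * T2)" by (auto simp: \<epsilon>_def)
  have "\<exists>z y'. y < z \<and> z < y' \<and> y' \<le> y + R \<and> v z = 0 \<and> v y' \<le> - (\<sigma> / 4 * \<tau>)"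
    if o: "oscillator a b q \<epsilon> {y..y + R} v dv g" and ry: "r \<le> v y" for v dv g y
  proof -
    let ?h = "\<lambda>x. g x * v x"
    have v: "second_antiderivative_on {y..y + R} v dv ?h"
      and v1: "\<And>x. x \<in> {y..y+R} \<Longrightarrow> \<bar>v x\<bar> \<le> 1"
      and gu: "\<And>x. x \<in> {y..y+R} \<Longrightarrow> g x \<le> \<epsilon> - a * \<bar>v x\<bar> powr q"
      and gl: "\<And>x. x \<in> {y..y+R} \<Longrightarrow> - \<epsilon> - b * \<bar>v x\<bar> powr q \<le> g x"
      using o by (auto simp: oscillator_def)
    have vs: "second_antiderivative_on {s..t} v dv ?h" if "y \<le> s" "t \<le> y + R" for s t
      using second_antiderivative_on_subset[OF v] that by simp
    have cont: "continuous_on {s..t} v" if "y \<le> s" "t \<le> y + R" for s t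
      using second_antiderivative_on_continuous[OF vs[OF that]] .
    have hB: "\<bar>?h x\<bar> \<le> B" if x: "x \<in> {y..y+R}" for x
    proof -
      have p1: "\<bar>v x\<bar> powr q \<le> 1" using v1[OF x] assms powr_mono2[of q "\<bar>v x\<bar>" 1] by auto
      have "0 \<le> a * \<bar>v x\<bar> powr q" "b * \<bar>v x\<bar> powr q \<le> b" "0 \<le> b"
        using assms p1 by (auto simp: mult_left_le)
      then have "\<bar>g x\<bar> \<le> B" using gu[OF x] gl[OF x] eps(1) unfolding B_def by linarith
      then have "\<bar>g x\<bar> * \<bar>v x\<bar> \<le> B * 1" using v1[OF x] pos by (intro mult_mono) auto
      then show ?thesis by (simp add: abs_mult)
    qed
    have hk: "?h x \<le> - k" if x: "x \<in> {y..y+R}" and vx: "r / 2 \<le> v x" for x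
    proof -
      have "(r / 2) powr q \<le> \<bar>v x\<bar> powr q" using vx assms by (intro powr_mono2) auto
      then have "a * (r / 2) powr q \<le> a * \<bar>v x\<bar> powr q" using assms by simp
      then have "g x \<le> - (a / 2 * (r / 2) powr q)" using gu[OF x] eps(2) by (simp add: field_simps)
      moreover have "0 \<le> a / 2 * (r / 2) powr q" using assms by simp
      ultimately have "a / 2 * (r / 2) powr q * (r / 2) \<le> (- g x) * v x"
        using vx assms by (intro mult_mono) linarith+
      then show ?thesis by (simp add: k_def)
    qed
    have RT: "R \<ge> T" "R \<ge> 1" using \<open>T \<ge> 2\<close> \<open>0 < T2\<close> \<open>0 < \<tau>\<close> by (auto simp: R_def)
    have dy: "dv y \<le> C"
      using second_antiderivative_on_deriv_abs_le[OF vs[of y "y+1"], of y B 1] hB v1 RT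
      by (auto simp: C_def)
    have "\<exists>x\<in>{y..y+T}. v x < r / 2"
    proof (rule ccontr)
      assume "\<not> ?thesis"
      then have ge: "r / 2 \<le> v x" if "x \<in> {y..y+T}" for x using that by force
      have d: "dv x \<le> - 1" if x: "x \<in> {y + T/2..y+T}" for x
      proof -
        have "dv x \<le> dv y + (- k) * (x - y)"
          by (rule second_antiderivative_on_deriv_le[OF vs]) (use x RT \<open>T \<ge> 2\<close> hk ge in auto)
        also have "\<dots> \<le> C + (- k) * (T/2)"
          using dy x pos by (intro add_mono mult_left_mono_neg) auto
        also have "\<dots> \<le> - 1" using pos unfolding T_def by (simp add: field_simps)
        finally show ?thesis .
      qed
      obtain x where "x \<in> {y + T/2..y+T}" "v (y + T) - v (y + T/2) = dv x * (T/2)"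
        using second_antiderivative_on_MVT[OF vs[of "y + T/2" "y + T"]] RT \<open>T \<ge> 2\<close>
        by (auto simp: field_simps)
      moreover from d[OF this(1)] have "dv x * (T/2) \<le> - 1 * (T/2)"
        using \<open>T \<ge> 2\<close> by (intro mult_right_mono) auto
      moreover have "v (y + T/2) \<le> 1" using v1[of "y + T/2"] RT \<open>T \<ge> 2\<close> by auto
      ultimately have "v (y + T) \<le> 0" using \<open>T \<ge> 2\<close> by linarith
      then show False using ge[of "y + T"] \<open>T \<ge> 2\<close> assms by auto
    qed
    then obtain x1 where x1: "x1 \<in> {y..y+T}" "v x1 < r / 2" by blast
    obtain y1 where y1: "y < y1" "y1 \<le> x1" "v y1 = r / 2" "\<And>x. x \<in> {y..y1} \<Longrightarrow> r / 2 \<le> v x"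
      using first_hitting_point[OF cont, of y x1 "r / 2"] x1 RT assms ry by auto
    then have y1T: "y1 \<le> y + T" using x1 by auto
    obtain \<xi> where \<xi>: "\<xi> \<in> {y..y1}" "v y1 - v y = dv \<xi> * (y1 - y)"
      using second_antiderivative_on_MVT[OF vs[of y y1]] y1 y1T RT by auto
    \<comment> \<open>The mean value theorem gives a negative slope only at some
      \<open>\<xi>\<close> before \<open>y1\<close>; concavity above \<open>r / 2\<close> carries it
      on to \<open>y1\<close>.\<close>
    have "dv y1 \<le> dv \<xi> + (- k) * (y1 - \<xi>)"
      by (rule second_antiderivative_on_deriv_le[OF vs]) (use \<xi> y1T RT hk y1 in auto)
    also have "\<dots> \<le> dv \<xi>" using pos \<xi> by auto
    also have "dv \<xi> \<le> - \<sigma>"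
    proof -
      have "dv \<xi> * (y1 - y) \<le> - (r / 2)" using \<xi> y1 ry by simp
      moreover have "- \<sigma> * (y1 - y) \<ge> - \<sigma> * T"
        using y1T \<open>0 < \<sigma>\<close> y1(1) by (intro mult_left_mono_neg) auto
      moreover have "\<sigma> * T = r / 2" using \<open>T \<ge> 2\<close> by (simp add: \<sigma>_def)
      ultimately have "dv \<xi> * (y1 - y) \<le> - \<sigma> * (y1 - y)" by linarith
      then show ?thesis using y1(1) mult_le_cancel_right_pos[of "y1 - y" "dv \<xi>" "- \<sigma>"] by simp
    qed
    finally have dy1: "dv y1 \<le> - \<sigma>" .
    have y1R: "y1 + T2 \<le> y + R" using y1T \<open>0 < \<tau>\<close> by (simp add: R_def)
    \<comment> \<open>Below \<open>r / 2\<close> the function may become convex, but as long as it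
      is nonnegative \<open>v''\<close> is at most \<open>\<epsilon>\<close>, which costs at most
      half of the slope during \<open>T2\<close>.\<close>
    have slope: "dv x \<le> - (\<sigma> / 2)"
      if x: "x \<in> {y1..y1 + T2}" and nn: "\<And>t. t \<in> {y1..x} \<Longrightarrow> 0 \<le> v t" for x
    proof -
      have "?h t \<le> \<epsilon>" if t: "t \<in> {y1..x}" for t
      proof -
        have tt: "t \<in> {y..y+R}" using t x y1R y1 by auto
        have "g t \<le> \<epsilon>" using gu[OF tt] assms(1) by (smt (verit) mult_nonneg_nonneg powr_ge_zero)
        then show ?thesis
          using v1[OF tt] nn[OF t] \<open>0 < \<epsilon>\<close> by (smt (verit) mult_left_le mult_right_mono)
      qed
      then have "dv x \<le> dv y1 + \<epsilon> * (x - y1)"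
        by (intro second_antiderivative_on_deriv_le[OF vs]) (use x y1R y1 in auto)
      also have "\<dots> \<le> - \<sigma> + \<sigma> / (2 * T2) * T2"
        using dy1 x eps(3) \<open>0 < \<epsilon>\<close> by (intro add_mono mult_mono) auto
      finally show ?thesis using \<open>0 < T2\<close> by simp
    qed
    have "\<exists>x\<in>{y1..y1+T2}. v x \<le> 0"
    proof (rule ccontr)
      assume "\<not> ?thesis"
      then have gt: "0 < v x" if "x \<in> {y1..y1+T2}" for x using that by force
      obtain x where "x \<in> {y1..y1+T2}" "v (y1 + T2) - v y1 = dv x * T2"
        using second_antiderivative_on_MVT[OF vs[of y1 "y1 + T2"]] y1R y1 \<open>0 < T2\<close> by auto
      moreover have "dv x * T2 \<le> - (\<sigma> / 2) * T2"
        using calculation(1) gt \<open>0 < T2\<close> by (intro mult_right_mono slope) (auto intro: less_imp_le)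
      moreover have "(\<sigma> / 2) * T2 = r / 2" using \<open>0 < \<sigma>\<close> by (simp add: T2_def)
      ultimately show False using y1(3) gt[of "y1 + T2"] \<open>0 < T2\<close> by auto
    qed
    then obtain x2 where x2: "x2 \<in> {y1..y1+T2}" "v x2 \<le> 0" by blast
    obtain z where z: "y1 < z" "z \<le> x2" "v z = 0" "\<And>x. x \<in> {y1..z} \<Longrightarrow> 0 \<le> v x"
      using first_hitting_point[OF cont, of y1 x2 0] x2 y1R y1 assms by auto
    have dz: "dv z \<le> - (\<sigma> / 2)" using slope[of z] z x2 by auto
    have zR: "z + \<tau> \<le> y + R" using z x2 y1T by (auto simp: R_def)
    obtain x where x: "x \<in> {z..z+\<tau>}" "v (z + \<tau>) - v z = dv x * \<tau>"
      using second_antiderivative_on_MVT[OF vs[of z "z + \<tau>"]] zR z y1 \<open>0 < \<tau>\<close> by auto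
    have "dv x \<le> dv z + B * (x - z)"
      by (rule second_antiderivative_on_deriv_le[OF vs]) (use x zR y1 z hB in \<open>auto simp: abs_le_iff\<close>)
    also have "\<dots> \<le> - (\<sigma> / 2) + B * \<tau>" using dz x pos by (intro add_mono mult_left_mono) auto
    also have "\<dots> = - (\<sigma> / 4)" using pos by (simp add: \<tau>_def)
    finally have "dv x * \<tau> \<le> - (\<sigma> / 4) * \<tau>" using \<open>0 < \<tau>\<close> by (intro mult_right_mono) auto
    then have "v (z + \<tau>) \<le> - (\<sigma> / 4 * \<tau>)" using x z by simp
    then show ?thesis using zR y1 z \<open>0 < \<tau>\<close> by (intro exI[of _ z] exI[of _ "z + \<tau>"]) auto
  qed
  moreover have "0 < R" "0 < \<sigma> / 4 * \<tau>"
    using \<open>T \<ge> 2\<close> \<open>0 < T2\<close> \<open>0 < \<tau>\<close> \<open>0 < \<sigma>\<close> by (auto simp: R_def)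
  ultimately show thesis using that \<open>0 < \<epsilon>\<close> by blast
qed

text \<open>Induction on the number of zeros. Each sign change ends at a point where
  \<open>|v|\<close> is at least some new height, and the reflection \<open>- v\<close> restarts the
  argument there; the height \<open>r\<close> is therefore arbitrary in the induction. The nonzero
  values between consecutive zeros are recorded because they make the nodal intervals nontrivial
  later.\<close>

lemma oscillator_zeros:
  fixes a b q r :: real
  assumes "0 < a" "0 < b" "0 < q" "0 < r"
  obtains R \<epsilon> where "0 < R" "0 < \<epsilon>"
    "\<And>v dv g y. oscillator a b q \<epsilon> {y..y + R} v dv g \<Longrightarrow> r \<le> \<bar>v y\<bar> \<Longrightarrow>
       \<exists>z. (\<forall>i\<le>N. y < z i \<and> z i \<le> y + R \<and> v (z i) = 0) \<and>
           (\<forall>i<N. z i < z (Suc i) \<and> (\<exists>x. z i < x \<and> x < z (Suc i) \<and> v x \<noteq> 0))"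
  using assms(4)
proof (induction N arbitrary: r thesis)
  case 0
  obtain R r' \<epsilon> where *: "0 < R" "0 < r'" "0 < \<epsilon>"
    "\<And>v dv g y. oscillator a b q \<epsilon> {y..y + R} v dv g \<Longrightarrow> r \<le> v y \<Longrightarrow>
       \<exists>z y'. y < z \<and> z < y' \<and> y' \<le> y + R \<and> v z = 0 \<and> v y' \<le> - r'"
    using oscillator_sign_change[OF assms(1-3) 0(2)] by metis
  show ?case
  proof (rule 0(1)[OF *(1,3)])
    fix v dv g y assume o: "oscillator a b q \<epsilon> {y..y + R} v dv g" and r: "r \<le> \<bar>v y\<bar>"
    have "\<exists>z. y < z \<and> z \<le> y + R \<and> v z = 0"
    proof (cases "0 \<le> v y")
      case True
      then show ?thesis using *(4)[OF o] r 0(2) by (smt (verit))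
    next
      case False
      then have "r \<le> - v y" using r by simp
      from *(4)[OF oscillator_uminus[OF o] this] show ?thesis by (smt (verit))
    qed
    then obtain z where "y < z \<and> z \<le> y + R \<and> v z = 0" by blast
    then show "\<exists>z. (\<forall>i\<le>0. y < z i \<and> z i \<le> y + R \<and> v (z i) = 0) \<and>
        (\<forall>i<0::nat. z i < z (Suc i) \<and> (\<exists>x. z i < x \<and> x < z (Suc i) \<and> v x \<noteq> 0))"
      by (intro exI[of _ "\<lambda>_. z"]) auto
  qed
next
  case (Suc N)
  obtain R1 r' \<epsilon>1 where 1: "0 < R1" "0 < r'" "0 < \<epsilon>1"
    "\<And>v dv g y. oscillator a b q \<epsilon>1 {y..y + R1} v dv g \<Longrightarrow> r \<le> v y \<Longrightarrow>
       \<exists>z y'. y < z \<and> z < y' \<and> y' \<le> y + R1 \<and> v z = 0 \<and> v y' \<le> - r'"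
    using oscillator_sign_change[OF assms(1-3) Suc(3)] by metis
  obtain R2 \<epsilon>2 where 2: "0 < R2" "0 < \<epsilon>2"
    "\<And>v dv g y. oscillator a b q \<epsilon>2 {y..y + R2} v dv g \<Longrightarrow> r' \<le> \<bar>v y\<bar> \<Longrightarrow>
       \<exists>z. (\<forall>i\<le>N. y < z i \<and> z i \<le> y + R2 \<and> v (z i) = 0) \<and>
           (\<forall>i<N. z i < z (Suc i) \<and> (\<exists>x. z i < x \<and> x < z (Suc i) \<and> v x \<noteq> 0))"
    using Suc.IH[OF _ 1(2)] by metis
  show ?case
  proof (rule Suc.prems(1)[of "R1 + R2" "min \<epsilon>1 \<epsilon>2"])
    show "0 < R1 + R2" "0 < min \<epsilon>1 \<epsilon>2" using 1 2 by auto
    fix v dv g y assume o: "oscillator a b q (min \<epsilon>1 \<epsilon>2) {y..y + (R1 + R2)} v dv g" and r: "r \<le> \<bar>v y\<bar>"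
    have o1: "oscillator a b q \<epsilon>1 {y..y + R1} v dv g"
      by (rule oscillator_subset[OF o]) (use 2 in auto)
    have "\<exists>z y'. y < z \<and> z < y' \<and> y' \<le> y + R1 \<and> v z = 0 \<and> r' \<le> \<bar>v y'\<bar>"
    proof (cases "0 \<le> v y")
      case True
      then show ?thesis using 1(4)[OF o1] r 1(2) by (smt (verit))
    next
      case False
      then have "r \<le> - v y" using r by simp
      from 1(4)[OF oscillator_uminus[OF o1] this] show ?thesis using 1(2) by (smt (verit))
    qed
    then obtain z0 y' where z0: "y < z0" "z0 < y'" "y' \<le> y + R1" "v z0 = 0" "r' \<le> \<bar>v y'\<bar>" by blast
    have "oscillator a b q \<epsilon>2 {y'..y' + R2} v dv g"
      by (rule oscillator_subset[OF o]) (use 2 z0 in auto)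
    from 2(3)[OF this z0(5)] obtain z where
      z: "\<And>i. i \<le> N \<Longrightarrow> y' < z i \<and> z i \<le> y' + R2 \<and> v (z i) = 0"
        "\<And>i. i < N \<Longrightarrow> z i < z (Suc i) \<and> (\<exists>x. z i < x \<and> x < z (Suc i) \<and> v x \<noteq> 0)" by blast
    \<comment> \<open>The new zero \<open>z0\<close> is put in front of those found from
      \<open>y'\<close> on. The point \<open>y'\<close> lies between \<open>z0\<close> and
      \<open>z 0\<close>, and \<open>v\<close> is not zero there.\<close>
    let ?z = "\<lambda>i. if i = 0 then z0 else z (i - 1)"
    have "y < ?z i \<and> ?z i \<le> y + (R1 + R2) \<and> v (?z i) = 0" if "i \<le> Suc N" for i
      using z(1)[of "i - 1"] z0 that 2(1) by (cases i) auto
    moreover have "?z i < ?z (Suc i) \<and> (\<exists>x. ?z i < x \<and> x < ?z (Suc i) \<and> v x \<noteq> 0)" if "i < Suc N" for i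
    proof (cases i)
      case 0
      then show ?thesis using z(1)[of 0] z0 1(2) by auto
    next
      case (Suc j)
      then show ?thesis using z(2)[of j] that by simp
    qed
    ultimately show "\<exists>z. (\<forall>i\<le>Suc N. y < z i \<and> z i \<le> y + (R1 + R2) \<and> v (z i) = 0) \<and>
           (\<forall>i<Suc N. z i < z (Suc i) \<and> (\<exists>x. z i < x \<and> x < z (Suc i) \<and> v x \<noteq> 0))"
      by (intro exI[of _ ?z]) blast
  qed
qed

section \<open>Locally integrable functions and test functions\<close>

text \<open>On a half-line square integrable functions need not be integrable; local integrability
  is what pairing with compactly supported test functions requires. Compact intervals that touch the
  boundary of \<open>I\<close> are included.\<close>

definition locally_integrable_on :: "(real \<Rightarrow> real) \<Rightarrow> real set \<Rightarrow> bool" where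
  "locally_integrable_on g I \<longleftrightarrow> (\<forall>s t. {s..t} \<subseteq> I \<longrightarrow> integrable (lebesgue_on {s..t}) g)"

lemma integrable_lebesgue_on_iff_absolutely_integrable_on:
  fixes f :: "real \<Rightarrow> real"
  shows "S \<in> sets lebesgue \<Longrightarrow> integrable (lebesgue_on S) f \<longleftrightarrow> f absolutely_integrable_on S"
  by (simp add: set_integrable_def integrable_restrict_space)

lemma integrable_lebesgue_on_mult_continuous:
  fixes g :: "real \<Rightarrow> real"
  assumes "integrable (lebesgue_on {s..t}) g" "continuous_on {s..t} \<phi>"
  shows "integrable (lebesgue_on {s..t}) (\<lambda>x. g x * \<phi> x)"
proof -
  have "(\<lambda>x. \<phi> x * g x) absolutely_integrable_on {s..t}"
  proof (rule absolutely_integrable_bounded_measurable_product_real)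
    show "\<phi> \<in> borel_measurable (lebesgue_on {s..t})"
      by (rule continuous_imp_measurable_on_sets_lebesgue[OF assms(2)]) simp
    show "bounded (\<phi> ` {s..t})"
      using compact_continuous_image[OF assms(2)] compact_imp_bounded by blast
    show "g absolutely_integrable_on {s..t}"
      using assms(1) by (simp add: integrable_lebesgue_on_iff_absolutely_integrable_on)
  qed simp
  then show ?thesis
    by (simp add: integrable_lebesgue_on_iff_absolutely_integrable_on mult.commute)
qed

lemma integrable_lebesgue_on_continuous:
  fixes g :: "real \<Rightarrow> real"
  shows "continuous_on {s..t} g \<Longrightarrow> integrable (lebesgue_on {s..t}) g"
  by (simp add: integrable_lebesgue_on_iff_absolutely_integrable_on absolutely_integrable_continuous_real)

lemma locally_integrable_on_continuous: "continuous_on I g \<Longrightarrow> locally_integrable_on g I"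
  unfolding locally_integrable_on_def
  by (auto intro!: integrable_lebesgue_on_continuous intro: continuous_on_subset)

lemma locally_integrable_on_diff:
  "locally_integrable_on f I \<Longrightarrow> locally_integrable_on g I \<Longrightarrow> locally_integrable_on (\<lambda>x. f x - g x) I"
  unfolding locally_integrable_on_def by auto

lemma lebesgue_on_supported:
  fixes f :: "real \<Rightarrow> real"
  assumes "S \<subseteq> I" "S \<in> sets lebesgue" "I \<in> sets lebesgue" "\<And>x. x \<in> I - S \<Longrightarrow> f x = 0"
  shows "integrable (lebesgue_on I) f \<longleftrightarrow> integrable (lebesgue_on S) f"
    and "(LINT x|lebesgue_on I. f x) = (LINT x|lebesgue_on S. f x)"
proof -
  have "(\<lambda>x. indicator I x *\<^sub>R f x) = (\<lambda>x. indicator S x *\<^sub>R f x)"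
    using assms by (auto simp: fun_eq_iff indicator_def)
  then show "integrable (lebesgue_on I) f \<longleftrightarrow> integrable (lebesgue_on S) f"
    "(LINT x|lebesgue_on I. f x) = (LINT x|lebesgue_on S. f x)"
    using assms by (simp_all add: integrable_restrict_space integral_restrict_space)
qed

lemma C1_differentiable_on_UNIV_iff:
  fixes \<phi> :: "real \<Rightarrow> real"
  shows "\<phi> C1_differentiable_on UNIV \<longleftrightarrow>
    (\<forall>x. (\<phi> has_real_derivative deriv \<phi> x) (at x)) \<and> continuous_on UNIV (deriv \<phi>)"
proof
  assume "\<phi> C1_differentiable_on UNIV"
  then obtain D where D: "\<And>x. (\<phi> has_real_derivative D x) (at x)" "continuous_on UNIV D"
    unfolding C1_differentiable_on_def has_real_derivative_iff_has_vector_derivative by auto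
  then have "deriv \<phi> = D" by (auto intro: DERIV_imp_deriv)
  then show "(\<forall>x. (\<phi> has_real_derivative deriv \<phi> x) (at x)) \<and> continuous_on UNIV (deriv \<phi>)"
    using D by simp
next
  assume "(\<forall>x. (\<phi> has_real_derivative deriv \<phi> x) (at x)) \<and> continuous_on UNIV (deriv \<phi>)"
  then show "\<phi> C1_differentiable_on UNIV"
    unfolding C1_differentiable_on_def has_real_derivative_iff_has_vector_derivative by auto
qed

lemma C1_differentiable_on_UNIV_I:
  fixes \<phi> :: "real \<Rightarrow> real"
  assumes "\<And>x. (\<phi> has_real_derivative D x) (at x)" "continuous_on UNIV D"
  shows "\<phi> C1_differentiable_on UNIV" "deriv \<phi> = D"
proof -
  show "deriv \<phi> = D" using assms(1) by (auto intro: DERIV_imp_deriv)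
  then show "\<phi> C1_differentiable_on UNIV" using assms by (simp add: C1_differentiable_on_UNIV_iff)
qed

definition test_function_on :: "real set \<Rightarrow> (real \<Rightarrow> real) \<Rightarrow> bool" where
  "test_function_on I \<phi> \<longleftrightarrow> \<phi> C1_differentiable_on UNIV \<and>
     (\<exists>K. compact K \<and> K \<subseteq> interior I \<and> (\<forall>x. x \<notin> K \<longrightarrow> \<phi> x = 0))"

lemma has_weak_derivative_iff:
  "has_weak_derivative f g I \<longleftrightarrow> (\<forall>\<phi>. test_function_on I \<phi> \<longrightarrow>
     (LINT x|lebesgue_on I. f x * deriv \<phi> x) = - (LINT x|lebesgue_on I. g x * \<phi> x))"
  unfolding has_weak_derivative_def test_function_on_def by blast

lemma test_function_on_DERIV:
  "test_function_on I \<phi> \<Longrightarrow> (\<phi> has_real_derivative deriv \<phi> x) (at x)"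
  "test_function_on I \<phi> \<Longrightarrow> continuous_on S (deriv \<phi>)"
  "test_function_on I \<phi> \<Longrightarrow> continuous_on S \<phi>"
proof -
  assume "test_function_on I \<phi>"
  then have *: "\<And>x. (\<phi> has_real_derivative deriv \<phi> x) (at x)" "continuous_on UNIV (deriv \<phi>)"
    unfolding test_function_on_def C1_differentiable_on_UNIV_iff by auto
  then show "(\<phi> has_real_derivative deriv \<phi> x) (at x)" "continuous_on S (deriv \<phi>)"
    using continuous_on_subset by blast+
  show "continuous_on S \<phi>"
    by (rule DERIV_continuous_on[of _ _ "deriv \<phi>"]) (use * in \<open>blast intro: DERIV_subset\<close>)
qed

lemma test_function_on_support:
  assumes "test_function_on I \<phi>" "is_interval I" "{s0..t0} \<subseteq> interior I" "s0 \<le> t0"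
  obtains s t where "s \<le> s0" "t0 \<le> t" "{s..t} \<subseteq> interior I"
    "\<And>x. x \<notin> {s..t} \<Longrightarrow> \<phi> x = 0" "\<And>x. x \<notin> {s..t} \<Longrightarrow> deriv \<phi> x = 0"
proof -
  obtain K where K: "compact K" "K \<subseteq> interior I" "\<And>x. x \<notin> K \<Longrightarrow> \<phi> x = 0"
    using assms(1) unfolding test_function_on_def by blast
  \<comment> \<open>Inserting both points makes the set nonempty and forces the interval spanned by
    it to contain \<open>{s0..t0}\<close>.\<close>
  define K' where "K' = insert s0 (insert t0 K)"
  have K': "compact K'" "K' \<noteq> {}" "K' \<subseteq> interior I" using K assms(3,4) by (auto simp: K'_def)
  obtain s where s: "s \<in> K'" "\<And>x. x \<in> K' \<Longrightarrow> s \<le> x"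
    using compact_attains_inf[OF K'(1,2)] by auto
  obtain t where t: "t \<in> K'" "\<And>x. x \<in> K' \<Longrightarrow> x \<le> t"
    using compact_attains_sup[OF K'(1,2)] by auto
  have st: "{s..t} \<subseteq> interior I"
  proof -
    have "is_interval (interior I)"
      using assms(2) by (simp add: convex_interior is_interval_convex_1)
    then show ?thesis
      using s(1) t(1) K'(3) unfolding is_interval_1 by (auto simp: subset_iff)
  qed
  have z: "\<phi> x = 0" if "x \<notin> {s..t}" for x
    using K(3)[of x] s(2)[of x] t(2)[of x] that by (auto simp: K'_def)
  have dz: "deriv \<phi> x = 0" if x: "x \<notin> {s..t}" for x
  proof -
    have "((\<lambda>x. 0) has_real_derivative 0) (at x)" by simp
    then have "(\<phi> has_real_derivative 0) (at x)"
      by (rule has_field_derivative_transform_within_open[of _ _ _ "- {s..t}"]) (use x z in auto)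
    then show ?thesis by (rule DERIV_imp_deriv)
  qed
  show thesis
    by (rule that[of s t]) (use s t st z dz in \<open>auto simp: K'_def\<close>)
qed

lemma integral_mult_supported:
  assumes g: "locally_integrable_on g I" and I: "I \<in> sets lebesgue" "{s..t} \<subseteq> I"
    and \<phi>: "continuous_on {s..t} \<phi>" "\<And>x. x \<notin> {s..t} \<Longrightarrow> \<phi> x = 0"
  shows "integrable (lebesgue_on I) (\<lambda>x. g x * \<phi> x)"
    and "(LINT x|lebesgue_on I. g x * \<phi> x) = (LINT x|lebesgue_on {s..t}. g x * \<phi> x)"
    and "(LINT x|lebesgue_on I. g x * \<phi> x) = integral {s..t} (\<lambda>x. g x * \<phi> x)"
proof -
  have i: "integrable (lebesgue_on {s..t}) (\<lambda>x. g x * \<phi> x)"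
    by (rule integrable_lebesgue_on_mult_continuous) (use g I \<phi> in \<open>auto simp: locally_integrable_on_def\<close>)
  show "integrable (lebesgue_on I) (\<lambda>x. g x * \<phi> x)"
    using lebesgue_on_supported(1)[of "{s..t}" I "\<lambda>x. g x * \<phi> x"] i I \<phi>(2) by auto
  show "(LINT x|lebesgue_on I. g x * \<phi> x) = (LINT x|lebesgue_on {s..t}. g x * \<phi> x)"
    using lebesgue_on_supported(2)[of "{s..t}" I "\<lambda>x. g x * \<phi> x"] I \<phi>(2) by auto
  then show "(LINT x|lebesgue_on I. g x * \<phi> x) = integral {s..t} (\<lambda>x. g x * \<phi> x)"
    using lebesgue_integral_eq_integral[OF i] by simp
qed

section \<open>Continuously differentiable cutoff functions\<close>

lemma DERIV_max_0_square: "((\<lambda>x::real. (max 0 x)\<^sup>2) has_real_derivative 2 * max 0 x) (at x)"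
proof (cases x "0::real" rule: linorder_cases)
  case less
  have "((\<lambda>x::real. 0) has_real_derivative 0) (at x)" by simp
  then have "((\<lambda>x::real. (max 0 x)\<^sup>2) has_real_derivative 0) (at x)"
    by (rule has_field_derivative_transform_within_open[of _ _ _ "{..<0}"]) (use less in auto)
  then show ?thesis using less by simp
next
  case greater
  have "((\<lambda>x::real. x\<^sup>2) has_real_derivative 2 * x) (at x)" by (auto intro!: derivative_eq_intros)
  then have "((\<lambda>x::real. (max 0 x)\<^sup>2) has_real_derivative 2 * x) (at x)"
    by (rule has_field_derivative_transform_within_open[of _ _ _ "{0<..}"]) (use greater in auto)
  then show ?thesis using greater by simp
next
  case equal
  have "(\<lambda>h::real. (max 0 h)\<^sup>2 / h) \<midarrow>0\<rightarrow> 0"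
  proof (rule Lim_null_comparison)
    show "\<forall>\<^sub>F h::real in at 0. norm ((max 0 h)\<^sup>2 / h) \<le> \<bar>h\<bar>"
      by (intro always_eventually allI) (auto simp: max_def power2_eq_square abs_mult)
    show "((\<lambda>h::real. \<bar>h\<bar>) \<longlongrightarrow> 0) (at 0)" by (rule tendsto_rabs_zero) simp
  qed
  then show ?thesis using equal by (simp add: DERIV_def)
qed

text \<open>A bump supported in \<open>[s, t]\<close> that tends to the indicator of the open
  interval as \<open>k\<close> grows. It has the form \<open>k P / (1 + k P)\<close> with
  \<open>P\<close> the square of a positive part, and squaring removes the kink of
  \<open>max 0\<close>.\<close>

definition cutoff :: "real \<Rightarrow> real \<Rightarrow> real \<Rightarrow> real \<Rightarrow> real" where
  "cutoff s t k x = k * (max 0 ((x - s) * (t - x)))\<^sup>2 / (1 + k * (max 0 ((x - s) * (t - x)))\<^sup>2)"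

lemma cutoff_bounds: "0 \<le> k \<Longrightarrow> 0 \<le> cutoff s t k x \<and> cutoff s t k x \<le> 1"
  unfolding cutoff_def by (auto simp: divide_simps) (smt (verit) mult_nonneg_nonneg zero_le_power2)

lemma cutoff_outside: "x \<notin> {s<..<t} \<Longrightarrow> s \<le> t \<Longrightarrow> cutoff s t k x = 0"
proof -
  assume "x \<notin> {s<..<t}" "s \<le> t"
  then have "(x - s) * (t - x) \<le> 0"
    by (auto simp: mult_le_0_iff)
  then show ?thesis by (simp add: cutoff_def)
qed

lemma cutoff_tendsto_1: "x \<in> {s<..<t} \<Longrightarrow> (\<lambda>n. cutoff s t (real n) x) \<longlonglongrightarrow> 1"
proof -
  assume x: "x \<in> {s<..<t}"
  define P where "P = (max 0 ((x - s) * (t - x)))\<^sup>2"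
  have P: "P > 0" using x by (simp add: P_def)
  have "(\<lambda>n. 1 - 1 / (1 + real n * P)) \<longlonglongrightarrow> 1 - 0"
  proof (intro tendsto_diff tendsto_const)
    have "filterlim (\<lambda>n. 1 + real n * P) at_top sequentially"
      using P by (intro filterlim_tendsto_add_at_top[OF tendsto_const] filterlim_at_top_mult_tendsto_pos[OF tendsto_const]
          filterlim_real_sequentially)
    then show "(\<lambda>n. 1 / (1 + real n * P)) \<longlonglongrightarrow> 0"
      using tendsto_divide_0[OF tendsto_const filterlim_at_top_imp_at_infinity] by blast
  qed
  moreover have "1 - 1 / (1 + real n * P) = cutoff s t (real n) x" for n
  proof -
    have "1 + real n * P > 0" using P by (simp add: add_pos_nonneg)
    then show ?thesis unfolding cutoff_def P_def[symmetric] by (simp add: field_simps)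
  qed
  ultimately show ?thesis by simp
qed

lemma test_function_on_cutoff:
  assumes "{s..t} \<subseteq> interior I" "s \<le> t" "0 \<le> k"
  shows "test_function_on I (cutoff s t k)"
proof -
  define q where "q = (\<lambda>x. (x - s) * (t - x))"
  define P where "P = (\<lambda>x. (max 0 (q x))\<^sup>2)"
  define P' where "P' = (\<lambda>x. 2 * max 0 (q x) * (s + t - 2 * x))"
  have q: "(q has_real_derivative (s + t - 2 * x)) (at x)" for x
    unfolding q_def by (auto intro!: derivative_eq_intros)
  have P: "(P has_real_derivative P' x) (at x)" for x
    unfolding P_def P'_def by (rule DERIV_chain2[OF DERIV_max_0_square q])
  have pos: "1 + k * P x > 0" for x using assms(3) by (simp add: P_def add_pos_nonneg)
  have c: "cutoff s t k = (\<lambda>x. k * P x / (1 + k * P x))"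
    by (simp add: fun_eq_iff cutoff_def P_def q_def)
  have "((\<lambda>x. k * P x / (1 + k * P x)) has_real_derivative k * P' x / (1 + k * P x)\<^sup>2) (at x)" for x
    using pos[of x] by (auto intro!: derivative_eq_intros P simp: field_simps power2_eq_square)
  moreover have "continuous_on UNIV (\<lambda>x. k * P' x / (1 + k * P x)\<^sup>2)"
    unfolding P_def P'_def q_def
    by (intro continuous_intros ballI) (use pos in \<open>auto simp: P_def q_def less_le\<close>)
  ultimately have "cutoff s t k C1_differentiable_on UNIV"
    unfolding c by (rule C1_differentiable_on_UNIV_I)
  then show ?thesis
    unfolding test_function_on_def using assms cutoff_outside
    by (intro conjI exI[of _ "{s..t}"]) auto
qed

text \<open>Henstock's lemma does the work: since all interval integrals vanish, the Riemann sum of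
  \<open>|g|\<close> over a fine division is exactly the error sum which that lemma makes small.
  Hence \<open>|g|\<close> has integral 0.\<close>

lemma AE_lebesgue_on_eq_0_if_interval_integrals_eq_0:
  fixes g :: "real \<Rightarrow> real"
  assumes g: "integrable (lebesgue_on {a..b}) g"
    and 0: "\<And>s t. {s..t} \<subseteq> {a..b} \<Longrightarrow> integral {s..t} g = 0"
  shows "AE x in lebesgue_on {a..b}. g x = 0"
proof -
  have "(\<lambda>x. \<bar>g x\<bar>) integrable_on {a..b}" "g integrable_on cbox a b"
    using g integrable_on_lebesgue_on[of "{a..b}"] by auto
  have "((\<lambda>x. \<bar>g x\<bar>) has_integral 0) (cbox a b)"
    unfolding has_integral
  proof (intro allI impI)
    fix e :: real assume "0 < e"
    from Henstock_lemma[OF \<open>g integrable_on cbox a b\<close> this]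
    obtain \<gamma> where \<gamma>: "gauge \<gamma>" "\<And>p. \<lbrakk>p tagged_partial_division_of (cbox a b); \<gamma> fine p\<rbrakk> \<Longrightarrow>
        (\<Sum>(x, k)\<in>p. norm (measure lborel k *\<^sub>R g x - integral k g)) < e" by blast
    show "\<exists>\<gamma>. gauge \<gamma> \<and> (\<forall>D. D tagged_division_of cbox a b \<and> \<gamma> fine D \<longrightarrow>
         norm ((\<Sum>(x, k)\<in>D. measure lborel k *\<^sub>R \<bar>g x\<bar>) - 0) < e)"
    proof (intro exI[of _ \<gamma>] conjI allI impI \<gamma>(1))
      fix D assume D: "D tagged_division_of cbox a b \<and> \<gamma> fine D"
      have "(\<Sum>(x, k)\<in>D. measure lborel k *\<^sub>R \<bar>g x\<bar>) = (\<Sum>(x, k)\<in>D. norm (measure lborel k *\<^sub>R g x - integral k g))"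
      proof (rule sum.cong[OF refl], clarify)
        fix x k assume xk: "(x, k) \<in> D"
        then obtain s t where "k = cbox s t" "k \<subseteq> cbox a b"
          using D tagged_division_ofD(3,4)[of D "cbox a b"] by meson
        then have "integral k g = 0" using 0[of s t] by auto
        then show "measure lborel k *\<^sub>R \<bar>g x\<bar> = norm (measure lborel k *\<^sub>R g x - integral k g)"
          by (simp add: abs_mult)
      qed
      also have "\<dots> < e" using \<gamma>(2) D tagged_division_of_def by blast
      finally have "(\<Sum>(x, k)\<in>D. measure lborel k *\<^sub>R \<bar>g x\<bar>) < e" .
      moreover have "0 \<le> (\<Sum>(x, k)\<in>D. measure lborel k *\<^sub>R \<bar>g x\<bar>)"
        by (auto intro!: sum_nonneg)
      ultimately show "norm ((\<Sum>(x, k)\<in>D. measure lborel k *\<^sub>R \<bar>g x\<bar>) - 0) < e" by simp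
    qed
  qed
  then have "(LINT x|lebesgue_on {a..b}. \<bar>g x\<bar>) = 0"
    using lebesgue_integral_eq_integral[of "{a..b}" "\<lambda>x. \<bar>g x\<bar>"] g by (auto simp: integral_unique)
  then have "AE x in lebesgue_on {a..b}. \<bar>g x\<bar> = 0"
    using integral_nonneg_eq_0_iff_AE[of "lebesgue_on {a..b}" "\<lambda>x. \<bar>g x\<bar>"] g by auto
  then show ?thesis by simp
qed

lemma AE_lebesgue_on_iff_negligible:
  assumes "S \<in> sets lebesgue"
  shows "(AE x in lebesgue_on S. P x) \<longleftrightarrow> negligible {x \<in> S. \<not> P x}"
proof -
  have "(AE x in lebesgue_on S. P x) \<longleftrightarrow> (AE x in lebesgue. x \<in> S \<longrightarrow> P x)"
    using assms by (simp add: AE_restrict_space_iff)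
  also have "\<dots> \<longleftrightarrow> negligible {x. \<not> (x \<in> S \<longrightarrow> P x)}"
    unfolding eventually_ae_filter using negligible_subset[of _ "{x. \<not> (x \<in> S \<longrightarrow> P x)}"]
    unfolding negligible_iff_null_sets by (simp, blast)
  also have "{x. \<not> (x \<in> S \<longrightarrow> P x)} = {x \<in> S. \<not> P x}" by auto
  finally show ?thesis .
qed

text \<open>The cutoffs converge boundedly to indicators, so dominated convergence turns the
  hypothesis into vanishing integrals over all compact intervals in the interior. Intervals with
  rational endpoints cover the interior by countably many of them, and the boundary of an interval
  is negligible.\<close>

theorem fundamental_lemma:
  assumes g: "locally_integrable_on g I" and I: "is_interval I" "I \<in> sets lebesgue"
    and 0: "\<And>\<phi>. test_function_on I \<phi> \<Longrightarrow> (LINT x|lebesgue_on I. g x * \<phi> x) = 0"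
  shows "AE x in lebesgue_on I. g x = 0"
proof -
  have int0: "integral {s..t} g = 0" if st: "{s..t} \<subseteq> interior I" for s t
  proof (cases "s < t")
    case True
    have sub: "{s..t} \<subseteq> I" using st interior_subset by blast
    have gi: "integrable (lebesgue_on {s..t}) g" using g sub by (simp add: locally_integrable_on_def)
    let ?c = "\<lambda>n. cutoff s t (real n)"
    have tf: "test_function_on I (?c n)" for n
      by (rule test_function_on_cutoff[OF st]) (use True in auto)
    have c0: "(LINT x|lebesgue_on {s..t}. g x * ?c n x) = 0" for n
    proof -
      have "(LINT x|lebesgue_on I. g x * ?c n x) = (LINT x|lebesgue_on {s..t}. g x * ?c n x)"
        by (rule integral_mult_supported(2)[OF g I(2) sub])
          (use test_function_on_DERIV(3)[OF tf] cutoff_outside True in auto)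
      then show ?thesis using 0[OF tf] by simp
    qed
    have "(\<lambda>n. LINT x|lebesgue_on {s..t}. g x * ?c n x) \<longlonglongrightarrow>
        (LINT x|lebesgue_on {s..t}. g x * indicator {s<..<t} x)"
    proof (rule integral_dominated_convergence[where w = "\<lambda>x. \<bar>g x\<bar>"])
      have "g \<in> borel_measurable (lebesgue_on {s..t})" using gi by auto
      moreover have "indicat_real {s<..<t} \<in> borel_measurable (lebesgue_on {s..t})"
        by (intro borel_measurable_indicator) (auto simp: sets_restrict_space_iff)
      ultimately show "(\<lambda>x. g x * indicat_real {s<..<t} x) \<in> borel_measurable (lebesgue_on {s..t})"
        by (rule borel_measurable_times)
      show "(\<lambda>x. g x * ?c n x) \<in> borel_measurable (lebesgue_on {s..t})" for n
        using integrable_lebesgue_on_mult_continuous[OF gi test_function_on_DERIV(3)[OF tf]] by auto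
      show "integrable (lebesgue_on {s..t}) (\<lambda>x. \<bar>g x\<bar>)" using gi by auto
      show "AE x in lebesgue_on {s..t}. (\<lambda>n. g x * ?c n x) \<longlonglongrightarrow> g x * indicat_real {s<..<t} x"
      proof (intro AE_I2)
        fix x
        have "(\<lambda>n. ?c n x) \<longlonglongrightarrow> indicat_real {s<..<t} x"
          by (cases "x \<in> {s<..<t}") (use cutoff_tendsto_1 cutoff_outside[of x s t] True in auto)
        then show "(\<lambda>n. g x * ?c n x) \<longlonglongrightarrow> g x * indicat_real {s<..<t} x"
          by (rule tendsto_mult_left)
      qed
      show "AE x in lebesgue_on {s..t}. norm (g x * ?c n x) \<le> \<bar>g x\<bar>" for n
      proof (intro AE_I2)
        fix x
        have "\<bar>?c n x\<bar> \<le> 1" using cutoff_bounds[of "real n" s t x] by auto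
        then show "norm (g x * ?c n x) \<le> \<bar>g x\<bar>" by (simp add: abs_mult mult_left_le)
      qed
    qed
    then have "(LINT x|lebesgue_on {s..t}. g x * indicator {s<..<t} x) = 0"
      using c0 LIMSEQ_unique by (simp add: LIMSEQ_const_iff)
    moreover have "(LINT x|lebesgue_on {s..t}. g x * indicator {s<..<t} x) = integral {s..t} g"
    proof -
      have "integrable (lebesgue_on {s..t}) (\<lambda>x. g x * indicat_real {s<..<t} x)"
        by (rule integrable_real_mult_indicator[OF _ gi]) (auto simp: sets_restrict_space_iff)
      then have "(LINT x|lebesgue_on {s..t}. g x * indicator {s<..<t} x)
          = integral {s..t} (\<lambda>x. g x * indicator {s<..<t} x)"
        by (rule lebesgue_integral_eq_integral) simp
      also have "\<dots> = integral {s..t} g"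
        by (rule integral_spike[of "{s, t}"]) (auto simp: indicator_def)
      finally show ?thesis .
    qed
    ultimately show ?thesis by simp
  next
    case False
    then show ?thesis by (cases "s = t") auto
  qed
  define \<F> where "\<F> = (\<lambda>(s, t). {x \<in> {s..t}. g x \<noteq> 0}) ` {(s, t). s \<in> \<rat> \<and> t \<in> \<rat> \<and> {s..t} \<subseteq> interior I}"
  have "negligible (\<Union>\<F>)"
  proof (rule negligible_countable_Union)
    have "countable {(s::real, t::real). s \<in> \<rat> \<and> t \<in> \<rat> \<and> {s..t} \<subseteq> interior I}"
      by (rule countable_subset[of _ "\<rat> \<times> \<rat>"]) (auto intro: countable_SIGMA countable_rat)
    then show "countable \<F>" unfolding \<F>_def by (rule countable_image)
    fix S assume "S \<in> \<F>"
    then obtain s t where S: "S = {x \<in> {s..t}. g x \<noteq> 0}" "{s..t} \<subseteq> interior I"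
      unfolding \<F>_def by auto
    have "AE x in lebesgue_on {s..t}. g x = 0"
    proof (rule AE_lebesgue_on_eq_0_if_interval_integrals_eq_0)
      show "integrable (lebesgue_on {s..t}) g"
        using g S(2) interior_subset unfolding locally_integrable_on_def by blast
      show "integral {q..r} g = 0" if "{q..r} \<subseteq> {s..t}" for q r
        using int0 that S(2) by blast
    qed
    then show "negligible S" using S by (simp add: AE_lebesgue_on_iff_negligible)
  qed
  moreover have "negligible (I - interior I)"
    by (rule negligible_subset[OF negligible_convex_frontier[of I]])
      (use I(1) closure_subset in \<open>auto simp: frontier_def is_interval_convex_1\<close>)
  ultimately have "negligible (\<Union>\<F> \<union> (I - interior I))" by (rule negligible_Un)
  moreover have "{x \<in> I. g x \<noteq> 0} \<subseteq> \<Union>\<F> \<union> (I - interior I)"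
  proof
    fix x assume x: "x \<in> {x \<in> I. g x \<noteq> 0}"
    show "x \<in> \<Union>\<F> \<union> (I - interior I)"
    proof (cases "x \<in> interior I")
      case True
      then obtain e where e: "e > 0" "ball x e \<subseteq> interior I"
        using open_contains_ball open_interior by blast
      obtain s where s: "s \<in> \<rat>" "x - e < s" "s < x" using Rats_dense_in_real[of "x - e" x] e by auto
      obtain t where t: "t \<in> \<rat>" "x < t" "t < x + e" using Rats_dense_in_real[of x "x + e"] e by auto
      have "{s..t} \<subseteq> ball x e" using s t by (auto simp: dist_real_def)
      then have "{s..t} \<subseteq> interior I" using e by blast
      then have "{x \<in> {s..t}. g x \<noteq> 0} \<in> \<F>" unfolding \<F>_def using s t by auto
      moreover have "x \<in> {x \<in> {s..t}. g x \<noteq> 0}" using x s t by auto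
      ultimately show ?thesis by blast
    qed (use x in auto)
  qed
  ultimately have "negligible {x \<in> I. g x \<noteq> 0}" by (rule negligible_subset)
  then show ?thesis using I(2) by (simp add: AE_lebesgue_on_iff_negligible)
qed

section \<open>The lemma of du Bois-Reymond\<close>

lemma antiderivative_UNIV:
  fixes f :: "real \<Rightarrow> real"
  assumes "continuous_on UNIV f"
  obtains F where "\<And>x. (F has_real_derivative f x) (at x)"
proof -
  \<comment> \<open>An integral over a reversed interval is 0, so only one of the two terms survives
    at each point.\<close>
  define F where "F = (\<lambda>x. integral {0..x} f - integral {x..0} f)"
  have "(F has_real_derivative f x) (at x)" for x
  proof -
    define n where "n = \<bar>x\<bar> + 1"
    have fi: "f integrable_on {s..t}" for s t
      using assms continuous_on_subset integrable_continuous_real by blast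
    have eq: "integral {- n..y} f - integral {- n..0} f = F y" if y: "y \<in> {- n<..<n}" for y
    proof (cases "0 \<le> y")
      case True
      have "integral {- n..0} f + integral {0..y} f = integral {- n..y} f"
        by (rule Henstock_Kurzweil_Integration.integral_combine) (use True fi in \<open>auto simp: n_def\<close>)
      moreover have "integral {y..0} f = 0" using True by (cases "y = 0") auto
      ultimately show ?thesis by (simp add: F_def)
    next
      case False
      have "integral {- n..y} f + integral {y..0} f = integral {- n..0} f"
        by (rule Henstock_Kurzweil_Integration.integral_combine) (use y False fi in auto)
      then show ?thesis using False by (simp add: F_def)
    qed
    have "((\<lambda>x. integral {- n..x} f) has_real_derivative f x) (at x within {- n..n})"
      by (rule integral_has_real_derivative) (use assms continuous_on_subset in \<open>auto simp: n_def\<close>)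
    then have "((\<lambda>x. integral {- n..x} f) has_real_derivative f x) (at x)"
      using at_within_Icc_at[of "- n" x n] by (simp add: n_def)
    then have "((\<lambda>x. integral {- n..x} f - integral {- n..0} f) has_real_derivative f x) (at x)"
      by (auto intro!: derivative_eq_intros)
    then show ?thesis
      by (rule has_field_derivative_transform_within_open[of _ _ _ "{- n<..<n}"]) (use eq in \<open>auto simp: n_def\<close>)
  qed
  then show thesis by (rule that)
qed

text \<open>Mean zero is what makes the antiderivative that starts at the left end of the support
  vanish to the right of the support as well.\<close>

lemma test_function_on_antiderivative:
  assumes I: "is_interval I" and st: "{s..t} \<subseteq> interior I" "s \<le> t"
    and \<psi>: "continuous_on UNIV \<psi>" "\<And>x. x \<notin> {s..t} \<Longrightarrow> \<psi> x = 0" "integral {s..t} \<psi> = 0"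
  obtains \<Psi> where "test_function_on I \<Psi>" "deriv \<Psi> = \<psi>"
proof -
  obtain F where F: "\<And>x. (F has_real_derivative \<psi> x) (at x)"
    using antiderivative_UNIV[OF \<psi>(1)] by blast
  define \<Psi> where "\<Psi> = (\<lambda>x. F x - F s)"
  have D: "(\<Psi> has_real_derivative \<psi> x) (at x)" for x
    unfolding \<Psi>_def using F by (auto intro!: derivative_eq_intros)
  have "(\<psi> has_integral (\<Psi> t - \<Psi> s)) {s..t}"
    using fundamental_theorem_of_calculus[OF st(2), of \<Psi> \<psi>] D
    by (metis has_field_derivative_at_within has_real_derivative_iff_has_vector_derivative)
  then have t0: "\<Psi> t = 0" using \<psi>(3) by (auto simp: \<Psi>_def dest: integral_unique)
  have "\<Psi> x = 0" if x: "x \<notin> {s..t}" for x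
  proof (cases "x < s")
    case True
    then obtain z where "z > x" "z < s" "\<Psi> s - \<Psi> x = (s - x) * \<psi> z"
      using MVT2[of x s \<Psi> \<psi>] D by auto
    then show ?thesis using \<psi>(2)[of z] by (simp add: \<Psi>_def)
  next
    case False
    then have "t < x" using x by auto
    then obtain z where "z > t" "z < x" "\<Psi> x - \<Psi> t = (x - t) * \<psi> z"
      using MVT2[of t x \<Psi> \<psi>] D by auto
    then show ?thesis using \<psi>(2)[of z] t0 by simp
  qed
  then have "test_function_on I \<Psi>"
    unfolding test_function_on_def using C1_differentiable_on_UNIV_I(1)[OF D \<psi>(1)] st
    by (intro conjI exI[of _ "{s..t}"]) auto
  then show thesis using that C1_differentiable_on_UNIV_I(2)[OF D \<psi>(1)] by blast
qed

text \<open>Fix a bump \<open>\<eta>\<close> of mass \<open>m\<close>. Subtracting a suitable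
  multiple of \<open>\<eta>\<close> from a test function leaves mean zero, hence the derivative of a
  test function, on which \<open>g\<close> vanishes. So \<open>g\<close> acts on every test function
  like the constant \<open>k\<close>, the integral of \<open>g * \<eta>\<close> divided by
  \<open>m\<close>.\<close>

theorem du_Bois_Reymond:
  assumes g: "locally_integrable_on g I" and I: "is_interval I" "I \<in> sets lebesgue" "interior I \<noteq> {}"
    and 0: "\<And>\<phi>. test_function_on I \<phi> \<Longrightarrow> (LINT x|lebesgue_on I. g x * deriv \<phi> x) = 0"
  obtains k where "AE x in lebesgue_on I. g x = k"
proof -
  obtain x0 e where "e > 0" "ball x0 e \<subseteq> interior I"
    using I(3) open_contains_ball open_interior by (metis ex_in_conv)
  then have ex: "{x0 - e/2..x0 + e/2} \<subseteq> interior I" "x0 - e/2 < x0 + e/2"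
    by (auto simp: subset_iff dist_real_def)
  define s0 t0 where "s0 = x0 - e/2" and "t0 = x0 + e/2"
  have st0: "{s0..t0} \<subseteq> interior I" "s0 < t0" using ex by (auto simp: s0_def t0_def)
  define \<eta> where "\<eta> = cutoff s0 t0 1"
  have \<eta>: "test_function_on I \<eta>" unfolding \<eta>_def using test_function_on_cutoff st0 by auto
  define m where "m = integral {s0..t0} \<eta>"
  have \<eta>0: "\<eta> x = 0" if "x \<notin> {s0..t0}" for x
    using that cutoff_outside st0(2) unfolding \<eta>_def by auto
  have "m > 0"
  proof -
    have "m \<noteq> 0"
    proof
      assume "m = 0"
      then have "\<eta> ((s0 + t0) / 2) = 0"
        using integral_eq_0_iff[of s0 t0 \<eta>] test_function_on_DERIV(3)[OF \<eta>] st0(2) cutoff_bounds[of 1]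
        unfolding m_def \<eta>_def by auto
      moreover define P where "P = (max 0 (((s0 + t0) / 2 - s0) * (t0 - (s0 + t0) / 2)))\<^sup>2"
      have "0 < P"
        unfolding P_def using st0(2) by (auto intro!: zero_less_power mult_pos_pos simp: less_max_iff_disj)
      then have "0 < 1 * P / (1 + 1 * P)" by simp
      then have "0 < \<eta> ((s0 + t0) / 2)" unfolding \<eta>_def cutoff_def P_def .
      ultimately show False by simp
    qed
    moreover have "m \<ge> 0" unfolding m_def
      by (rule integral_nonneg) (use test_function_on_DERIV(3)[OF \<eta>] cutoff_bounds[of 1] in
          \<open>auto simp: \<eta>_def intro: integrable_continuous_real\<close>)
    ultimately show ?thesis by simp
  qed
  define k where "k = (LINT x|lebesgue_on I. g x * \<eta> x) / m"
  have gk: "locally_integrable_on (\<lambda>x. g x - k) I"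
    using locally_integrable_on_diff[OF g locally_integrable_on_continuous[OF continuous_on_const]] .
  have "AE x in lebesgue_on I. g x - k = 0"
  proof (rule fundamental_lemma[OF gk I(1,2)])
    fix \<phi> assume \<phi>: "test_function_on I \<phi>"
    obtain s t where st: "s \<le> s0" "t0 \<le> t" "{s..t} \<subseteq> interior I" "\<And>x. x \<notin> {s..t} \<Longrightarrow> \<phi> x = 0"
      using test_function_on_support[OF \<phi> I(1) st0(1)] st0(2) by (metis less_imp_le)
    have sub: "{s..t} \<subseteq> I" using st(3) interior_subset by blast
    have \<eta>st: "\<eta> x = 0" if "x \<notin> {s..t}" for x using \<eta>0 st that by auto
    have ci: "\<phi> integrable_on {s..t}" "\<eta> integrable_on {s..t}"
      using test_function_on_DERIV(3) \<phi> \<eta> integrable_continuous_real by blast+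
    have \<eta>m: "integral {s..t} \<eta> = m"
    proof -
      have "{x \<in> {s..t} - {s0..t0}. \<eta> x \<noteq> 0} = {}" using \<eta>0 by blast
      moreover have "{x \<in> {s0..t0} - {s..t}. \<eta> x \<noteq> 0} = {}" using st(1,2) by auto
      ultimately show ?thesis
        unfolding m_def by (intro integral_spike_set) (simp_all only: negligible_empty)
    qed
    define r where "r = integral {s..t} \<phi> / m"
    define \<psi> where "\<psi> = (\<lambda>x. \<phi> x - r * \<eta> x)"
    have "integral {s..t} \<psi> = 0"
    proof -
      have "(\<lambda>x. r * \<eta> x) integrable_on {s..t}" 
        by (intro integrable_continuous_real continuous_intros test_function_on_DERIV(3)[OF \<eta>])
      then have "integral {s..t} \<psi> = integral {s..t} \<phi> - integral {s..t} (\<lambda>x. r * \<eta> x)"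
        unfolding \<psi>_def by (rule Henstock_Kurzweil_Integration.integral_diff[OF ci(1)])
      also have "\<dots> = integral {s..t} \<phi> - r * m" using \<eta>m by simp
      finally show ?thesis using \<open>m > 0\<close> by (simp add: r_def)
    qed
    moreover have "s \<le> t" using st(1,2) st0(2) by simp
    moreover have "continuous_on UNIV \<psi>"
      unfolding \<psi>_def by (intro continuous_intros test_function_on_DERIV(3)[OF \<phi>] test_function_on_DERIV(3)[OF \<eta>])
    moreover have "\<psi> x = 0" if "x \<notin> {s..t}" for x
      using st(4)[OF that] \<eta>st[OF that] by (simp add: \<psi>_def)
    ultimately obtain \<Psi> where \<Psi>: "test_function_on I \<Psi>" "deriv \<Psi> = \<psi>"
      using test_function_on_antiderivative[OF I(1) st(3), of \<psi>] by metis
    have i: "integrable (lebesgue_on I) (\<lambda>x. g x * \<phi> x)" "integrable (lebesgue_on I) (\<lambda>x. g x * \<eta> x)"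
      using integral_mult_supported(1)[OF g I(2) sub] test_function_on_DERIV(3) \<phi> \<eta> st(4) \<eta>st by auto
    have one: "integrable (lebesgue_on I) (\<lambda>x. 1 * \<phi> x)"
      "(LINT x|lebesgue_on I. 1 * \<phi> x) = integral {s..t} (\<lambda>x. 1 * \<phi> x)"
      by (rule integral_mult_supported[OF locally_integrable_on_continuous[OF continuous_on_const] I(2) sub];
          use test_function_on_DERIV(3) \<phi> st(4) in auto)+
    have "0 = (LINT x|lebesgue_on I. g x * \<phi> x - r * (g x * \<eta> x))"
      using 0[OF \<Psi>(1)] by (simp add: \<Psi>(2) \<psi>_def algebra_simps)
    also have "\<dots> = (LINT x|lebesgue_on I. g x * \<phi> x) - r * (m * k)"
      using i \<open>m > 0\<close> by (simp add: k_def)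
    also have "r * (m * k) = k * (LINT x|lebesgue_on I. \<phi> x)"
      using one \<open>m > 0\<close> by (simp add: r_def)
    also have "(LINT x|lebesgue_on I. g x * \<phi> x) - k * (LINT x|lebesgue_on I. \<phi> x)
        = (LINT x|lebesgue_on I. g x * \<phi> x - k * \<phi> x)"
      using i one by simp
    finally show "(LINT x|lebesgue_on I. (g x - k) * \<phi> x) = 0" by (simp add: algebra_simps)
  qed
  then show thesis using that[of k] by simp
qed

section \<open>Weak derivatives on an interval\<close>

text \<open>A quadratic modulus of continuity makes every difference quotient tend to 0. This
  replaces the product rule in the integration by parts below, where one factor may fail to be
  differentiable.\<close>

lemma constant_if_quadratic_modulus:
  fixes P :: "real \<Rightarrow> real"
  assumes "s \<le> t" "\<And>x y. s \<le> x \<Longrightarrow> x \<le> y \<Longrightarrow> y \<le> t \<Longrightarrow> \<bar>P y - P x\<bar> \<le> C * (y - x)\<^sup>2"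
  shows "P t = P s"
proof -
  have "(P has_field_derivative 0) (at x within {s..t})" if x: "x \<in> {s..t}" for x
    unfolding has_field_derivative_iff
  proof (rule Lim_null_comparison)
    have le: "\<bar>P y - P x\<bar> \<le> C * (y - x)\<^sup>2" if "y \<in> {s..t}" for y
      using assms(2)[of x y] assms(2)[of y x] x that
      by (cases "x \<le> y") (auto simp: abs_minus_commute power2_commute)
    show "\<forall>\<^sub>F y in at x within {s..t}. norm ((P y - P x) / (y - x)) \<le> C * \<bar>y - x\<bar>"
      unfolding eventually_at_filter
    proof (intro always_eventually allI impI)
      fix y assume y: "y \<noteq> x" "y \<in> {s..t}"
      have "\<bar>P y - P x\<bar> \<le> (C * \<bar>y - x\<bar>) * \<bar>y - x\<bar>"
        using le[OF y(2)] by (simp add: mult.assoc power2_eq_square)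
      then show "norm ((P y - P x) / (y - x)) \<le> C * \<bar>y - x\<bar>"
        using y by (simp add: pos_divide_le_eq)
    qed
    have "((\<lambda>y. C * \<bar>y - x\<bar>) \<longlongrightarrow> C * \<bar>x - x\<bar>) (at x within {s..t})"
      by (intro tendsto_intros)
    then show "((\<lambda>y. C * \<bar>y - x\<bar>) \<longlongrightarrow> 0) (at x within {s..t})" by simp
  qed
  then obtain c where "\<forall>x\<in>{s..t}. P x = c"
    using has_field_derivative_zero_constant[of "{s..t}" P] by auto
  then show ?thesis using assms(1) by auto
qed

text \<open>\<open>H\<close> is known only as an integral of the bounded \<open>h\<close>, so the
  product need not be differentiable at every point. The defect \<open>P\<close> between the product
  and the integral has a quadratic modulus instead: \<open>H\<close> is Lipschitz with constant
  \<open>B\<close> and \<open>F\<close> with constant \<open>L\<close>.\<close>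

theorem integration_by_parts_bounded:
  fixes H h F F' :: "real \<Rightarrow> real"
  assumes st: "s \<le> t"
    and h: "\<And>x y. s \<le> x \<Longrightarrow> x \<le> y \<Longrightarrow> y \<le> t \<Longrightarrow> (h has_integral (H y - H x)) {x..y}"
    and B: "\<And>x. x \<in> {s..t} \<Longrightarrow> \<bar>h x\<bar> \<le> B"
    and F: "\<And>x. x \<in> {s..t} \<Longrightarrow> (F has_real_derivative F' x) (at x within {s..t})"
    and F': "continuous_on {s..t} F'"
  shows "((\<lambda>x. h x * F x + H x * F' x) has_integral (H t * F t - H s * F s)) {s..t}"
proof -
  have B0: "0 \<le> B" using B[of s] st by force
  have Fc: "continuous_on {s..t} F" using F by (rule DERIV_continuous_on)
  have lip: "\<bar>H y - H x\<bar> \<le> B * (y - x)" if "s \<le> x" "x \<le> y" "y \<le> t" for x y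
  proof -
    have "norm (H y - H x) \<le> B * measure lborel (cbox x y)"
      by (rule has_integral_bound[OF B0]) (use h[OF that] B that in auto)
    then show ?thesis using that by simp
  qed
  have "B-lipschitz_on {s..t} H"
  proof (rule lipschitz_onI[OF _ B0])
    fix x y assume "x \<in> {s..t}" "y \<in> {s..t}"
    then show "dist (H x) (H y) \<le> B * dist x y"
      using lip[of x y] lip[of y x] by (cases "x \<le> y") (auto simp: dist_real_def abs_minus_commute)
  qed
  then have Hc: "continuous_on {s..t} H" by (rule lipschitz_on_continuous_on)
  obtain L where L: "L \<ge> 0" "\<And>x. x \<in> {s..t} \<Longrightarrow> \<bar>F' x\<bar> \<le> L"
  proof -
    have "bounded (F' ` {s..t})" using compact_continuous_image[OF F'] compact_imp_bounded by blast
    then obtain L where L: "\<And>x. x \<in> {s..t} \<Longrightarrow> \<bar>F' x\<bar> \<le> L" unfolding bounded_iff by force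
    moreover have "L \<ge> 0" using L[of s] st by force
    ultimately show thesis using that by blast
  qed
  have lipF: "\<bar>F y - F x\<bar> \<le> L * (y - x)" if "s \<le> x" "x \<le> y" "y \<le> t" for x y
  proof -
    have "((\<lambda>z. F' z) has_integral (F y - F x)) (cbox x y)"
      unfolding box_real
    proof (rule fundamental_theorem_of_calculus[OF \<open>x \<le> y\<close>])
      fix z assume "z \<in> {x..y}"
      then have "(F has_real_derivative F' z) (at z within {x..y})"
        using F[of z] that by (auto elim: DERIV_subset)
      then show "(F has_vector_derivative F' z) (at z within {x..y})"
        by (simp add: has_real_derivative_iff_has_vector_derivative)
    qed
    then have "norm (F y - F x) \<le> L * measure lborel (cbox x y)"
      by (rule has_integral_bound[OF L(1)]) (use L(2) that in auto)
    then show ?thesis using that by simp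
  qed
  let ?G = "\<lambda>x. h x * F x + H x * F' x"
  have "(\<lambda>x. F x * h x) absolutely_integrable_on {s..t}"
  proof (rule absolutely_integrable_bounded_measurable_product_real)
    show "F \<in> borel_measurable (lebesgue_on {s..t})"
      by (rule continuous_imp_measurable_on_sets_lebesgue[OF Fc]) simp
    show "bounded (F ` {s..t})"
      using compact_continuous_image[OF Fc] compact_imp_bounded by blast
    have "h integrable_on {s..t}" using h[of s t] st by blast
    then show "h absolutely_integrable_on {s..t}"
      by (rule absolutely_integrable_integrable_bound[of _ _ "\<lambda>_. B", rotated]) (use B in auto)
  qed simp
  then have "(\<lambda>x. h x * F x) integrable_on {s..t}"
    using set_lebesgue_integral_eq_integral(1) by (simp add: mult.commute)
  moreover have "(\<lambda>x. H x * F' x) integrable_on {s..t}"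
    by (intro integrable_continuous_real continuous_intros Hc F')
  ultimately have Gi: "?G integrable_on {s..t}" by (rule integrable_add)
  define P where "P = (\<lambda>x. H x * F x - integral {s..x} ?G)"
  have "P t = P s"
  proof (rule constant_if_quadratic_modulus[OF st, of _ "2 * B * L"])
    fix x y assume xy: "s \<le> x" "x \<le> y" "y \<le> t"
    have sub: "{x..y} \<subseteq> {s..t}" using xy by auto
    have "((\<lambda>z. h z * F y + F' z * H x - ?G z) has_integral
        ((H y - H x) * F y + (F y - F x) * H x - integral {x..y} ?G)) (cbox x y)"
      unfolding box_real
    proof (intro has_integral_diff has_integral_add has_integral_mult_left h xy)
      show "(F' has_integral (F y - F x)) {x..y}"
      proof (rule fundamental_theorem_of_calculus[OF xy(2)])
        fix z assume "z \<in> {x..y}"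
        then have "(F has_real_derivative F' z) (at z within {x..y})"
          using F[of z] xy by (auto elim: DERIV_subset)
        then show "(F has_vector_derivative F' z) (at z within {x..y})"
          by (simp add: has_real_derivative_iff_has_vector_derivative)
      qed
      show "(?G has_integral integral {x..y} ?G) {x..y}"
        using integrable_on_subinterval[OF Gi sub] by (rule integrable_integral)
    qed
    moreover have "(H y - H x) * F y + (F y - F x) * H x - integral {x..y} ?G = P y - P x"
    proof -
      have "integral {s..x} ?G + integral {x..y} ?G = integral {s..y} ?G"
        by (rule Henstock_Kurzweil_Integration.integral_combine)
          (use xy integrable_on_subinterval[OF Gi, of s y] in auto)
      then show ?thesis by (simp add: P_def algebra_simps)
    qed
    ultimately have "norm (P y - P x) \<le> (2 * B * L * (y - x)) * measure lborel (cbox x y)"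
    proof (rule_tac has_integral_bound[of _ "\<lambda>z. h z * F y + F' z * H x - ?G z"])
      show "0 \<le> 2 * B * L * (y - x)" using B0 L xy by simp
      fix z assume "z \<in> cbox x y"
      then have z: "z \<in> {s..t}" "x \<le> z" "z \<le> y" using sub by auto
      \<comment> \<open>Freezing \<open>F\<close> at the right end and \<open>H\<close> at the left
        end leaves one small factor in each term, of order \<open>y - x\<close>. Integration over
        \<open>{x..y}\<close> supplies the second factor \<open>y - x\<close>.\<close>
      have "h z * F y + F' z * H x - ?G z = h z * (F y - F z) - F' z * (H z - H x)"
        by (simp add: algebra_simps)
      also have "\<bar>\<dots>\<bar> \<le> \<bar>h z\<bar> * \<bar>F y - F z\<bar> + \<bar>F' z\<bar> * \<bar>H z - H x\<bar>"
        by (metis abs_mult abs_triangle_ineq4)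
      also have "\<dots> \<le> B * (L * (y - x)) + L * (B * (y - x))"
      proof (intro add_mono mult_mono)
        show "\<bar>h z\<bar> \<le> B" "\<bar>F' z\<bar> \<le> L" using B L z by auto
        have "\<bar>F y - F z\<bar> \<le> L * (y - z)" using lipF z xy by auto
        also have "\<dots> \<le> L * (y - x)" using L z by (intro mult_left_mono) auto
        finally show "\<bar>F y - F z\<bar> \<le> L * (y - x)" .
        have "\<bar>H z - H x\<bar> \<le> B * (z - x)" using lip z xy by auto
        also have "\<dots> \<le> B * (y - x)" using B0 z by (intro mult_left_mono) auto
        finally show "\<bar>H z - H x\<bar> \<le> B * (y - x)" .
      qed (use B0 L xy in auto)
      finally show "norm (h z * F y + F' z * H x - ?G z) \<le> 2 * B * L * (y - x)" by simp
    qed simp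
    then show "\<bar>P y - P x\<bar> \<le> 2 * B * L * (y - x)\<^sup>2"
      using xy by (simp add: power2_eq_square mult.assoc)
  qed
  then have "integral {s..t} ?G = H t * F t - H s * F s" by (simp add: P_def)
  then show ?thesis using integrable_integral[OF Gi] by simp
qed

text \<open>These are the possible parameter intervals of an edge.\<close>

definition closed_ray_or_segment :: "real set \<Rightarrow> bool" where
  "closed_ray_or_segment I \<longleftrightarrow> I = {0..} \<or> (\<exists>l>0. I = {0..l})"

lemma closed_ray_or_segmentD:
  assumes "closed_ray_or_segment I"
  shows "is_interval I" "I \<in> sets lebesgue" "interior I \<noteq> {}" "0 \<in> I" "x \<in> I \<Longrightarrow> 0 \<le> x"
    "x \<in> I \<Longrightarrow> {0..x} \<subseteq> I"
proof -
  consider "I = {0..}" | l where "l > 0" "I = {0..l}"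
    using assms unfolding closed_ray_or_segment_def by blast
  note cases = this
  show "is_interval I" using cases by cases (simp_all add: is_interval_ci is_interval_cc)
  show "I \<in> sets lebesgue" using cases by cases simp_all
  show "0 \<in> I" using cases by cases simp_all
  show "x \<in> I \<Longrightarrow> 0 \<le> x" "x \<in> I \<Longrightarrow> {0..x} \<subseteq> I" using cases by (cases; auto)+
  show "interior I \<noteq> {}"
    using cases by cases (simp_all add: interior_atLeastAtMost_real interior_real_atLeast)
qed

lemma integrable_mult_test_function:
  assumes I: "closed_ray_or_segment I" and g: "locally_integrable_on g I" and \<phi>: "test_function_on I \<phi>"
  shows "integrable (lebesgue_on I) (\<lambda>x. g x * \<phi> x)" "integrable (lebesgue_on I) (\<lambda>x. g x * deriv \<phi> x)"
proof -
  note I' = closed_ray_or_segmentD[OF I]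
  obtain x0 where "x0 \<in> interior I" using I'(3) by blast
  then have "{x0..x0} \<subseteq> interior I" by simp
  then obtain s t where
    st: "{s..t} \<subseteq> interior I" "\<And>x. x \<notin> {s..t} \<Longrightarrow> \<phi> x = 0" "\<And>x. x \<notin> {s..t} \<Longrightarrow> deriv \<phi> x = 0"
    using test_function_on_support[OF \<phi> I'(1) _ order_refl[of x0]] by metis
  then have sub: "{s..t} \<subseteq> I" using interior_subset by blast
  show "integrable (lebesgue_on I) (\<lambda>x. g x * \<phi> x)" "integrable (lebesgue_on I) (\<lambda>x. g x * deriv \<phi> x)"
    using integral_mult_supported(1)[OF g I'(2) sub] test_function_on_DERIV(2,3)[OF \<phi>] st by auto
qed

lemma has_weak_derivative_AE_unique:
  assumes I: "closed_ray_or_segment I"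
    and g1: "has_weak_derivative f g1 I" "locally_integrable_on g1 I"
    and g2: "has_weak_derivative f g2 I" "locally_integrable_on g2 I"
  shows "AE x in lebesgue_on I. g1 x = g2 x"
proof -
  have "AE x in lebesgue_on I. g1 x - g2 x = 0"
  proof (rule fundamental_lemma[OF locally_integrable_on_diff[OF g1(2) g2(2)] closed_ray_or_segmentD(1,2)[OF I]])
    fix \<phi> assume \<phi>: "test_function_on I \<phi>"
    then show "(LINT x|lebesgue_on I. (g1 x - g2 x) * \<phi> x) = 0"
      using g1(1) g2(1) integrable_mult_test_function(1)[OF I _ \<phi>] g1(2) g2(2)
      unfolding has_weak_derivative_iff by (simp add: left_diff_distrib)
  qed
  then show ?thesis by simp
qed

lemma has_weak_derivative_sum:
  assumes I: "closed_ray_or_segment I" and S: "finite S"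
    and fg: "\<And>i. i \<in> S \<Longrightarrow> has_weak_derivative (f i) (g i) I"
    and li: "\<And>i. i \<in> S \<Longrightarrow> locally_integrable_on (f i) I" "\<And>i. i \<in> S \<Longrightarrow> locally_integrable_on (g i) I"
  shows "has_weak_derivative (\<lambda>x. \<Sum>i\<in>S. c i * f i x) (\<lambda>x. \<Sum>i\<in>S. c i * g i x) I"
  unfolding has_weak_derivative_iff
proof (intro allI impI)
  fix \<phi> assume \<phi>: "test_function_on I \<phi>"
  have *: "integrable (lebesgue_on I) (\<lambda>x. c i * (f i x * deriv \<phi> x))"
    "integrable (lebesgue_on I) (\<lambda>x. c i * (g i x * \<phi> x))" if "i \<in> S" for i
    using integrable_mult_test_function[OF I _ \<phi>] li that by auto
  have "(LINT x|lebesgue_on I. (\<Sum>i\<in>S. c i * f i x) * deriv \<phi> x)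
      = (\<Sum>i\<in>S. c i * (LINT x|lebesgue_on I. f i x * deriv \<phi> x))"
    using * by (simp add: sum_distrib_right mult.assoc Bochner_Integration.integral_sum)
  also have "\<dots> = - (\<Sum>i\<in>S. c i * (LINT x|lebesgue_on I. g i x * \<phi> x))"
    using fg \<phi> by (simp add: has_weak_derivative_iff sum_negf)
  also have "\<dots> = - (LINT x|lebesgue_on I. (\<Sum>i\<in>S. c i * g i x) * \<phi> x)"
    using * by (simp add: sum_distrib_right mult.assoc Bochner_Integration.integral_sum)
  finally show "(LINT x|lebesgue_on I. (\<Sum>i\<in>S. c i * f i x) * deriv \<phi> x)
      = - (LINT x|lebesgue_on I. (\<Sum>i\<in>S. c i * g i x) * \<phi> x)" .
qed

text \<open>Integration by parts leaves no boundary terms: at an end of the piece inside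
  \<open>I\<close> the function \<open>F\<close> vanishes, and at an end on the boundary of
  \<open>I\<close> every test function does. The second case admits functions that do not vanish at
  a vertex.\<close>

lemma has_weak_derivative_C1_piece:
  fixes F F' :: "real \<Rightarrow> real"
  assumes I: "I \<in> sets lebesgue" "{s..t} \<subseteq> I" "s \<le> t"
    and F: "\<And>x. x \<in> {s..t} \<Longrightarrow> (F has_real_derivative F' x) (at x within {s..t})"
    and F': "continuous_on {s..t} F'"
    and ends: "s \<in> interior I \<Longrightarrow> F s = 0" "t \<in> interior I \<Longrightarrow> F t = 0"
  shows "has_weak_derivative (\<lambda>x. indicator {s..t} x * F x) (\<lambda>x. indicator {s..t} x * F' x) I"
  unfolding has_weak_derivative_iff
proof (intro allI impI)
  fix \<phi> assume \<phi>: "test_function_on I \<phi>"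
  have Fc: "continuous_on {s..t} F" using F by (rule DERIV_continuous_on)
  have z: "\<phi> x = 0" if "x \<notin> interior I" for x
    using \<phi> that unfolding test_function_on_def by blast
  have red: "(LINT x|lebesgue_on I. indicator {s..t} x * f x * \<psi> x) = integral {s..t} (\<lambda>x. f x * \<psi> x)"
    if "continuous_on {s..t} f" "continuous_on {s..t} \<psi>" for f \<psi> :: "real \<Rightarrow> real"
  proof -
    have "(LINT x|lebesgue_on I. indicator {s..t} x * f x * \<psi> x)
        = (LINT x|lebesgue_on {s..t}. indicator {s..t} x * f x * \<psi> x)"
      by (rule lebesgue_on_supported) (use I in auto)
    also have "\<dots> = (LINT x|lebesgue_on {s..t}. f x * \<psi> x)"
      by (rule Bochner_Integration.integral_cong) auto
    also have "\<dots> = integral {s..t} (\<lambda>x. f x * \<psi> x)"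
      by (rule lebesgue_integral_eq_integral)
        (use that in \<open>auto intro!: integrable_lebesgue_on_continuous continuous_intros\<close>)
    finally show ?thesis .
  qed
  have "((\<lambda>x. F' x * \<phi> x + F x * deriv \<phi> x) has_integral (F t * \<phi> t - F s * \<phi> s)) {s..t}"
  proof (rule fundamental_theorem_of_calculus[OF I(3)])
    fix x assume "x \<in> {s..t}"
    then have "((\<lambda>x. F x * \<phi> x) has_real_derivative (F' x * \<phi> x + deriv \<phi> x * F x)) (at x within {s..t})"
      using F test_function_on_DERIV(1)[OF \<phi>, of x]
      by (intro DERIV_mult) (simp_all add: has_field_derivative_at_within)
    then have "((\<lambda>x. F x * \<phi> x) has_real_derivative (F' x * \<phi> x + F x * deriv \<phi> x)) (at x within {s..t})"
      by (simp add: mult.commute)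
    then show "((\<lambda>x. F x * \<phi> x) has_vector_derivative (F' x * \<phi> x + F x * deriv \<phi> x)) (at x within {s..t})"
      by (simp add: has_real_derivative_iff_has_vector_derivative)
  qed
  moreover have "F t * \<phi> t - F s * \<phi> s = 0" using z ends by (metis diff_zero mult_eq_0_iff)
  ultimately have "integral {s..t} (\<lambda>x. F' x * \<phi> x + F x * deriv \<phi> x) = 0" by (simp add: integral_unique)
  moreover have "integral {s..t} (\<lambda>x. F' x * \<phi> x + F x * deriv \<phi> x)
      = integral {s..t} (\<lambda>x. F' x * \<phi> x) + integral {s..t} (\<lambda>x. F x * deriv \<phi> x)"
    by (rule Henstock_Kurzweil_Integration.integral_add; intro integrable_continuous_real continuous_intros
        F' Fc test_function_on_DERIV(2,3)[OF \<phi>])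
  ultimately show "(LINT x|lebesgue_on I. indicator {s..t} x * F x * deriv \<phi> x)
      = - (LINT x|lebesgue_on I. indicator {s..t} x * F' x * \<phi> x)"
    using red[OF Fc test_function_on_DERIV(2)[OF \<phi>]] red[OF F' test_function_on_DERIV(3)[OF \<phi>]] by simp
qed

lemma integrable_lebesgue_on_subset:
  fixes f :: "real \<Rightarrow> real"
  assumes "integrable (lebesgue_on T) f" "S \<subseteq> T" "S \<in> sets lebesgue" "T \<in> sets lebesgue"
  shows "integrable (lebesgue_on S) f"
proof -
  have "f absolutely_integrable_on T"
    using assms(1,4) by (simp only: integrable_lebesgue_on_iff_absolutely_integrable_on)
  then have "f absolutely_integrable_on S" by (rule set_integrable_subset[OF _ assms(3,2)])
  then show ?thesis using assms(3) by (simp only: integrable_lebesgue_on_iff_absolutely_integrable_on)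
qed

lemma square_integrable_on_imp_locally_integrable_on:
  assumes "square_integrable_on g I" "I \<in> sets lebesgue"
  shows "locally_integrable_on g I"
  unfolding locally_integrable_on_def
proof (intro allI impI)
  fix s t assume st: "{s..t} \<subseteq> I"
  have "integrable (lebesgue_on {s..t}) (\<lambda>x. (g x)\<^sup>2)"
    using integrable_lebesgue_on_subset[OF _ st _ assms(2)] assms(1) by (simp add: square_integrable_on_def)
  then have "integrable (lebesgue_on {s..t}) (\<lambda>x. 1 + (g x)\<^sup>2)"
    using Bochner_Integration.integrable_add[OF integrable_lebesgue_on_continuous[OF continuous_on_const]]
    by blast
  moreover have "g \<in> borel_measurable (lebesgue_on {s..t})"
    using measurable_restrict_mono[OF _ st] assms(1) unfolding square_integrable_on_def by blast
  moreover have "AE x in lebesgue_on {s..t}. norm (g x) \<le> norm (1 + (g x)\<^sup>2)"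
  proof (rule AE_I2)
    fix x
    have "\<bar>g x\<bar> \<le> 1 + (g x)\<^sup>2" using sum_squares_bound[of 1 "\<bar>g x\<bar>"] by simp
    then show "norm (g x) \<le> norm (1 + (g x)\<^sup>2)" by simp
  qed
  ultimately show "integrable (lebesgue_on {s..t}) g"
    by (rule Bochner_Integration.integrable_bound)
qed

lemma continuous_on_AE_eq_0_imp_eq_0:
  fixes f :: "real \<Rightarrow> real"
  assumes I: "closed_ray_or_segment I" and f: "continuous_on I f"
    and 0: "AE x in lebesgue_on I. f x = 0" and x: "x \<in> I"
  shows "f x = 0"
proof (rule ccontr)
  assume "f x \<noteq> 0"
  then obtain d where d: "d > 0" "\<And>y. y \<in> I \<Longrightarrow> dist y x < d \<Longrightarrow> dist (f y) (f x) < \<bar>f x\<bar>"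
    using f[unfolded continuous_on_iff, rule_format, OF x, of "\<bar>f x\<bar>"] by auto
  \<comment> \<open>The point \<open>x\<close> may be an end of \<open>I\<close>, so a nondegenerate
    interval near \<open>x\<close> is taken on one side only.\<close>
  have "\<exists>s t. s < t \<and> {s..t} \<subseteq> I \<and> {s..t} \<subseteq> ball x d"
  proof (cases "x = 0")
    case True
    show ?thesis
    proof (cases "I = {0..}")
      case True
      then show ?thesis using \<open>x = 0\<close> d(1)
        by (intro exI[of _ 0] exI[of _ "d/2"]) (auto simp: dist_real_def)
    next
      case False
      then obtain l where "l > 0" "I = {0..l}" using I by (auto simp: closed_ray_or_segment_def)
      then show ?thesis using \<open>x = 0\<close> d(1)
        by (intro exI[of _ 0] exI[of _ "min l (d/2)"]) (auto simp: dist_real_def)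
    qed
  next
    case False
    then have "x > 0" using closed_ray_or_segmentD(5)[OF I x] by simp
    moreover have "{0..x} \<subseteq> I" using closed_ray_or_segmentD(6)[OF I x] .
    ultimately show ?thesis using d(1)
      by (intro exI[of _ "max 0 (x - d/2)"] exI[of _ x]) (auto simp: dist_real_def)
  qed
  then obtain s t where st: "s < t" "{s..t} \<subseteq> I" "{s..t} \<subseteq> ball x d" by blast
  have "{s..t} \<subseteq> {x \<in> I. f x \<noteq> 0}"
  proof
    fix y assume y: "y \<in> {s..t}"
    then have "y \<in> I" "dist y x < d" using st by (auto simp: dist_commute subset_iff)
    then have "dist (f y) (f x) < \<bar>f x\<bar>" using d(2) by blast
    then show "y \<in> {x \<in> I. f x \<noteq> 0}" using \<open>y \<in> I\<close> by (auto simp: dist_real_def)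
  qed
  moreover have "negligible {x \<in> I. f x \<noteq> 0}"
    using 0 closed_ray_or_segmentD(2)[OF I] by (simp add: AE_lebesgue_on_iff_negligible)
  ultimately have "negligible {s..t}" using negligible_subset by blast
  then show False using st(1) negligible_interval(1)[of s t] by simp
qed

lemma test_function_on_boundary:
  assumes "test_function_on I \<phi>" "\<And>x. x \<notin> {s..t} \<Longrightarrow> \<phi> x = 0"
  shows "\<phi> s = 0" "\<phi> t = 0"
proof -
  have c: "continuous_on S \<phi>" for S using test_function_on_DERIV(3)[OF assms(1)] .
  show "\<phi> s = 0"
    by (rule continuous_constant_on_closure[OF c, of "{..<s}"]) (use assms(2) in auto)
  show "\<phi> t = 0"
    by (rule continuous_constant_on_closure[OF c, of "{t<..}"]) (use assms(2) in auto)
qed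

text \<open>Differentiability and continuity on a half-line are thereby reduced to compact
  intervals, where the integral theorems apply.\<close>

lemma at_within_closed_ray_or_segment:
  assumes "closed_ray_or_segment I" "x \<in> I"
  obtains z where "z \<in> I" "x \<le> z" "at x within I = at x within {0..z}"
proof (cases "I = {0..}")
  case True
  have "at x within I = at x within {0..x + 1}"
    by (rule at_within_nhd[of _ "{..<x + 1}"]) (use True in auto)
  then show thesis using that[of "x + 1"] assms(2) True by simp
next
  case False
  then obtain l where "I = {0..l}" using assms(1) by (auto simp: closed_ray_or_segment_def)
  then show thesis using that[of l] assms(2) by auto
qed

text \<open>Here \<open>h\<close> is bounded on compact pieces but not continuous, so the claim
  rests on \<open>integration_by_parts_bounded\<close> and not on the classical product
  rule.\<close>

lemma has_weak_derivative_antiderivative: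
  assumes I: "closed_ray_or_segment I"
    and h: "\<And>x y. x \<in> I \<Longrightarrow> y \<in> I \<Longrightarrow> x \<le> y \<Longrightarrow> (h has_integral (H y - H x)) {x..y}"
    and B: "\<And>x. x \<in> I \<Longrightarrow> \<exists>B. \<forall>z\<in>{0..x}. \<bar>h z\<bar> \<le> B"
  shows "has_weak_derivative H h I" "locally_integrable_on h I" "continuous_on I H"
proof -
  note I' = closed_ray_or_segmentD[OF I]
  show hl: "locally_integrable_on h I"
    unfolding locally_integrable_on_def
  proof (intro allI impI)
    fix s t assume st: "{s..t} \<subseteq> I"
    show "integrable (lebesgue_on {s..t}) h"
    proof (cases "s \<le> t")
      case True
      then have "s \<in> I" "t \<in> I" using st by auto
      then have "h integrable_on {s..t}" using h True by blast
      obtain B where "\<forall>z\<in>{0..t}. \<bar>h z\<bar> \<le> B" using B[OF \<open>t \<in> I\<close>] by blast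
      then have hB: "\<And>z. z \<in> {s..t} \<Longrightarrow> norm (h z) \<le> B" using I'(5)[OF \<open>s \<in> I\<close>] by auto
      have "h absolutely_integrable_on {s..t}"
        by (rule absolutely_integrable_integrable_bound[OF hB \<open>h integrable_on {s..t}\<close> integrable_const_ivl])
      then show ?thesis by (simp add: integrable_lebesgue_on_iff_absolutely_integrable_on)
    qed (simp add: integrable_lebesgue_on_continuous)
  qed
  show Hc: "continuous_on I H"
    unfolding continuous_on_eq_continuous_within
  proof
    fix x assume x: "x \<in> I"
    obtain z where z: "z \<in> I" "x \<le> z" "at x within I = at x within {0..z}"
      using at_within_closed_ray_or_segment[OF I x] by metis
    have sub: "y \<in> I" if "y \<in> {0..z}" for y using I'(6)[OF z(1)] that by auto
    have "h integrable_on {0..z}" using h[OF I'(4) z(1)] I'(5)[OF z(1)] by blast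
    then have "continuous_on {0..z} (\<lambda>x. integral {0..x} h + H 0)"
      by (intro continuous_intros indefinite_integral_continuous_1)
    moreover have "integral {0..y} h + H 0 = H y" if "y \<in> {0..z}" for y
      using integral_unique[OF h[OF I'(4) sub[OF that]]] that by simp
    ultimately have "continuous_on {0..z} H"
      using continuous_on_cong[of "{0..z}" "{0..z}" "\<lambda>x. integral {0..x} h + H 0" H] by simp
    then have "continuous (at x within {0..z}) H"
      using z(2) I'(5)[OF x] by (simp add: continuous_on_eq_continuous_within)
    then show "continuous (at x within I) H" using z(3) by (simp add: continuous_within)
  qed
  show "has_weak_derivative H h I"
    unfolding has_weak_derivative_iff
  proof (intro allI impI)
    fix \<phi> assume \<phi>: "test_function_on I \<phi>"
    obtain x0 where "x0 \<in> interior I" using I'(3) by blast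
    then have "{x0..x0} \<subseteq> interior I" by simp
    then obtain s t where
      st: "s \<le> x0" "x0 \<le> t" "{s..t} \<subseteq> interior I" "\<And>x. x \<notin> {s..t} \<Longrightarrow> \<phi> x = 0" "\<And>x. x \<notin> {s..t} \<Longrightarrow> deriv \<phi> x = 0"
      using test_function_on_support[OF \<phi> I'(1) _ order_refl[of x0]] by metis
    then have sub: "{s..t} \<subseteq> I" "s \<le> t" using interior_subset[of I] by (blast, linarith)
    then have stI: "s \<in> I" "t \<in> I" by auto
    obtain B where B: "\<And>z. z \<in> {0..t} \<Longrightarrow> \<bar>h z\<bar> \<le> B" using B[OF stI(2)] by blast
    have "((\<lambda>x. h x * \<phi> x + H x * deriv \<phi> x) has_integral (H t * \<phi> t - H s * \<phi> s)) {s..t}"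
    proof (rule integration_by_parts_bounded[OF sub(2)])
      show "(h has_integral H y - H x) {x..y}" if "s \<le> x" "x \<le> y" "y \<le> t" for x y
        by (rule h) (use that sub in auto)
      show "\<bar>h x\<bar> \<le> B" if "x \<in> {s..t}" for x using B[of x] that I'(5)[OF stI(1)] by auto
      show "(\<phi> has_real_derivative deriv \<phi> x) (at x within {s..t})" for x
        using test_function_on_DERIV(1)[OF \<phi>] by (rule has_field_derivative_at_within)
    qed (rule test_function_on_DERIV(2)[OF \<phi>])
    then have 0: "integral {s..t} (\<lambda>x. h x * \<phi> x + H x * deriv \<phi> x) = 0"
      using test_function_on_boundary[OF \<phi> st(4)] by (simp add: integral_unique)
    note cs = test_function_on_DERIV(3)[OF \<phi>, of "{s..t}"] test_function_on_DERIV(2)[OF \<phi>, of "{s..t}"]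
    note Hl = locally_integrable_on_continuous[OF Hc]
    have "(\<lambda>x. h x * \<phi> x) integrable_on {s..t}" "(\<lambda>x. H x * deriv \<phi> x) integrable_on {s..t}"
      using integrable_lebesgue_on_mult_continuous[of s t h \<phi>] integrable_lebesgue_on_mult_continuous[of s t H "deriv \<phi>"]
        hl Hl sub(1) cs unfolding locally_integrable_on_def by (simp_all add: integrable_on_lebesgue_on)
    then have "integral {s..t} (\<lambda>x. h x * \<phi> x) + integral {s..t} (\<lambda>x. H x * deriv \<phi> x) = 0"
      using 0 by (simp add: Henstock_Kurzweil_Integration.integral_add)
    then show "(LINT x|lebesgue_on I. H x * deriv \<phi> x) = - (LINT x|lebesgue_on I. h x * \<phi> x)"
      using integral_mult_supported(3)[OF hl I'(2) sub(1) cs(1) st(4)]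
        integral_mult_supported(3)[OF Hl I'(2) sub(1) cs(2) st(5)] by simp
  qed
qed

text \<open>Two applications of \<open>du_Bois_Reymond\<close>. Since \<open>w\<close> and the
  integral \<open>H\<close> of \<open>h\<close> have the same weak derivative, they differ by a
  constant, which yields the continuous representative \<open>du\<close> of \<open>w\<close>. The
  same comparison of \<open>u\<close> with the integral \<open>U\<close> of \<open>du\<close> makes
  \<open>u\<close> continuously differentiable.\<close>

theorem second_antiderivative_on_if_has_weak_derivatives:
  assumes I: "closed_ray_or_segment I"
    and u: "continuous_on I u" and w: "locally_integrable_on w I" and uw: "has_weak_derivative u w I"
    and h: "\<And>x. x \<in> I \<Longrightarrow> h integrable_on {0..x}"
    and B: "\<And>x. x \<in> I \<Longrightarrow> \<exists>B. \<forall>z\<in>{0..x}. \<bar>h z\<bar> \<le> B"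
    and wh: "has_weak_derivative w h I"
  obtains du where "second_antiderivative_on I u du h" "continuous_on I du" "AE x in lebesgue_on I. w x = du x"
proof -
  note I' = closed_ray_or_segmentD[OF I]
  define H where "H = (\<lambda>x. integral {0..x} h)"
  have hH: "(h has_integral (H y - H x)) {x..y}" if "x \<in> I" "y \<in> I" "x \<le> y" for x y
  proof -
    have "integral {0..x} h + integral {x..y} h = integral {0..y} h"
      by (rule Henstock_Kurzweil_Integration.integral_combine) (use that I'(5) h in auto)
    moreover have "h integrable_on {x..y}"
      using integrable_on_subinterval[OF h[OF that(2)]] I'(5)[OF that(1)] by auto
    ultimately show ?thesis unfolding H_def by (metis add_diff_cancel_left' integrable_integral)
  qed
  note Hh = has_weak_derivative_antiderivative[OF I hH B]
  note Hl = locally_integrable_on_continuous[OF Hh(3)]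
  obtain k where k: "AE x in lebesgue_on I. w x - H x = k"
  proof (rule du_Bois_Reymond[OF locally_integrable_on_diff[OF w Hl] I'(1,2,3)])
    fix \<phi> assume \<phi>: "test_function_on I \<phi>"
    then show "(LINT x|lebesgue_on I. (w x - H x) * deriv \<phi> x) = 0"
      using integrable_mult_test_function(2)[OF I w \<phi>] integrable_mult_test_function(2)[OF I Hl \<phi>]
        wh Hh(1) unfolding has_weak_derivative_iff by (simp add: left_diff_distrib)
  qed blast
  define du where "du = (\<lambda>x. H x + k)"
  have duc: "continuous_on I du" unfolding du_def by (intro continuous_intros Hh(3))
  have wdu: "AE x in lebesgue_on I. w x = du x" using k by (auto simp: du_def)
  define U where "U = (\<lambda>x. integral {0..x} du)"
  have duU: "(du has_integral (U y - U x)) {x..y}" if "x \<in> I" "y \<in> I" "x \<le> y" for x y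
  proof -
    have i: "du integrable_on {0..y}"
      by (rule integrable_continuous_real) (use duc I'(6)[OF that(2)] continuous_on_subset in blast)
    have "integral {0..x} du + integral {x..y} du = integral {0..y} du"
      by (rule Henstock_Kurzweil_Integration.integral_combine) (use that I'(5) i in auto)
    moreover have "du integrable_on {x..y}"
      using integrable_on_subinterval[OF i] I'(5)[OF that(1)] by auto
    ultimately show ?thesis unfolding U_def by (metis add_diff_cancel_left' integrable_integral)
  qed
  have duB: "\<exists>B. \<forall>z\<in>{0..x}. \<bar>du z\<bar> \<le> B" if "x \<in> I" for x
  proof -
    have "continuous_on {0..x} du" using duc I'(6)[OF that] continuous_on_subset by blast
    then have "bounded (du ` {0..x})" using compact_continuous_image compact_imp_bounded by blast
    then show ?thesis unfolding bounded_iff by auto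
  qed
  note Uu = has_weak_derivative_antiderivative[OF I duU duB]
  note Ul = locally_integrable_on_continuous[OF Uu(3)] and ul = locally_integrable_on_continuous[OF u]
  obtain k2 where k2: "AE x in lebesgue_on I. u x - U x = k2"
  proof (rule du_Bois_Reymond[OF locally_integrable_on_diff[OF ul Ul] I'(1,2,3)])
    fix \<phi> assume \<phi>: "test_function_on I \<phi>"
    have "(LINT x|lebesgue_on I. w x * \<phi> x) = (LINT x|lebesgue_on I. du x * \<phi> x)"
    proof (rule integral_cong_AE)
      show "(\<lambda>x. w x * \<phi> x) \<in> borel_measurable (lebesgue_on I)"
        "(\<lambda>x. du x * \<phi> x) \<in> borel_measurable (lebesgue_on I)"
        using integrable_mult_test_function(1)[OF I w \<phi>] integrable_mult_test_function(1)[OF I Uu(2) \<phi>]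
        by (auto dest: borel_measurable_integrable)
      show "AE x in lebesgue_on I. w x * \<phi> x = du x * \<phi> x" using wdu by auto
    qed
    then show "(LINT x|lebesgue_on I. (u x - U x) * deriv \<phi> x) = 0"
      using integrable_mult_test_function(2)[OF I ul \<phi>] integrable_mult_test_function(2)[OF I Ul \<phi>]
        uw Uu(1) \<phi> unfolding has_weak_derivative_iff by (simp add: left_diff_distrib)
  qed blast
  \<comment> \<open>Both sides are continuous, so the identity holds at every point and
    \<open>u\<close> itself needs no new representative.\<close>
  have uU: "u x = U x + k2" if "x \<in> I" for x
  proof -
    have "u x - U x - k2 = 0"
      by (rule continuous_on_AE_eq_0_imp_eq_0[OF I _ _ that, of "\<lambda>x. u x - U x - k2"])
        (use k2 in \<open>auto intro!: continuous_intros u Uu(3)\<close>)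
    then show ?thesis by simp
  qed
  have "(u has_real_derivative du x) (at x within I)" if x: "x \<in> I" for x
  proof -
    obtain z where z: "z \<in> I" "x \<le> z" "at x within I = at x within {0..z}"
      using at_within_closed_ray_or_segment[OF I x] by metis
    have "continuous_on {0..z} du" using duc I'(6)[OF z(1)] continuous_on_subset by blast
    then have "(U has_real_derivative du x) (at x within {0..z})"
      unfolding U_def by (rule integral_has_real_derivative) (use z(2) I'(5)[OF x] in auto)
    then have "((\<lambda>x. U x + k2) has_real_derivative du x) (at x within I)"
      unfolding z(3) by (auto intro!: derivative_eq_intros)
    then show ?thesis
      by (rule has_field_derivative_transform_within[OF _ zero_less_one x]) (simp add: uU)
  qed
  moreover have "(h has_integral (du y - du x)) {x..y}" if "x \<in> I" "y \<in> I" "x \<le> y" for x y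
    using hH[OF that] by (simp add: du_def)
  ultimately have "second_antiderivative_on I u du h" unfolding second_antiderivative_on_def by blast
  then show thesis using duc wdu that by blast
qed

section \<open>Test functions on a metric graph\<close>

lemma closed_ray_or_segment_edge_interval:
  assumes "wf_metric_graph G" "e \<in> edges G"
  shows "closed_ray_or_segment (edge_interval G e)"
proof (cases "len G e")
  case (real l)
  then have "edge_interval G e = {0..l}" "l > 0"
    using assms by (auto simp: edge_interval_def wf_metric_graph_def)
  then show ?thesis by (auto simp: closed_ray_or_segment_def)
next
  case PInf
  then have "edge_interval G e = {0..}" by (auto simp: edge_interval_def)
  then show ?thesis by (simp add: closed_ray_or_segment_def)
next
  case MInf
  then show ?thesis using assms by (auto simp: wf_metric_graph_def)
qed

lemma edge_point_in_gpoints: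
  assumes "wf_metric_graph G" "e \<in> edges G" "x \<in> edge_interval G e"
  shows "edge_point G e x \<in> gpoints G"
  using assms
  by (fastforce simp: wf_metric_graph_def edge_ends_def edge_interval_def edge_point_def gpoints_def
      split: if_splits)

text \<open>The quotient topology is final for the parametrisations of the edges. Agreement of the
  values at a vertex is automatic because all incident edges share the point
  \<open>Vertex\<close>.\<close>

lemma continuous_map_graph_topology_iff:
  assumes G: "wf_metric_graph G"
  shows "continuous_map (graph_topology G) euclideanreal u \<longleftrightarrow>
    (\<forall>e\<in>edges G. continuous_on (edge_interval G e) (on_edge G u e))"
proof -
  have eq: "{x \<in> edge_interval G e. edge_point G e x \<in> {z \<in> gpoints G. u z \<in> U}}
      = edge_interval G e \<inter> on_edge G u e -` U" if "e \<in> edges G" for e U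
    using edge_point_in_gpoints[OF G that] by (auto simp: on_edge_def)
  have "continuous_map (graph_topology G) euclideanreal u \<longleftrightarrow>
      (\<forall>U. open U \<longrightarrow> openin (graph_topology G) {z \<in> gpoints G. u z \<in> U})"
    by (simp add: continuous_map topspace_graph_topology[OF G] open_openin[symmetric])
  also have "\<dots> \<longleftrightarrow> (\<forall>U. open U \<longrightarrow> (\<forall>e\<in>edges G.
      openin (top_of_set (edge_interval G e)) (edge_interval G e \<inter> on_edge G u e -` U)))"
    unfolding openin_graph_topology using eq by auto
  also have "\<dots> \<longleftrightarrow> (\<forall>e\<in>edges G. continuous_on (edge_interval G e) (on_edge G u e))"
    unfolding continuous_openin_preimage_eq by blast
  finally show ?thesis .
qed

text \<open>This lets an explicitly computed weak derivative replace the representative picked by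
  \<open>SOME\<close>.\<close>

lemma weak_derivative_AE_eq:
  assumes "closed_ray_or_segment I" "square_integrable_on g I" "has_weak_derivative f g I"
  shows "AE x in lebesgue_on I. weak_derivative f I x = g x"
    and "square_integrable_on (weak_derivative f I) I"
    and "has_weak_derivative f (weak_derivative f I) I"
proof -
  have *: "square_integrable_on (weak_derivative f I) I \<and> has_weak_derivative f (weak_derivative f I) I"
    unfolding weak_derivative_def by (rule someI[of _ g]) (use assms in simp)
  then show "square_integrable_on (weak_derivative f I) I" "has_weak_derivative f (weak_derivative f I) I"
    by auto
  show "AE x in lebesgue_on I. weak_derivative f I x = g x"
    using has_weak_derivative_AE_unique[OF assms(1)] * assms(2,3)
      square_integrable_on_imp_locally_integrable_on closed_ray_or_segmentD(2)[OF assms(1)] by blast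
qed

lemma graphs_finD:
  assumes "G \<in> graphs_fin"
  shows "wf_metric_graph G" "finite (edges G)" "finite (verts G)"
  using assms by (auto simp: graphs_fin_def graphs_def)

lemma square_integrable_on_continuous_supported:
  assumes I: "closed_ray_or_segment I" and f: "continuous_on I f"
    and r: "r \<in> I" "\<And>x. x \<in> I \<Longrightarrow> r < x \<Longrightarrow> f x = 0"
  shows "square_integrable_on f I"
  unfolding square_integrable_on_def
proof
  note I' = closed_ray_or_segmentD[OF I]
  show "f \<in> borel_measurable (lebesgue_on I)"
    by (rule continuous_imp_measurable_on_sets_lebesgue[OF f I'(2)])
  have "continuous_on {0..r} (\<lambda>x. (f x)\<^sup>2)"
    using f I'(6)[OF r(1)] continuous_on_subset by (intro continuous_intros) blast
  then have "integrable (lebesgue_on {0..r}) (\<lambda>x. (f x)\<^sup>2)"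
    by (rule integrable_lebesgue_on_continuous)
  moreover have "(f x)\<^sup>2 = 0" if "x \<in> I - {0..r}" for x
    using r(2)[of x] I'(5)[of x] that by auto
  ultimately show "integrable (lebesgue_on I) (\<lambda>x. (f x)\<^sup>2)"
    using lebesgue_on_supported(1)[of "{0..r}" I "\<lambda>x. (f x)\<^sup>2"] I'(2) I'(6)[OF r(1)] by simp
qed

text \<open>Half-lines prevent the graph from being compact. Cutting every edge at a parameter
  \<open>r e\<close> leaves a finite union of images of compact intervals, which serves as an upper
  bound for supports. Adding all vertices makes the complement consist of inner points of
  edges.\<close>

lemma compactin_graph_topology_truncation:
  assumes G: "G \<in> graphs_fin" and r: "\<And>e. e \<in> edges G \<Longrightarrow> r e \<in> edge_interval G e"
  defines "C \<equiv> Vertex ` verts G \<union> (\<Union>e\<in>edges G. edge_point G e ` {0..r e})"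
  shows "compactin (graph_topology G) C" "closedin (graph_topology G) C"
proof -
  note G' = graphs_finD[OF G]
  have Ie: "{0..r e} \<subseteq> edge_interval G e" if "e \<in> edges G" for e
    using closed_ray_or_segmentD(6)[OF closed_ray_or_segment_edge_interval[OF G'(1) that] r[OF that]] .
  have C: "C \<subseteq> gpoints G"
  proof -
    have "edge_point G e ` {0..r e} \<subseteq> gpoints G" if "e \<in> edges G" for e
      using Ie[OF that] edge_point_in_gpoints[OF G'(1) that] by blast
    moreover have "Vertex ` verts G \<subseteq> gpoints G" by (auto simp: gpoints_def)
    ultimately show ?thesis unfolding C_def by blast
  qed
  have "compactin (graph_topology G) (edge_point G e ` {0..r e})" if e: "e \<in> edges G" for e
  proof (rule image_compactin)
    show "compactin (top_of_set (edge_interval G e)) {0..r e}"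
      using Ie[OF e] by (simp add: compactin_subtopology)
    show "continuous_map (top_of_set (edge_interval G e)) (graph_topology G) (edge_point G e)"
      unfolding continuous_map topspace_graph_topology[OF G'(1)] openin_graph_topology
      using edge_point_in_gpoints[OF G'(1) e] e by auto
  qed
  moreover have "compactin (graph_topology G) (Vertex ` verts G)"
    by (rule finite_imp_compactin) (use C G'(3) in \<open>auto simp: C_def topspace_graph_topology[OF G'(1)]\<close>)
  ultimately show "compactin (graph_topology G) C"
    unfolding C_def using G'(2) by (intro compactin_Un compactin_Union) auto
  show "closedin (graph_topology G) C"
    unfolding closedin_def topspace_graph_topology[OF G'(1)]
  proof (rule conjI[OF C])
    have "openin (top_of_set (edge_interval G e)) {x \<in> edge_interval G e. edge_point G e x \<in> gpoints G - C}"
      if e: "e \<in> edges G" for e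
    proof -
      \<comment> \<open>The far end of a bounded edge is a vertex and hence belongs to
        \<open>C\<close> even when it lies beyond \<open>r e\<close>; this is why the strict bound
        by the length appears.\<close>
      have "{x \<in> edge_interval G e. edge_point G e x \<in> gpoints G - C}
          = edge_interval G e \<inter> ({r e<..} \<inter> {x. ereal x < len G e})"
      proof (intro set_eqI iffI)
        fix x assume x: "x \<in> {x \<in> edge_interval G e. edge_point G e x \<in> gpoints G - C}"
        then have xI: "x \<in> edge_interval G e" "0 \<le> x" "ereal x \<le> len G e" and nC: "edge_point G e x \<notin> C"
          and gp: "edge_point G e x \<in> gpoints G"
          by (auto simp: edge_interval_def)
        have "\<not> x \<le> r e" using nC xI e unfolding C_def by auto
        moreover have "ereal x \<noteq> len G e"
        proof
          assume "ereal x = len G e"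
          then have "edge_point G e x \<in> range Vertex" by (auto simp: edge_point_def)
          then have "edge_point G e x \<in> Vertex ` verts G" using gp by (auto simp: gpoints_def)
          then show False using nC by (simp add: C_def)
        qed
        ultimately show "x \<in> edge_interval G e \<inter> ({r e<..} \<inter> {x. ereal x < len G e})"
          using xI by auto
      next
        fix x assume x: "x \<in> edge_interval G e \<inter> ({r e<..} \<inter> {x. ereal x < len G e})"
        have "0 \<le> r e" using r[OF e] by (simp add: edge_interval_def)
        then have ep: "edge_point G e x = Inner e x" using x by (auto simp: edge_point_def)
        have "Inner e x \<notin> C"
        proof
          assume "Inner e x \<in> C"
          then obtain e' y where "y \<in> {0..r e'}" "Inner e x = edge_point G e' y"
            unfolding C_def by auto
          then have "e' = e" "y = x" by (auto simp: edge_point_def split: if_splits)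
          then show False using \<open>y \<in> {0..r e'}\<close> x by auto
        qed
        then show "x \<in> {x \<in> edge_interval G e. edge_point G e x \<in> gpoints G - C}"
          using x ep edge_point_in_gpoints[OF G'(1) e, of x] by auto
      qed
      moreover have "open {x. ereal x < len G e}"
      proof (cases "len G e")
        case (real l)
        then have "{x. ereal x < len G e} = {..<l}" by auto
        then show ?thesis by simp
      qed auto
      ultimately show ?thesis by (simp add: openin_open_Int open_Int)
    qed
    then show "openin (graph_topology G) (gpoints G - C)"
      unfolding openin_graph_topology by auto
  qed
qed

text \<open>Membership in the test space is reduced to data on single edges. Vanishing beyond some
  \<open>r\<close> restricts only half-lines, since on a bounded edge \<open>r\<close> can be its
  length. The second claim identifies \<open>edge_deriv\<close> with the candidate \<open>d\<close>
  at hand.\<close>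

theorem graph_test_function:
  assumes G: "G \<in> graphs_fin"
    and out: "\<And>z. z \<notin> gpoints G \<Longrightarrow> \<phi> z = 0"
    and c: "\<And>e. e \<in> edges G \<Longrightarrow> continuous_on (edge_interval G e) (on_edge G \<phi> e)"
    and r: "\<And>e. e \<in> edges G \<Longrightarrow> \<exists>r\<in>edge_interval G e. \<forall>x\<in>edge_interval G e. r < x \<longrightarrow> on_edge G \<phi> e x = 0"
    and d: "\<And>e. e \<in> edges G \<Longrightarrow> has_weak_derivative (on_edge G \<phi> e) (d e) (edge_interval G e)"
      "\<And>e. e \<in> edges G \<Longrightarrow> square_integrable_on (d e) (edge_interval G e)"
  shows "\<phi> \<in> H1 G \<inter> Cc G"
    and "\<And>e. e \<in> edges G \<Longrightarrow> AE x in lebesgue_on (edge_interval G e). edge_deriv G \<phi> e x = d e x"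
proof -
  note G' = graphs_finD[OF G]
  note I = closed_ray_or_segment_edge_interval[OF G'(1)]
  have cm: "continuous_map (graph_topology G) euclideanreal \<phi>"
    using c by (simp add: continuous_map_graph_topology_iff[OF G'(1)])
  have "\<forall>e\<in>edges G. \<exists>r. r \<in> edge_interval G e \<and> (\<forall>x\<in>edge_interval G e. r < x \<longrightarrow> on_edge G \<phi> e x = 0)"
    using r by blast
  then obtain r where r: "\<And>e. e \<in> edges G \<Longrightarrow> r e \<in> edge_interval G e"
    "\<And>e x. e \<in> edges G \<Longrightarrow> x \<in> edge_interval G e \<Longrightarrow> r e < x \<Longrightarrow> on_edge G \<phi> e x = 0"
    by metis
  have "on_edge G \<phi> e \<in> H1_on (edge_interval G e)" if e: "e \<in> edges G" for e
    unfolding H1_on_def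
    using square_integrable_on_continuous_supported[OF I[OF e] c[OF e] r(1)[OF e] r(2)[OF e]] d[OF e] by blast
  then have "\<phi> \<in> H1 G" unfolding H1_def using cm G'(2) by simp
  define C where "C = Vertex ` verts G \<union> (\<Union>e\<in>edges G. edge_point G e ` {0..r e})"
  have C: "compactin (graph_topology G) C" "closedin (graph_topology G) C"
    unfolding C_def using compactin_graph_topology_truncation[OF G r(1)] by auto
  have "{x \<in> gpoints G. \<phi> x \<noteq> 0} \<subseteq> C"
  proof
    fix z assume z: "z \<in> {x \<in> gpoints G. \<phi> x \<noteq> 0}"
    then consider v where "v \<in> verts G" "z = Vertex v"
      | e x where "e \<in> edges G" "0 < x" "ereal x < len G e" "z = Inner e x"
      unfolding gpoints_def by blast
    then show "z \<in> C"
    proof cases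
      case 1
      then show ?thesis by (simp add: C_def)
    next
      case 2
      then have zx: "z = edge_point G e x" "x \<in> edge_interval G e"
        by (auto simp: edge_point_def edge_interval_def)
      then have "\<not> r e < x" using r(2)[OF 2(1) zx(2)] z by (auto simp: on_edge_def)
      then have "x \<in> {0..r e}" using 2 by simp
      then have "z \<in> edge_point G e ` {0..r e}" unfolding zx(1) by (rule imageI)
      then show ?thesis using 2(1) unfolding C_def by blast
    qed
  qed
  then have "graph_topology G closure_of {x \<in> gpoints G. \<phi> x \<noteq> 0} \<subseteq> C"
    using C(2) by (rule closure_of_minimal)
  then have "compactin (graph_topology G) (graph_topology G closure_of {x \<in> gpoints G. \<phi> x \<noteq> 0})"
    using closed_compactin[OF C(1)] closedin_closure_of by blast
  then have "\<phi> \<in> Cc G" unfolding Cc_def using cm out by blast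
  with \<open>\<phi> \<in> H1 G\<close> show "\<phi> \<in> H1 G \<inter> Cc G" by blast
  show "AE x in lebesgue_on (edge_interval G e). edge_deriv G \<phi> e x = d e x" if "e \<in> edges G" for e
    unfolding edge_deriv_def by (rule weak_derivative_AE_eq(1)[OF I[OF that] d(2)[OF that] d(1)[OF that]])
qed

text \<open>Extension by zero from one edge to the graph. The range conditions on \<open>x\<close>
  give the value zero off the graph, as \<open>Cc\<close> demands. All vertices get the value 0, so
  \<open>f\<close> has to vanish at the ends of the edge for the extension to restrict to
  \<open>f\<close>.\<close>

definition edge_fun :: "('v, 'e) metric_graph \<Rightarrow> 'e \<Rightarrow> (real \<Rightarrow> real) \<Rightarrow> ('v, 'e) gpoint \<Rightarrow> real" where
  "edge_fun G e f z = (case z of Vertex v \<Rightarrow> 0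
     | Inner e' x \<Rightarrow> if e' = e \<and> 0 < x \<and> ereal x < len G e then f x else 0)"

lemma on_edge_edge_fun:
  assumes "x \<in> edge_interval G e'" "f 0 = 0" "ereal x = len G e \<Longrightarrow> f x = 0"
  shows "on_edge G (edge_fun G e f) e' x = (if e' = e then f x else 0)"
  using assms by (auto simp: on_edge_def edge_fun_def edge_point_def edge_interval_def)

theorem edge_fun_test_function:
  assumes G: "G \<in> graphs_fin" and e: "e \<in> edges G"
    and f: "continuous_on (edge_interval G e) f" "f 0 = 0" "\<And>x. ereal x = len G e \<Longrightarrow> f x = 0"
    and r: "r \<in> edge_interval G e" "\<And>x. x \<in> edge_interval G e \<Longrightarrow> r < x \<Longrightarrow> f x = 0"
    and d: "has_weak_derivative f d (edge_interval G e)" "square_integrable_on d (edge_interval G e)"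
  shows "edge_fun G e f \<in> H1 G \<inter> Cc G"
    and "AE x in lebesgue_on (edge_interval G e). edge_deriv G (edge_fun G e f) e x = d x"
    and "\<And>e'. e' \<in> edges G \<Longrightarrow> e' \<noteq> e \<Longrightarrow>
      AE x in lebesgue_on (edge_interval G e'). edge_deriv G (edge_fun G e f) e' x = 0"
proof -
  note G' = graphs_finD[OF G]
  note I = closed_ray_or_segment_edge_interval[OF G'(1)]
  let ?\<phi> = "edge_fun G e f" and ?d = "\<lambda>e' x. if e' = e then d x else 0"
  have on: "on_edge G ?\<phi> e' x = (if e' = e then f x else 0)" if "x \<in> edge_interval G e'" for e' x
    using on_edge_edge_fun[OF that] f by simp
  have wd: "has_weak_derivative (on_edge G ?\<phi> e') (?d e') (edge_interval G e')" if e': "e' \<in> edges G" for e'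
  proof -
    have "has_weak_derivative (\<lambda>x. if e' = e then f x else 0) (?d e') (edge_interval G e')"
      using d(1) by (cases "e' = e") (auto simp: has_weak_derivative_def)
    moreover have "(LINT x|lebesgue_on (edge_interval G e'). on_edge G ?\<phi> e' x * \<psi> x)
        = (LINT x|lebesgue_on (edge_interval G e'). (if e' = e then f x else 0) * \<psi> x)" for \<psi>
      by (rule Bochner_Integration.integral_cong) (use on in auto)
    ultimately show ?thesis unfolding has_weak_derivative_def by simp
  qed
  have sq: "square_integrable_on (?d e') (edge_interval G e')" if "e' \<in> edges G" for e'
    using d(2) by (cases "e' = e") (auto simp: square_integrable_on_def)
  have cont: "continuous_on (edge_interval G e') (on_edge G ?\<phi> e')" if "e' \<in> edges G" for e'
  proof -
    have "continuous_on (edge_interval G e') (\<lambda>x. if e' = e then f x else 0)"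
      using f(1) by (cases "e' = e") auto
    then show ?thesis by (rule continuous_on_eq) (simp add: on)
  qed
  have van: "\<exists>r\<in>edge_interval G e'. \<forall>x\<in>edge_interval G e'. r < x \<longrightarrow> on_edge G ?\<phi> e' x = 0"
    if e': "e' \<in> edges G" for e'
  proof (cases "e' = e")
    case True
    then show ?thesis using on r by (intro bexI[of _ r]) auto
  next
    case False
    then show ?thesis using on closed_ray_or_segmentD(4)[OF I[OF e']] by (intro bexI[of _ 0]) auto
  qed
  have out: "?\<phi> z = 0" if "z \<notin> gpoints G" for z
    using that e by (cases z) (auto simp: edge_fun_def gpoints_def)
  show "?\<phi> \<in> H1 G \<inter> Cc G"
    by (rule graph_test_function(1)[where d = ?d, OF G]) (fact out cont van wd sq)+
  have T: "AE x in lebesgue_on (edge_interval G e'). edge_deriv G ?\<phi> e' x = ?d e' x"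
    if "e' \<in> edges G" for e'
    by (rule graph_test_function(2)[where d = ?d, OF G _ _ _ _ _ that]) (fact out cont van wd sq)+
  show "AE x in lebesgue_on (edge_interval G e). edge_deriv G ?\<phi> e x = d x" using T[OF e] by simp
  show "AE x in lebesgue_on (edge_interval G e'). edge_deriv G ?\<phi> e' x = 0"
    if "e' \<in> edges G" "e' \<noteq> e" for e'
    using T[OF that(1)] that(2) by simp
qed

section \<open>Solutions on an edge\<close>

text \<open>The bounds on \<open>W\<close> and \<open>\<rho>\<close> are required at every point.
  The coefficients are replaced by suitable representatives once, in the final theorem, and no later
  estimate has to carry null sets.\<close>

definition edge_solution ::
  "real set \<Rightarrow> real \<Rightarrow> real \<Rightarrow> real \<Rightarrow> real \<Rightarrow> (real \<Rightarrow> real) \<Rightarrow> (real \<Rightarrow> real) \<Rightarrow>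
   (real \<Rightarrow> real) \<Rightarrow> (real \<Rightarrow> real) \<Rightarrow> bool" where
  "edge_solution I p lam Wbar b W \<rho> u du \<longleftrightarrow> closed_ray_or_segment I \<and>
     W \<in> borel_measurable (lebesgue_on I) \<and> \<rho> \<in> borel_measurable (lebesgue_on I) \<and>
     (\<forall>x. \<bar>W x\<bar> \<le> Wbar) \<and> (\<forall>x. 0 \<le> \<rho> x \<and> \<rho> x \<le> b) \<and>
     second_antiderivative_on I u du (\<lambda>x. (W x + lam - \<rho> x * \<bar>u x\<bar> powr (p - 2)) * u x) \<and>
     continuous_on I du \<and> square_integrable_on u I \<and> square_integrable_on du I"

lemma locally_integrable_on_bounded:
  assumes I: "closed_ray_or_segment I" and f: "f \<in> borel_measurable (lebesgue_on I)"
    and B: "\<And>x. x \<in> I \<Longrightarrow> \<exists>B. \<forall>z\<in>{0..x}. \<bar>f z\<bar> \<le> B"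
  shows "locally_integrable_on f I" "x \<in> I \<Longrightarrow> f integrable_on {0..x}"
proof -
  note I' = closed_ray_or_segmentD[OF I]
  have *: "integrable (lebesgue_on {0..x}) f" if x: "x \<in> I" for x
  proof -
    obtain B where B: "\<And>z. z \<in> {0..x} \<Longrightarrow> \<bar>f z\<bar> \<le> B" using B[OF x] by blast
    have "integrable (lebesgue_on {0..x}) (\<lambda>_. B)"
      by (rule integrable_lebesgue_on_continuous) simp
    moreover have "f \<in> borel_measurable (lebesgue_on {0..x})"
      using measurable_restrict_mono[OF f I'(6)[OF x]] .
    moreover have "AE z in lebesgue_on {0..x}. norm (f z) \<le> norm B"
      using B by (intro AE_I2) fastforce
    ultimately show ?thesis by (rule Bochner_Integration.integrable_bound)
  qed
  show "x \<in> I \<Longrightarrow> f integrable_on {0..x}" using integrable_on_lebesgue_on[OF *] by simp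
  show "locally_integrable_on f I"
    unfolding locally_integrable_on_def
  proof (intro allI impI)
    fix s t assume st: "{s..t} \<subseteq> I"
    show "integrable (lebesgue_on {s..t}) f"
    proof (cases "s \<le> t")
      case True
      then have "s \<in> I" "t \<in> I" using st by auto
      then show ?thesis
        using integrable_lebesgue_on_subset[OF *[of t], of "{s..t}"] I'(5)[of s] by auto
    qed (simp add: integrable_lebesgue_on_continuous)
  qed
qed

lemma continuous_on_locally_bounded:
  assumes "closed_ray_or_segment I" "continuous_on I f" "x \<in> I"
  obtains B :: real where "0 \<le> B" "\<And>z. z \<in> {0..x} \<Longrightarrow> \<bar>f z\<bar> \<le> B"
proof -
  have "continuous_on {0..x} f"
    using assms(2) closed_ray_or_segmentD(6)[OF assms(1,3)] continuous_on_subset by blast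
  then have "bounded (f ` {0..x})" using compact_continuous_image compact_imp_bounded by blast
  then obtain B where "\<forall>z\<in>{0..x}. \<bar>f z\<bar> \<le> B" unfolding bounded_iff by auto
  then show thesis using that[of "max 0 B"] by fastforce
qed

lemma H1D:
  assumes G: "G \<in> graphs_fin" and u: "u \<in> H1 G" and e: "e \<in> edges G"
  shows "continuous_on (edge_interval G e) (on_edge G u e)"
    "square_integrable_on (on_edge G u e) (edge_interval G e)"
    "square_integrable_on (edge_deriv G u e) (edge_interval G e)"
    "has_weak_derivative (on_edge G u e) (edge_deriv G u e) (edge_interval G e)"
proof -
  note G' = graphs_finD[OF G]
  note I = closed_ray_or_segment_edge_interval[OF G'(1) e]
  show "continuous_on (edge_interval G e) (on_edge G u e)"
    using u e continuous_map_graph_topology_iff[OF G'(1)] unfolding H1_def by blast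
  have "on_edge G u e \<in> H1_on (edge_interval G e)" using u e unfolding H1_def by blast
  then obtain g where "square_integrable_on (on_edge G u e) (edge_interval G e)"
    "square_integrable_on g (edge_interval G e)" "has_weak_derivative (on_edge G u e) g (edge_interval G e)"
    unfolding H1_on_def by blast
  then show "square_integrable_on (on_edge G u e) (edge_interval G e)"
    "square_integrable_on (edge_deriv G u e) (edge_interval G e)"
    "has_weak_derivative (on_edge G u e) (edge_deriv G u e) (edge_interval G e)"
    using weak_derivative_AE_eq(2,3)[OF I] unfolding edge_deriv_def by blast+
qed

text \<open>The weak equation with every ingredient exchanged for an almost everywhere equal
  representative, and with the infinite sum over edges turned into a finite one.\<close>

lemma weak_solution_identity:
  fixes W\<^sub>e \<rho>\<^sub>e w d f :: "'e \<Rightarrow> real \<Rightarrow> real"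
  assumes G: "G \<in> graphs_fin" and sol: "weak_solution G p W lam \<rho> u"
    and L: "W \<in> Linfty G" "\<rho> \<in> Linfty G" and \<phi>: "\<phi> \<in> H1 G \<inter> Cc G"
    and f: "\<And>e x. e \<in> edges G \<Longrightarrow> x \<in> edge_interval G e \<Longrightarrow> on_edge G \<phi> e x = f e x"
    and AE: "\<And>e. e \<in> edges G \<Longrightarrow> AE x in lebesgue_on (edge_interval G e). on_edge G W e x = W\<^sub>e e x"
      "\<And>e. e \<in> edges G \<Longrightarrow> AE x in lebesgue_on (edge_interval G e). on_edge G \<rho> e x = \<rho>\<^sub>e e x"
      "\<And>e. e \<in> edges G \<Longrightarrow> AE x in lebesgue_on (edge_interval G e). edge_deriv G u e x = w e x"
      "\<And>e. e \<in> edges G \<Longrightarrow> AE x in lebesgue_on (edge_interval G e). edge_deriv G \<phi> e x = d e x"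
    and meas: "\<And>e. e \<in> edges G \<Longrightarrow> W\<^sub>e e \<in> borel_measurable (lebesgue_on (edge_interval G e))"
      "\<And>e. e \<in> edges G \<Longrightarrow> \<rho>\<^sub>e e \<in> borel_measurable (lebesgue_on (edge_interval G e))"
      "\<And>e. e \<in> edges G \<Longrightarrow> w e \<in> borel_measurable (lebesgue_on (edge_interval G e))"
      "\<And>e. e \<in> edges G \<Longrightarrow> d e \<in> borel_measurable (lebesgue_on (edge_interval G e))"
  shows "(\<Sum>e\<in>edges G. LINT x|lebesgue_on (edge_interval G e). w e x * d e x +
      (W\<^sub>e e x + lam) * on_edge G u e x * f e x) =
    (\<Sum>e\<in>edges G. LINT x|lebesgue_on (edge_interval G e). \<rho>\<^sub>e e x * \<bar>on_edge G u e x\<bar> powr (p - 2) *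
      on_edge G u e x * f e x)"
proof -
  note G' = graphs_finD[OF G]
  have uH: "u \<in> H1 G" using sol by (simp add: weak_solution_def)
  have m: "on_edge G W e \<in> borel_measurable (lebesgue_on (edge_interval G e))"
    "on_edge G \<rho> e \<in> borel_measurable (lebesgue_on (edge_interval G e))"
    "on_edge G u e \<in> borel_measurable (lebesgue_on (edge_interval G e))"
    "on_edge G \<phi> e \<in> borel_measurable (lebesgue_on (edge_interval G e))"
    "edge_deriv G u e \<in> borel_measurable (lebesgue_on (edge_interval G e))"
    "edge_deriv G \<phi> e \<in> borel_measurable (lebesgue_on (edge_interval G e))"
    if e: "e \<in> edges G" for e
    using H1D(2,3)[OF G uH e] H1D(2,3)[OF G _ e, of \<phi>] \<phi> L e
    by (auto simp: square_integrable_on_def Linfty_def)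
  have mf: "f e \<in> borel_measurable (lebesgue_on (edge_interval G e))" if e: "e \<in> edges G" for e
    using m(4)[OF e] f[OF e] by (subst measurable_cong[of _ _ "on_edge G \<phi> e"]) auto
  have fA: "AE x in lebesgue_on (edge_interval G e). on_edge G \<phi> e x = f e x" if e: "e \<in> edges G" for e
    using f[OF e] by (intro AE_I2) auto
  have "graph_integral G (\<lambda>e x. edge_deriv G u e x * edge_deriv G \<phi> e x +
          (on_edge G W e x + lam) * on_edge G u e x * on_edge G \<phi> e x)
      = (\<Sum>e\<in>edges G. LINT x|lebesgue_on (edge_interval G e). w e x * d e x +
          (W\<^sub>e e x + lam) * on_edge G u e x * f e x)"
    unfolding graph_integral_def infsum_finite[OF G'(2)]
  proof (rule sum.cong[OF refl])
    fix e assume e: "e \<in> edges G"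
    note [measurable] = m[OF e] meas[OF e] mf[OF e]
    show "(LINT x|lebesgue_on (edge_interval G e). edge_deriv G u e x * edge_deriv G \<phi> e x +
          (on_edge G W e x + lam) * on_edge G u e x * on_edge G \<phi> e x)
      = (LINT x|lebesgue_on (edge_interval G e). w e x * d e x +
          (W\<^sub>e e x + lam) * on_edge G u e x * f e x)"
    proof (rule integral_cong_AE)
      show "AE x in lebesgue_on (edge_interval G e). edge_deriv G u e x * edge_deriv G \<phi> e x +
          (on_edge G W e x + lam) * on_edge G u e x * on_edge G \<phi> e x = w e x * d e x +
          (W\<^sub>e e x + lam) * on_edge G u e x * f e x"
        using AE(1)[OF e] AE(3)[OF e] AE(4)[OF e] fA[OF e] by eventually_elim simp
    qed measurable
  qed
  moreover have "graph_integral G (\<lambda>e x. on_edge G \<rho> e x * \<bar>on_edge G u e x\<bar> powr (p - 2) *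
          on_edge G u e x * on_edge G \<phi> e x)
      = (\<Sum>e\<in>edges G. LINT x|lebesgue_on (edge_interval G e). \<rho>\<^sub>e e x * \<bar>on_edge G u e x\<bar> powr (p - 2) *
          on_edge G u e x * f e x)"
    unfolding graph_integral_def infsum_finite[OF G'(2)]
  proof (rule sum.cong[OF refl])
    fix e assume e: "e \<in> edges G"
    note [measurable] = m[OF e] meas[OF e] mf[OF e]
    show "(LINT x|lebesgue_on (edge_interval G e). on_edge G \<rho> e x * \<bar>on_edge G u e x\<bar> powr (p - 2) *
          on_edge G u e x * on_edge G \<phi> e x)
      = (LINT x|lebesgue_on (edge_interval G e). \<rho>\<^sub>e e x * \<bar>on_edge G u e x\<bar> powr (p - 2) *
          on_edge G u e x * f e x)"
    proof (rule integral_cong_AE)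
      show "AE x in lebesgue_on (edge_interval G e). on_edge G \<rho> e x * \<bar>on_edge G u e x\<bar> powr (p - 2) *
          on_edge G u e x * on_edge G \<phi> e x
         = \<rho>\<^sub>e e x * \<bar>on_edge G u e x\<bar> powr (p - 2) * on_edge G u e x * f e x"
        using AE(2)[OF e] fA[OF e] by eventually_elim simp
    qed measurable
  qed
  ultimately show ?thesis using sol \<phi> unfolding weak_solution_def by simp
qed

text \<open>Test functions supported inside the single edge show that the weak derivative of
  \<open>u'\<close> is the right hand side \<open>h\<close> of the equation. As \<open>u\<close> is
  continuous, \<open>h\<close> is bounded on compact pieces, so the regularity theorem applies and
  improves \<open>u'\<close> from square integrable to continuous.\<close>

theorem edge_solution_if_weak_solution:
  assumes G: "G \<in> graphs_fin" and p: "2 < p" and sol: "weak_solution G p W lam \<rho> u"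
    and L: "W \<in> Linfty G" "\<rho> \<in> Linfty G" and e: "e \<in> edges G"
    and AEe: "AE x in lebesgue_on (edge_interval G e). on_edge G W e x = W\<^sub>e x"
      "AE x in lebesgue_on (edge_interval G e). on_edge G \<rho> e x = \<rho>\<^sub>e x"
    and meas: "W\<^sub>e \<in> borel_measurable (lebesgue_on (edge_interval G e))"
      "\<rho>\<^sub>e \<in> borel_measurable (lebesgue_on (edge_interval G e))"
    and bound: "\<And>x. \<bar>W\<^sub>e x\<bar> \<le> Wbar" "\<And>x. 0 \<le> \<rho>\<^sub>e x \<and> \<rho>\<^sub>e x \<le> b"
  obtains du where "edge_solution (edge_interval G e) p lam Wbar b W\<^sub>e \<rho>\<^sub>e (on_edge G u e) du"
    "AE x in lebesgue_on (edge_interval G e). edge_deriv G u e x = du x"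
proof -
  note G' = graphs_finD[OF G]
  define I where "I = edge_interval G e"
  define v where "v = on_edge G u e"
  define w where "w = edge_deriv G u e"
  have I: "closed_ray_or_segment I" unfolding I_def by (rule closed_ray_or_segment_edge_interval[OF G'(1) e])
  note I' = closed_ray_or_segmentD[OF I]
  have uH: "u \<in> H1 G" using sol by (simp add: weak_solution_def)
  note v = H1D[OF G uH e, folded I_def v_def w_def]
  have [measurable]: "W\<^sub>e \<in> borel_measurable (lebesgue_on I)" "\<rho>\<^sub>e \<in> borel_measurable (lebesgue_on I)"
    "v \<in> borel_measurable (lebesgue_on I)"
    using meas v(2) by (auto simp: I_def square_integrable_on_def)
  have wl: "locally_integrable_on w I"
    using square_integrable_on_imp_locally_integrable_on[OF v(3) I'(2)] .
  \<comment> \<open>The weak equation has the linear part on the left and the nonlinear part on the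
    right; each must be integrable against test functions before the two are combined into
    \<open>h\<close>.\<close>
  define h1 where "h1 = (\<lambda>x. (W\<^sub>e x + lam) * v x)"
  define h2 where "h2 = (\<lambda>x. \<rho>\<^sub>e x * \<bar>v x\<bar> powr (p - 2) * v x)"
  define h where "h = (\<lambda>x. (W\<^sub>e x + lam - \<rho>\<^sub>e x * \<bar>v x\<bar> powr (p - 2)) * v x)"
  have h_eq: "h x = h1 x - h2 x" for x by (simp add: h_def h1_def h2_def algebra_simps)
  have B1: "\<exists>B. \<forall>z\<in>{0..x}. \<bar>h1 z\<bar> \<le> B" and B2: "\<exists>B. \<forall>z\<in>{0..x}. \<bar>h2 z\<bar> \<le> B" if x: "x \<in> I" for x
  proof -
    obtain M where M: "0 \<le> M" "\<And>z. z \<in> {0..x} \<Longrightarrow> \<bar>v z\<bar> \<le> M"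
      using continuous_on_locally_bounded[OF I v(1) x] by blast
    have "\<bar>h1 z\<bar> \<le> (Wbar + \<bar>lam\<bar>) * M" if "z \<in> {0..x}" for z
      unfolding h1_def abs_mult using M(2)[OF that] bound(1)[of z] by (intro mult_mono) auto
    then show "\<exists>B. \<forall>z\<in>{0..x}. \<bar>h1 z\<bar> \<le> B" by blast
    have "\<bar>h2 z\<bar> \<le> b * M powr (p - 2) * M" if "z \<in> {0..x}" for z
    proof -
      have "\<bar>v z\<bar> powr (p - 2) \<le> M powr (p - 2)" using M(2)[OF that] p by (intro powr_mono2) auto
      then show ?thesis
        unfolding h2_def abs_mult using M(1) M(2)[OF that] bound(2)[of z] by (intro mult_mono) auto
    qed
    then show "\<exists>B. \<forall>z\<in>{0..x}. \<bar>h2 z\<bar> \<le> B" by blast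
  qed
  have B: "\<exists>B. \<forall>z\<in>{0..x}. \<bar>h z\<bar> \<le> B" if x: "x \<in> I" for x
  proof -
    obtain C1 C2 where "\<forall>z\<in>{0..x}. \<bar>h1 z\<bar> \<le> C1" "\<forall>z\<in>{0..x}. \<bar>h2 z\<bar> \<le> C2" using B1[OF x] B2[OF x] by blast
    then have "\<forall>z\<in>{0..x}. \<bar>h z\<bar> \<le> C1 + C2" unfolding h_eq by fastforce
    then show ?thesis by blast
  qed
  have h1l: "locally_integrable_on h1 I"
    by (rule locally_integrable_on_bounded(1)[OF I _ B1]) (simp_all add: h1_def)
  have h2l: "locally_integrable_on h2 I"
    by (rule locally_integrable_on_bounded(1)[OF I _ B2]) (simp_all add: h2_def)
  have wh: "has_weak_derivative w h I"
    unfolding has_weak_derivative_iff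
  proof (intro allI impI)
    fix \<phi> assume \<phi>: "test_function_on I \<phi>"
    obtain x0 where "x0 \<in> interior I" using I'(3) by blast
    then have "{x0..x0} \<subseteq> interior I" by simp
    then obtain s t where
      st: "s \<le> x0" "x0 \<le> t" "{s..t} \<subseteq> interior I" "\<And>x. x \<notin> {s..t} \<Longrightarrow> \<phi> x = 0" "\<And>x. x \<notin> {s..t} \<Longrightarrow> deriv \<phi> x = 0"
      using test_function_on_support[OF \<phi> I'(1) _ order_refl[of x0]] by metis
    have "t \<in> {s..t}" using st(1,2) by simp
    then have tI: "t \<in> I" using st(3) interior_subset by blast
    have z: "\<phi> x = 0" if "x \<notin> interior I" for x
      using \<phi> that unfolding test_function_on_def by blast
    have dw: "has_weak_derivative \<phi> (deriv \<phi>) I"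
    proof -
      have "has_weak_derivative (\<lambda>x. indicator {s..t} x * \<phi> x) (\<lambda>x. indicator {s..t} x * deriv \<phi> x) I"
      proof (rule has_weak_derivative_C1_piece[OF I'(2)])
        show "{s..t} \<subseteq> I" "s \<le> t" using st(3) interior_subset[of I] st(1,2) by (blast, linarith)
        show "(\<phi> has_real_derivative deriv \<phi> x) (at x within {s..t})" for x
          using test_function_on_DERIV(1)[OF \<phi>] by (rule has_field_derivative_at_within)
      qed (use test_function_on_boundary[OF \<phi> st(4)] test_function_on_DERIV(2)[OF \<phi>] in auto)
      moreover have "(\<lambda>x. indicator {s..t} x * \<phi> x) = \<phi>" "(\<lambda>x. indicator {s..t} x * deriv \<phi> x) = deriv \<phi>"
        using st(4,5) by (auto simp: fun_eq_iff indicator_def)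
      ultimately show ?thesis by simp
    qed
    have dsq: "square_integrable_on (deriv \<phi>) I"
      by (rule square_integrable_on_continuous_supported[OF I test_function_on_DERIV(2)[OF \<phi>] tI]) (use st(5) in auto)
    have end0: "\<phi> x = 0" if "ereal x = len G e" for x
    proof (rule z)
      have "I = {0..x}" using that[symmetric] by (auto simp: I_def edge_interval_def)
      then show "x \<notin> interior I" by simp
    qed
    have "0 \<notin> interior I"
    proof
      assume "0 \<in> interior I"
      then obtain r where "r > 0" "ball 0 r \<subseteq> I" using mem_interior by blast
      then have "- r/2 \<in> I" by (auto simp: subset_iff dist_real_def)
      then show False using I'(5)[of "- r/2"] \<open>r > 0\<close> by simp
    qed
    then have z0: "\<phi> 0 = 0" by (rule z)
    have van: "\<And>x. x \<in> I \<Longrightarrow> t < x \<Longrightarrow> \<phi> x = 0" using st(4) by simp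
    have c: "continuous_on I \<phi>" by (rule test_function_on_DERIV(3)[OF \<phi>])
    have T1: "edge_fun G e \<phi> \<in> H1 G \<inter> Cc G"
      by (rule edge_fun_test_function(1)[where r = t and d = "deriv \<phi>", OF G e])
        (unfold I_def[symmetric], (fact c z0 end0 tI van dw dsq)+)
    have T2: "AE x in lebesgue_on I. edge_deriv G (edge_fun G e \<phi>) e x = deriv \<phi> x"
      unfolding I_def
      by (rule edge_fun_test_function(2)[where r = t and d = "deriv \<phi>", OF G e])
        (unfold I_def[symmetric], (fact c z0 end0 tI van dw dsq)+)
    have T3: "AE x in lebesgue_on (edge_interval G e'). edge_deriv G (edge_fun G e \<phi>) e' x = 0"
      if "e' \<in> edges G" "e' \<noteq> e" for e'
      by (rule edge_fun_test_function(3)[where r = t and d = "deriv \<phi>", OF G e _ _ _ _ _ _ _ that])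
        (unfold I_def[symmetric], (fact c z0 end0 tI van dw dsq)+)
    \<comment> \<open>The new representatives of the coefficients are available on \<open>e\<close>
      only. On the other edges the original ones stay, and they meet a test function that vanishes
      there.\<close>
    let ?W = "\<lambda>e' x. if e' = e then W\<^sub>e x else on_edge G W e' x"
    let ?\<rho> = "\<lambda>e' x. if e' = e then \<rho>\<^sub>e x else on_edge G \<rho> e' x"
    let ?f = "\<lambda>e' x. if e' = e then \<phi> x else 0"
    let ?d = "\<lambda>e' x. if e' = e then deriv \<phi> x else 0"
    have F1: "on_edge G (edge_fun G e \<phi>) e' x = ?f e' x" if "x \<in> edge_interval G e'" for e' x
      by (rule on_edge_edge_fun[where f = \<phi>, OF that z0]) (rule end0)
    have A1: "AE x in lebesgue_on (edge_interval G e'). on_edge G W e' x = ?W e' x" for e'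
      using AEe(1) by (cases "e' = e") auto
    have A2: "AE x in lebesgue_on (edge_interval G e'). on_edge G \<rho> e' x = ?\<rho> e' x" for e'
      using AEe(2) by (cases "e' = e") auto
    have A3: "AE x in lebesgue_on (edge_interval G e'). edge_deriv G u e' x = edge_deriv G u e' x" for e'
      by simp
    have A4: "AE x in lebesgue_on (edge_interval G e'). edge_deriv G (edge_fun G e \<phi>) e' x = ?d e' x"
      if e': "e' \<in> edges G" for e'
      using T2[unfolded I_def] T3[OF e'] by (cases "e' = e") auto
    have M1: "?W e' \<in> borel_measurable (lebesgue_on (edge_interval G e'))"
      and M2: "?\<rho> e' \<in> borel_measurable (lebesgue_on (edge_interval G e'))" if e': "e' \<in> edges G" for e'
      using meas L e' by (cases "e' = e"; auto simp: Linfty_def)+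
    have M3: "edge_deriv G u e' \<in> borel_measurable (lebesgue_on (edge_interval G e'))" if e': "e' \<in> edges G" for e'
      using H1D(3)[OF G uH e'] by (simp add: square_integrable_on_def)
    have M4: "?d e' \<in> borel_measurable (lebesgue_on (edge_interval G e'))" for e'
      using dsq[unfolded I_def] by (cases "e' = e") (auto simp: square_integrable_on_def)
    have "(\<Sum>e'\<in>edges G. LINT x|lebesgue_on (edge_interval G e'). edge_deriv G u e' x * ?d e' x +
        (?W e' x + lam) * on_edge G u e' x * ?f e' x) =
      (\<Sum>e'\<in>edges G. LINT x|lebesgue_on (edge_interval G e'). ?\<rho> e' x * \<bar>on_edge G u e' x\<bar> powr (p - 2) *
        on_edge G u e' x * ?f e' x)"
      by (rule weak_solution_identity[where W\<^sub>e = ?W and \<rho>\<^sub>e = ?\<rho> and w = "edge_deriv G u" and d = ?d and f = ?f,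
          OF G sol L T1 F1 A1 A2 A3 A4 M1 M2 M3 M4])
    also have "(\<Sum>e'\<in>edges G. LINT x|lebesgue_on (edge_interval G e'). edge_deriv G u e' x * ?d e' x +
        (?W e' x + lam) * on_edge G u e' x * ?f e' x) = (LINT x|lebesgue_on I. w x * deriv \<phi> x + h1 x * \<phi> x)"
      by (subst sum.remove[OF G'(2) e]) (simp add: I_def w_def h1_def v_def)
    also have "(\<Sum>e'\<in>edges G. LINT x|lebesgue_on (edge_interval G e'). ?\<rho> e' x * \<bar>on_edge G u e' x\<bar> powr (p - 2) *
        on_edge G u e' x * ?f e' x) = (LINT x|lebesgue_on I. h2 x * \<phi> x)"
      by (subst sum.remove[OF G'(2) e]) (simp add: I_def h2_def v_def)
    finally have "(LINT x|lebesgue_on I. w x * deriv \<phi> x) + (LINT x|lebesgue_on I. h1 x * \<phi> x)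
        = (LINT x|lebesgue_on I. h2 x * \<phi> x)"
      using integrable_mult_test_function(2)[OF I wl \<phi>] integrable_mult_test_function(1)[OF I h1l \<phi>] by simp
    then show "(LINT x|lebesgue_on I. w x * deriv \<phi> x) = - (LINT x|lebesgue_on I. h x * \<phi> x)"
      using integrable_mult_test_function(1)[OF I h1l \<phi>] integrable_mult_test_function(1)[OF I h2l \<phi>]
      by (simp add: h_eq left_diff_distrib)
  qed
  have hi: "h integrable_on {0..x}" if "x \<in> I" for x
    by (rule locally_integrable_on_bounded(2)[OF I _ B that]) (simp_all add: h_def)
  obtain du where du: "second_antiderivative_on I v du h" "continuous_on I du"
    "AE x in lebesgue_on I. w x = du x"
    by (rule second_antiderivative_on_if_has_weak_derivatives[OF I v(1) wl v(4) hi B wh])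
  have dm[measurable]: "du \<in> borel_measurable (lebesgue_on I)"
    by (rule continuous_imp_measurable_on_sets_lebesgue[OF du(2) I'(2)])
  have "square_integrable_on du I"
    unfolding square_integrable_on_def
  proof (rule conjI[OF dm])
    have [measurable]: "w \<in> borel_measurable (lebesgue_on I)" and wi: "integrable (lebesgue_on I) (\<lambda>x. (w x)\<^sup>2)"
      using v(3) by (auto simp: square_integrable_on_def)
    show "integrable (lebesgue_on I) (\<lambda>x. (du x)\<^sup>2)"
      by (rule Bochner_Integration.integrable_cong_AE_imp[OF wi]) (use du(3) in auto)
  qed
  then have "edge_solution I p lam Wbar b W\<^sub>e \<rho>\<^sub>e v du"
    unfolding edge_solution_def using I bound du v(2) by (simp add: h_def)
  then show thesis using that du(3) unfolding I_def v_def w_def by blast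
qed

section \<open>Sup bound and energy identity\<close>

lemma has_weak_derivative_cong:
  assumes "I \<in> sets lebesgue" "\<And>x. x \<in> I \<Longrightarrow> f x = f' x" "\<And>x. x \<in> I \<Longrightarrow> g x = g' x" "has_weak_derivative f g I"
  shows "has_weak_derivative f' g' I"
proof -
  have "(LINT x|lebesgue_on I. f' x * \<psi> x) = (LINT x|lebesgue_on I. f x * \<psi> x)"
    "(LINT x|lebesgue_on I. g' x * \<psi> x) = (LINT x|lebesgue_on I. g x * \<psi> x)" for \<psi>
    by (rule Bochner_Integration.integral_cong; use assms in auto)+
  then show ?thesis using assms(4) unfolding has_weak_derivative_def by simp
qed

lemma integral_subset_le_lebesgue_on:
  fixes f :: "real \<Rightarrow> real"
  assumes "integrable (lebesgue_on T) f" "S \<subseteq> T" "S \<in> sets lebesgue" "T \<in> sets lebesgue"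
    and "\<And>x. x \<in> T \<Longrightarrow> 0 \<le> f x"
  shows "(LINT x|lebesgue_on S. f x) \<le> (LINT x|lebesgue_on T. f x)"
proof -
  have S: "integrable (lebesgue_on S) f" by (rule integrable_lebesgue_on_subset[OF assms(1-4)])
  have eq: "integrable (lebesgue_on S) (\<lambda>x. indicator S x * f x) = integrable (lebesgue_on S) f"
    "(LINT x|lebesgue_on S. indicator S x * f x) = (LINT x|lebesgue_on S. f x)"
    by (rule Bochner_Integration.integrable_cong Bochner_Integration.integral_cong; simp)+
  have "(LINT x|lebesgue_on S. f x) = (LINT x|lebesgue_on T. indicator S x * f x)"
    using lebesgue_on_supported(2)[OF assms(2-4), of "\<lambda>x. indicator S x * f x"] eq(2) by simp
  also have "\<dots> \<le> (LINT x|lebesgue_on T. f x)"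
  proof (rule integral_mono)
    show "integrable (lebesgue_on T) (\<lambda>x. indicator S x * f x)"
      using lebesgue_on_supported(1)[OF assms(2-4), of "\<lambda>x. indicator S x * f x"] eq(1) S by simp
    show "indicator S x * f x \<le> f x" if "x \<in> space (lebesgue_on T)" for x
      using that assms(5)[of x] by (auto simp: indicator_def)
  qed (rule assms(1))
  finally show ?thesis .
qed

lemma edge_solutionD:
  assumes "edge_solution I p lam Wbar b W \<rho> u du"
  shows "closed_ray_or_segment I" "W \<in> borel_measurable (lebesgue_on I)" "\<rho> \<in> borel_measurable (lebesgue_on I)"
    "\<bar>W x\<bar> \<le> Wbar" "0 \<le> \<rho> x" "\<rho> x \<le> b"
    "second_antiderivative_on I u du (\<lambda>x. (W x + lam - \<rho> x * \<bar>u x\<bar> powr (p - 2)) * u x)"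
    "continuous_on I du" "continuous_on I u"
    "u \<in> borel_measurable (lebesgue_on I)" "du \<in> borel_measurable (lebesgue_on I)"
    "integrable (lebesgue_on I) (\<lambda>x. (u x)\<^sup>2)" "integrable (lebesgue_on I) (\<lambda>x. (du x)\<^sup>2)"
  using assms second_antiderivative_on_continuous
  unfolding edge_solution_def square_integrable_on_def by auto

text \<open>At the minimum of \<open>u^2\<close> over the window its value is at most the mean,
  which gives the term with \<open>1 / l\<close>. From there \<open>u^2\<close> changes by an
  integral of \<open>2 u u'\<close>, estimated by Young's inequality with weight
  \<open>\<tau>\<close>. The weight stays free: \<open>\<tau> = 1\<close> shows boundedness, and its
  optimal value gives the Gagliardo--Nirenberg inequality.\<close>

lemma edge_solution_sup_bound:
  assumes es: "edge_solution I p lam Wbar b W \<rho> u du"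
    and l: "0 < l" "{s..s + l} \<subseteq> I" "x \<in> {s..s + l}" and \<tau>: "0 < \<tau>"
  shows "(u x)\<^sup>2 \<le> (1 / l + 1 / \<tau>) * (LINT x|lebesgue_on I. (u x)\<^sup>2) + \<tau> * (LINT x|lebesgue_on I. (du x)\<^sup>2)"
proof -
  note D = edge_solutionD[OF es]
  define J where "J = {s..s + l}"
  have JI: "J \<subseteq> I" "J \<in> sets lebesgue" using l by (auto simp: J_def)
  note Im = closed_ray_or_segmentD(2)[OF D(1)]
  have uc: "continuous_on J u" and duc: "continuous_on J du"
    using D(8,9) JI continuous_on_subset by blast+
  have u2: "integral J (\<lambda>x. (u x)\<^sup>2) \<le> (LINT x|lebesgue_on I. (u x)\<^sup>2)"
    and du2: "integral J (\<lambda>x. (du x)\<^sup>2) \<le> (LINT x|lebesgue_on I. (du x)\<^sup>2)"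
  proof -
    have "integral J (\<lambda>x. (f x)\<^sup>2) \<le> (LINT x|lebesgue_on I. (f x)\<^sup>2)"
      if "integrable (lebesgue_on I) (\<lambda>x. (f x)\<^sup>2)" for f :: "real \<Rightarrow> real"
      using integral_subset_le_lebesgue_on[OF that JI Im]
        lebesgue_integral_eq_integral[OF integrable_lebesgue_on_subset[OF that JI Im] JI(2)] by simp
    then show "integral J (\<lambda>x. (u x)\<^sup>2) \<le> (LINT x|lebesgue_on I. (u x)\<^sup>2)"
      "integral J (\<lambda>x. (du x)\<^sup>2) \<le> (LINT x|lebesgue_on I. (du x)\<^sup>2)" using D(12,13) by blast+
  qed
  have "compact J" "J \<noteq> {}" using l by (auto simp: J_def)
  then obtain y where y: "y \<in> J" "\<And>z. z \<in> J \<Longrightarrow> (u y)\<^sup>2 \<le> (u z)\<^sup>2"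
    using continuous_attains_inf[of J "\<lambda>x. (u x)\<^sup>2"] uc by (auto intro!: continuous_intros)
  have ii: "(\<lambda>x. (u x)\<^sup>2) integrable_on J" "(\<lambda>x. (du x)\<^sup>2) integrable_on J"
    unfolding J_def by (rule integrable_continuous_real; use uc duc in \<open>auto simp: J_def intro!: continuous_intros\<close>)+
  have "integral J (\<lambda>_. (u y)\<^sup>2) \<le> integral J (\<lambda>x. (u x)\<^sup>2)"
    by (rule integral_le) (use ii y in \<open>auto simp: J_def\<close>)
  then have uy: "(u y)\<^sup>2 \<le> (1 / l) * (LINT x|lebesgue_on I. (u x)\<^sup>2)"
    using u2 l(1) by (simp add: J_def field_simps)
  define q where "q = (\<lambda>x. \<tau> * (du x)\<^sup>2 + (1 / \<tau>) * (u x)\<^sup>2)"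
  have ti: "(\<lambda>x. \<tau> * (du x)\<^sup>2) integrable_on J" "(\<lambda>x. (1 / \<tau>) * (u x)\<^sup>2) integrable_on J"
    unfolding J_def by (intro integrable_continuous_real continuous_intros; use uc duc in \<open>simp add: J_def\<close>)+
  have qi: "q integrable_on J" unfolding q_def by (rule integrable_add[OF ti])
  have q: "\<bar>2 * u z * du z\<bar> \<le> q z" for z
  proof -
    have "0 \<le> (sqrt \<tau> * \<bar>du z\<bar> - (1 / sqrt \<tau>) * \<bar>u z\<bar>)\<^sup>2" by simp
    also have "\<dots> = q z - \<bar>2 * u z * du z\<bar>"
      using \<tau> by (simp add: q_def power2_diff power_mult_distrib power_divide abs_mult)
    finally show ?thesis by simp
  qed
  have le: "\<bar>(u t)\<^sup>2 - (u r)\<^sup>2\<bar> \<le> integral J q" if "r \<in> J" "t \<in> J" "r \<le> t" for r t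
  proof -
    have sub: "{r..t} \<subseteq> J" using that by (auto simp: J_def)
    have "((\<lambda>x. 2 * u x * du x) has_integral ((u t)\<^sup>2 - (u r)\<^sup>2)) {r..t}"
    proof (rule fundamental_theorem_of_calculus[OF that(3)])
      fix z assume "z \<in> {r..t}"
      then have "(u has_real_derivative du z) (at z within {r..t})"
        using D(7) sub JI(1) DERIV_subset[of u "du z" z I "{r..t}"] unfolding second_antiderivative_on_def by blast
      then have "((\<lambda>x. (u x)\<^sup>2) has_real_derivative 2 * u z * du z) (at z within {r..t})"
        by (auto intro!: derivative_eq_intros)
      then show "((\<lambda>x. (u x)\<^sup>2) has_vector_derivative 2 * u z * du z) (at z within {r..t})"
        by (simp add: has_real_derivative_iff_has_vector_derivative)
    qed
    then have i: "(\<lambda>x. 2 * u x * du x) integrable_on {r..t}" "(u t)\<^sup>2 - (u r)\<^sup>2 = integral {r..t} (\<lambda>x. 2 * u x * du x)"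
      by (auto simp: integral_unique)
    have qrt: "q integrable_on {r..t}" using integrable_on_subinterval[OF qi sub] .
    have "norm (integral {r..t} (\<lambda>x. 2 * u x * du x)) \<le> integral {r..t} q"
      by (rule integral_norm_bound_integral[OF i(1) qrt]) (use q in auto)
    also have "\<dots> \<le> integral J q"
      by (rule integral_subset_le[OF sub qrt qi]) (use q abs_ge_zero order_trans in blast)
    finally show ?thesis using i(2) by simp
  qed
  have "(u x)\<^sup>2 \<le> (u y)\<^sup>2 + integral J q"
    using le[of x y] le[of y x] y(1) l(3) by (cases "x \<le> y") (auto simp: J_def)
  moreover have "integral J q = \<tau> * integral J (\<lambda>x. (du x)\<^sup>2) + (1 / \<tau>) * integral J (\<lambda>x. (u x)\<^sup>2)"
    unfolding q_def by (subst Henstock_Kurzweil_Integration.integral_add[OF ti]) simp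
  moreover have "\<tau> * integral J (\<lambda>x. (du x)\<^sup>2) \<le> \<tau> * (LINT x|lebesgue_on I. (du x)\<^sup>2)"
    "(1 / \<tau>) * integral J (\<lambda>x. (u x)\<^sup>2) \<le> (1 / \<tau>) * (LINT x|lebesgue_on I. (u x)\<^sup>2)"
    using du2 u2 \<tau> by (auto intro!: mult_left_mono divide_right_mono)
  ultimately show ?thesis using uy unfolding distrib_right by linarith
qed

text \<open>The factor is 1 at every vertex, so multiplication by it keeps the values of a function
  at the vertices; half-lines alone are cut, at \<open>Suc n\<close>. The square makes it
  continuously differentiable there.\<close>

definition truncation :: "('v, 'e) metric_graph \<Rightarrow> nat \<Rightarrow> 'e \<Rightarrow> real \<Rightarrow> real" where
  "truncation G n e x = (if len G e = \<infinity> then (max 0 (1 - x / real (Suc n)))\<^sup>2 else 1)"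

definition truncation_deriv :: "('v, 'e) metric_graph \<Rightarrow> nat \<Rightarrow> 'e \<Rightarrow> real \<Rightarrow> real" where
  "truncation_deriv G n e x = (if len G e = \<infinity> then - (2 / real (Suc n)) * max 0 (1 - x / real (Suc n)) else 0)"

lemma DERIV_truncation: "(truncation G n e has_real_derivative truncation_deriv G n e x) (at x)"
proof (cases "len G e = \<infinity>")
  case True
  have "((\<lambda>x. 1 - x / real (Suc n)) has_real_derivative - (1 / real (Suc n))) (at x)"
    by (auto intro!: derivative_eq_intros)
  from DERIV_chain2[OF DERIV_max_0_square this] True show ?thesis
    by (simp add: truncation_def[abs_def] truncation_deriv_def mult.commute)
qed (simp add: truncation_def[abs_def] truncation_deriv_def)

lemma continuous_on_truncation:
  "continuous_on S (truncation G n e)" "continuous_on S (truncation_deriv G n e)"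
proof -
  show "continuous_on S (truncation G n e)"
    by (rule DERIV_continuous_on) (rule has_field_derivative_at_within[OF DERIV_truncation])
  show "continuous_on S (truncation_deriv G n e)"
    unfolding truncation_deriv_def[abs_def] by (cases "len G e = \<infinity>") (auto intro!: continuous_intros)
qed

lemma truncation_bounds:
  assumes "0 \<le> x"
  shows "0 \<le> truncation G n e x" "truncation G n e x \<le> 1" "\<bar>truncation_deriv G n e x\<bar> \<le> 2"
proof -
  define m where "m = max 0 (1 - x / real (Suc n))"
  have m: "0 \<le> m" "m \<le> 1" using assms by (auto simp: m_def)
  show "0 \<le> truncation G n e x" by (simp add: truncation_def)
  show "truncation G n e x \<le> 1"
    using m power_le_one[of m 2] unfolding truncation_def m_def[symmetric] by simp
  have "2 / real (Suc n) * m \<le> 2 * 1" using m by (intro mult_mono) (auto simp: divide_simps)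
  then show "\<bar>truncation_deriv G n e x\<bar> \<le> 2"
    using m unfolding truncation_deriv_def m_def[symmetric] by (simp add: abs_mult)
qed

lemma truncation_tendsto:
  "(\<lambda>n. truncation G n e x) \<longlonglongrightarrow> 1" "(\<lambda>n. truncation_deriv G n e x) \<longlonglongrightarrow> 0"
proof -
  have x: "(\<lambda>n. x / real (Suc n)) \<longlonglongrightarrow> 0" and two: "(\<lambda>n. 2 / real (Suc n)) \<longlonglongrightarrow> 0"
    by real_asymp+
  have m: "(\<lambda>n. max 0 (1 - x / real (Suc n))) \<longlonglongrightarrow> max 0 (1 - 0)"
    by (intro tendsto_intros x)
  then have "(\<lambda>n. (max 0 (1 - x / real (Suc n)))\<^sup>2) \<longlonglongrightarrow> (max 0 (1 - 0))\<^sup>2" by (rule tendsto_power)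
  then show "(\<lambda>n. truncation G n e x) \<longlonglongrightarrow> 1" by (cases "len G e = \<infinity>") (auto simp: truncation_def)
  have "(\<lambda>n. - (2 / real (Suc n)) * max 0 (1 - x / real (Suc n))) \<longlonglongrightarrow> - 0 * max 0 (1 - 0)"
    by (intro tendsto_mult tendsto_minus two m)
  then show "(\<lambda>n. truncation_deriv G n e x) \<longlonglongrightarrow> 0"
    by (cases "len G e = \<infinity>") (auto simp: truncation_deriv_def)
qed

lemma truncated_edge_weak_derivative:
  fixes n :: nat
  assumes wf: "wf_metric_graph G" "e \<in> edges G"
    and u: "\<And>x. x \<in> edge_interval G e \<Longrightarrow> (u has_real_derivative du x) (at x within edge_interval G e)"
    and du: "continuous_on (edge_interval G e) du"
  defines "f \<equiv> \<lambda>x. u x * truncation G n e x"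
    and "d \<equiv> \<lambda>x. du x * truncation G n e x + u x * truncation_deriv G n e x"
  shows "has_weak_derivative f d (edge_interval G e)" "square_integrable_on d (edge_interval G e)"
    "continuous_on (edge_interval G e) f"
    "\<exists>r\<in>edge_interval G e. \<forall>x\<in>edge_interval G e. r < x \<longrightarrow> f x = 0"
proof -
  define I where "I = edge_interval G e"
  have I: "closed_ray_or_segment I" unfolding I_def by (rule closed_ray_or_segment_edge_interval[OF wf])
  note I' = closed_ray_or_segmentD[OF I]
  have Df: "(f has_real_derivative d x) (at x within I)" if "x \<in> I" for x
    unfolding f_def d_def
    using DERIV_mult[OF u[OF that[unfolded I_def]] has_field_derivative_at_within[OF DERIV_truncation[of G n e x]]]
    by (simp add: I_def mult.commute add.commute)
  have fc: "continuous_on I f" using Df by (rule DERIV_continuous_on)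
  then show "continuous_on (edge_interval G e) f" by (simp add: I_def)
  have uc: "continuous_on I u" using u unfolding I_def by (rule DERIV_continuous_on)
  have dc: "continuous_on I d"
    unfolding d_def by (intro continuous_intros continuous_on_truncation uc du[folded I_def])
  \<comment> \<open>The function ends at the cut on a half-line, where it vanishes, and otherwise at
    the far vertex, where test functions on the edge vanish.\<close>
  define r where "r = (if len G e = \<infinity> then real (Suc n) else real_of_ereal (len G e))"
  have rI: "r \<in> I" and beyond: "\<And>x. x \<in> I \<Longrightarrow> r < x \<Longrightarrow> f x = 0 \<and> d x = 0"
    and r_end: "r \<in> interior I \<Longrightarrow> f r = 0"
  proof -
    have "r \<in> I \<and> (\<forall>x. x \<in> I \<longrightarrow> r < x \<longrightarrow> f x = 0 \<and> d x = 0) \<and> (r \<in> interior I \<longrightarrow> f r = 0)"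
    proof (cases "len G e")
      case (real l)
      then have "I = {0..l}" "r = l" by (auto simp: I_def edge_interval_def r_def)
      moreover have "0 < l" using wf real by (auto simp: wf_metric_graph_def)
      ultimately show ?thesis by simp
    next
      case PInf
      then have "I = {0..}" "r = real (Suc n)" by (auto simp: I_def edge_interval_def r_def)
      moreover have "f x = 0 \<and> d x = 0" if "real (Suc n) \<le> x" for x
      proof -
        have "max 0 (1 - x / real (Suc n)) = 0" using that by (simp add: field_simps)
        then show ?thesis using PInf by (simp add: f_def d_def truncation_def truncation_deriv_def)
      qed
      ultimately show ?thesis by auto
    next
      case MInf
      then show ?thesis using wf by (auto simp: wf_metric_graph_def)
    qed
    then show "r \<in> I" "\<And>x. x \<in> I \<Longrightarrow> r < x \<Longrightarrow> f x = 0 \<and> d x = 0" "r \<in> interior I \<Longrightarrow> f r = 0" by blast+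
  qed
  show "\<exists>r\<in>edge_interval G e. \<forall>x\<in>edge_interval G e. r < x \<longrightarrow> f x = 0"
    using rI beyond by (auto simp: I_def)
  show "square_integrable_on d (edge_interval G e)"
    using square_integrable_on_continuous_supported[OF I dc rI] beyond by (simp add: I_def)
  have sub: "{0..r} \<subseteq> I" using I'(6)[OF rI] .
  have "has_weak_derivative (\<lambda>x. indicator {0..r} x * f x) (\<lambda>x. indicator {0..r} x * d x) I"
  proof (rule has_weak_derivative_C1_piece[OF I'(2) sub])
    show "0 \<le> r" using I'(5)[OF rI] .
    show "(f has_real_derivative d x) (at x within {0..r})" if "x \<in> {0..r}" for x
      using DERIV_subset[OF Df sub] that sub by blast
    show "continuous_on {0..r} d" using dc sub continuous_on_subset by blast
    have "0 \<notin> interior I"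
    proof
      assume "0 \<in> interior I"
      then obtain t where "t > 0" "ball 0 t \<subseteq> I" using mem_interior by blast
      then have "- t/2 \<in> I" by (auto simp: subset_iff dist_real_def)
      then show False using I'(5)[of "- t/2"] \<open>t > 0\<close> by simp
    qed
    then show "0 \<in> interior I \<Longrightarrow> f 0 = 0" by simp
  qed (rule r_end)
  then have "has_weak_derivative f d I"
    by (rule has_weak_derivative_cong[OF I'(2), rotated 2]) (use beyond I'(5) in \<open>auto simp: indicator_def not_le\<close>)
  then show "has_weak_derivative f d (edge_interval G e)" by (simp add: I_def)
qed

text \<open>The solution need not have compact support, so it is tested with its truncations.
  Because \<open>u\<close> and \<open>du\<close> are square integrable and \<open>u\<close> is
  bounded by \<open>M\<close>, dominated convergence applies to both sides as the truncation tends
  to 1.\<close>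

theorem energy_identity:
  fixes W\<^sub>e \<rho>\<^sub>e du :: "'e \<Rightarrow> real \<Rightarrow> real" and G :: "('v, 'e) metric_graph"
  assumes G: "G \<in> graphs_fin" and p: "2 < p" and sol: "weak_solution G p W lam \<rho> u"
    and L: "W \<in> Linfty G" "\<rho> \<in> Linfty G"
    and AE: "\<And>e. e \<in> edges G \<Longrightarrow> AE x in lebesgue_on (edge_interval G e). on_edge G W e x = W\<^sub>e e x"
      "\<And>e. e \<in> edges G \<Longrightarrow> AE x in lebesgue_on (edge_interval G e). on_edge G \<rho> e x = \<rho>\<^sub>e e x"
      "\<And>e. e \<in> edges G \<Longrightarrow> AE x in lebesgue_on (edge_interval G e). edge_deriv G u e x = du e x"
    and es: "\<And>e. e \<in> edges G \<Longrightarrow>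
      edge_solution (edge_interval G e) p lam Wbar b (W\<^sub>e e) (\<rho>\<^sub>e e) (on_edge G u e) (du e)"
    and M: "\<And>e x. e \<in> edges G \<Longrightarrow> x \<in> edge_interval G e \<Longrightarrow> \<bar>on_edge G u e x\<bar> \<le> M"
  shows "(\<Sum>e\<in>edges G. LINT x|lebesgue_on (edge_interval G e).
      (du e x)\<^sup>2 + (W\<^sub>e e x + lam) * (on_edge G u e x)\<^sup>2) =
    (\<Sum>e\<in>edges G. LINT x|lebesgue_on (edge_interval G e).
      \<rho>\<^sub>e e x * \<bar>on_edge G u e x\<bar> powr (p - 2) * (on_edge G u e x)\<^sup>2)"
proof -
  note G' = graphs_finD[OF G]
  let ?u = "on_edge G u" and ?I = "edge_interval G"
  define f where "f = (\<lambda>n e x. ?u e x * truncation G n e x)"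
  define d where "d = (\<lambda>n e x. du e x * truncation G n e x + ?u e x * truncation_deriv G n e x)"
  \<comment> \<open>Vertices keep the value of \<open>u\<close>, where the truncation is 1; the case
    distinction on \<open>gpoints G\<close> provides the value zero off the graph.\<close>
  define \<phi> where "\<phi> = (\<lambda>n z. if z \<in> gpoints G then
      (case z of Vertex v \<Rightarrow> u z | Inner e x \<Rightarrow> u z * truncation G n e x) else 0)"
  have on: "on_edge G (\<phi> n) e x = f n e x" if "e \<in> edges G" "x \<in> ?I e" for n e x
    using edge_point_in_gpoints[OF G'(1) that] that(2)
    by (auto simp: on_edge_def \<phi>_def f_def edge_point_def truncation_def edge_interval_def)
  have u': "(?u e has_real_derivative du e x) (at x within ?I e)" if "e \<in> edges G" "x \<in> ?I e" for e x
    using edge_solutionD(7)[OF es[OF that(1)]] that(2) unfolding second_antiderivative_on_def by blast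
  note tr = truncated_edge_weak_derivative[OF G'(1) _ u' edge_solutionD(8)[OF es]]
  have T: "\<phi> n \<in> H1 G \<inter> Cc G" "\<And>e. e \<in> edges G \<Longrightarrow> AE x in lebesgue_on (?I e). edge_deriv G (\<phi> n) e x = d n e x" for n
  proof -
    have out: "\<And>z. z \<notin> gpoints G \<Longrightarrow> \<phi> n z = 0" by (simp add: \<phi>_def)
    have c: "continuous_on (?I e) (on_edge G (\<phi> n) e)" if e: "e \<in> edges G" for e
    proof -
      have "continuous_on (?I e) (f n e)" unfolding f_def using tr(3) e by blast
      then show ?thesis by (rule continuous_on_eq) (simp add: on e)
    qed
    have r: "\<exists>r\<in>?I e. \<forall>x\<in>?I e. r < x \<longrightarrow> on_edge G (\<phi> n) e x = 0" if e: "e \<in> edges G" for e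
      using tr(4)[of e n] e on[OF e] unfolding f_def by auto
    have wd: "has_weak_derivative (on_edge G (\<phi> n) e) (d n e) (?I e)" if e: "e \<in> edges G" for e
    proof (rule has_weak_derivative_cong)
      show "?I e \<in> sets lebesgue" using closed_ray_or_segmentD(2)[OF closed_ray_or_segment_edge_interval[OF G'(1) e]] .
      show "has_weak_derivative (f n e) (d n e) (?I e)" unfolding f_def d_def using tr(1) e by blast
    qed (simp_all add: on e)
    have sq: "square_integrable_on (d n e) (?I e)" if e: "e \<in> edges G" for e
      unfolding d_def using tr(2) e by blast
    show "\<phi> n \<in> H1 G \<inter> Cc G"
      by (rule graph_test_function(1)[where d = "d n", OF G]) (fact out c r wd sq)+
    show "AE x in lebesgue_on (?I e). edge_deriv G (\<phi> n) e x = d n e x" if "e \<in> edges G" for e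
      by (rule graph_test_function(2)[where d = "d n", OF G _ _ _ _ _ that]) (fact out c r wd sq)+
  qed
  have um: "?u e \<in> borel_measurable (lebesgue_on (?I e))" "du e \<in> borel_measurable (lebesgue_on (?I e))"
    "W\<^sub>e e \<in> borel_measurable (lebesgue_on (?I e))" "\<rho>\<^sub>e e \<in> borel_measurable (lebesgue_on (?I e))"
    if "e \<in> edges G" for e using edge_solutionD[OF es[OF that]] by auto
  have tm: "truncation G n e \<in> borel_measurable (lebesgue_on (?I e))"
    "truncation_deriv G n e \<in> borel_measurable (lebesgue_on (?I e))" if e: "e \<in> edges G" for n e
    by (rule continuous_imp_measurable_on_sets_lebesgue[OF continuous_on_truncation(1)]
        continuous_imp_measurable_on_sets_lebesgue[OF continuous_on_truncation(2)],
        rule closed_ray_or_segmentD(2)[OF closed_ray_or_segment_edge_interval[OF G'(1) e]])+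
  define A where "A = (\<lambda>n e x. du e x * d n e x + (W\<^sub>e e x + lam) * ?u e x * f n e x)"
  define R where "R = (\<lambda>n e x. \<rho>\<^sub>e e x * \<bar>?u e x\<bar> powr (p - 2) * ?u e x * f n e x)"
  define A' where "A' = (\<lambda>e x. (du e x)\<^sup>2 + (W\<^sub>e e x + lam) * (?u e x)\<^sup>2)"
  define R' where "R' = (\<lambda>e x. \<rho>\<^sub>e e x * \<bar>?u e x\<bar> powr (p - 2) * (?u e x)\<^sup>2)"
  have AR: "(\<Sum>e\<in>edges G. LINT x|lebesgue_on (?I e). A n e x) = (\<Sum>e\<in>edges G. LINT x|lebesgue_on (?I e). R n e x)" for n
  proof -
    have dm: "d n e \<in> borel_measurable (lebesgue_on (?I e))" if e: "e \<in> edges G" for e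
      unfolding d_def using um[OF e] tm[OF e, of n] by measurable
    show ?thesis
      unfolding A_def R_def
      by (rule weak_solution_identity[where W\<^sub>e = W\<^sub>e and \<rho>\<^sub>e = \<rho>\<^sub>e and w = du and d = "d n" and f = "f n",
            OF G sol L T(1)[of n] on AE T(2) um(3) um(4) um(2) dm])
  qed
  have lim: "(\<lambda>n. LINT x|lebesgue_on (?I e). A n e x) \<longlonglongrightarrow> (LINT x|lebesgue_on (?I e). A' e x)"
    "(\<lambda>n. LINT x|lebesgue_on (?I e). R n e x) \<longlonglongrightarrow> (LINT x|lebesgue_on (?I e). R' e x)" if e: "e \<in> edges G" for e
  proof -
    note D = edge_solutionD[OF es[OF e]]
    note I' = closed_ray_or_segmentD[OF D(1)]
    note [measurable] = um[OF e] tm[OF e]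
    have nonneg: "0 \<le> x" if "x \<in> space (lebesgue_on (?I e))" for x using that I'(5) by simp
    have b0: "0 \<le> b" using D(5,6)[of 0] by linarith
    have f_lim: "(\<lambda>n. f n e x) \<longlonglongrightarrow> ?u e x * 1" and d_lim: "(\<lambda>n. d n e x) \<longlonglongrightarrow> du e x * 1 + ?u e x * 0" for x
      unfolding f_def d_def by (intro tendsto_intros truncation_tendsto)+
    have f_le: "\<bar>f n e x\<bar> \<le> \<bar>?u e x\<bar>" and d_le: "\<bar>d n e x\<bar> \<le> \<bar>du e x\<bar> + 2 * \<bar>?u e x\<bar>" if "0 \<le> x" for n x
    proof -
      note tb = truncation_bounds[OF that, where G = G and n = n and e = e]
      show "\<bar>f n e x\<bar> \<le> \<bar>?u e x\<bar>" using tb by (simp add: f_def abs_mult mult_left_le)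
      have "\<bar>d n e x\<bar> \<le> \<bar>du e x\<bar> * \<bar>truncation G n e x\<bar> + \<bar>?u e x\<bar> * \<bar>truncation_deriv G n e x\<bar>"
        unfolding d_def by (metis abs_mult abs_triangle_ineq)
      also have "\<dots> \<le> \<bar>du e x\<bar> * 1 + \<bar>?u e x\<bar> * 2"
        using tb by (intro add_mono mult_left_mono) auto
      finally show "\<bar>d n e x\<bar> \<le> \<bar>du e x\<bar> + 2 * \<bar>?u e x\<bar>" by simp
    qed
    show "(\<lambda>n. LINT x|lebesgue_on (?I e). A n e x) \<longlonglongrightarrow> (LINT x|lebesgue_on (?I e). A' e x)"
    \<comment> \<open>The majorant comes from \<open>|d n| \<le> |du| + 2 |u|\<close> and
      \<open>2 |du| |u| \<le> du^2 + u^2\<close>.\<close>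
    proof (rule integral_dominated_convergence[where w = "\<lambda>x. 2 * (du e x)\<^sup>2 + (1 + Wbar + \<bar>lam\<bar>) * (?u e x)\<^sup>2"])
      show "A' e \<in> borel_measurable (lebesgue_on (?I e))" unfolding A'_def by measurable
      show "A n e \<in> borel_measurable (lebesgue_on (?I e))" for n unfolding A_def d_def f_def by measurable
      show "integrable (lebesgue_on (?I e)) (\<lambda>x. 2 * (du e x)\<^sup>2 + (1 + Wbar + \<bar>lam\<bar>) * (?u e x)\<^sup>2)"
        using D(12,13) by auto
      show "AE x in lebesgue_on (?I e). (\<lambda>n. A n e x) \<longlonglongrightarrow> A' e x"
      proof (rule AE_I2)
        fix x
        have "(\<lambda>n. A n e x) \<longlonglongrightarrow> du e x * (du e x * 1 + ?u e x * 0) + (W\<^sub>e e x + lam) * ?u e x * (?u e x * 1)"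
          unfolding A_def by (intro tendsto_intros f_lim d_lim)
        then show "(\<lambda>n. A n e x) \<longlonglongrightarrow> A' e x" by (simp add: A'_def power2_eq_square mult.assoc)
      qed
      show "AE x in lebesgue_on (?I e). norm (A n e x) \<le> 2 * (du e x)\<^sup>2 + (1 + Wbar + \<bar>lam\<bar>) * (?u e x)\<^sup>2" for n
      proof (rule AE_I2)
        fix x assume "x \<in> space (lebesgue_on (?I e))"
        then have x: "0 \<le> x" by (rule nonneg)
        have "\<bar>A n e x\<bar> \<le> \<bar>du e x\<bar> * \<bar>d n e x\<bar> + \<bar>W\<^sub>e e x + lam\<bar> * \<bar>?u e x\<bar> * \<bar>f n e x\<bar>"
          unfolding A_def by (metis abs_mult abs_triangle_ineq)
        also have "\<dots> \<le> \<bar>du e x\<bar> * (\<bar>du e x\<bar> + 2 * \<bar>?u e x\<bar>) + (Wbar + \<bar>lam\<bar>) * \<bar>?u e x\<bar> * \<bar>?u e x\<bar>"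
          using f_le[OF x] d_le[OF x] D(4)[of x] by (intro add_mono mult_mono) auto
        also have "\<dots> = (du e x)\<^sup>2 + 2 * \<bar>du e x\<bar> * \<bar>?u e x\<bar> + (Wbar + \<bar>lam\<bar>) * (?u e x)\<^sup>2"
          by (simp add: algebra_simps flip: power2_eq_square)
        also have "2 * \<bar>du e x\<bar> * \<bar>?u e x\<bar> \<le> (du e x)\<^sup>2 + (?u e x)\<^sup>2"
          using sum_squares_bound[of "\<bar>du e x\<bar>" "\<bar>?u e x\<bar>"] by simp
        finally show "norm (A n e x) \<le> 2 * (du e x)\<^sup>2 + (1 + Wbar + \<bar>lam\<bar>) * (?u e x)\<^sup>2"
          by (simp add: algebra_simps)
      qed
    qed
    show "(\<lambda>n. LINT x|lebesgue_on (?I e). R n e x) \<longlonglongrightarrow> (LINT x|lebesgue_on (?I e). R' e x)"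
    proof (rule integral_dominated_convergence[where w = "\<lambda>x. b * M powr (p - 2) * (?u e x)\<^sup>2"])
      show "R' e \<in> borel_measurable (lebesgue_on (?I e))" unfolding R'_def by measurable
      show "R n e \<in> borel_measurable (lebesgue_on (?I e))" for n unfolding R_def f_def by measurable
      show "integrable (lebesgue_on (?I e)) (\<lambda>x. b * M powr (p - 2) * (?u e x)\<^sup>2)"
        using D(12) by auto
      show "AE x in lebesgue_on (?I e). (\<lambda>n. R n e x) \<longlonglongrightarrow> R' e x"
      proof (rule AE_I2)
        fix x
        have "(\<lambda>n. R n e x) \<longlonglongrightarrow> \<rho>\<^sub>e e x * \<bar>?u e x\<bar> powr (p - 2) * ?u e x * (?u e x * 1)"
          unfolding R_def by (intro tendsto_intros f_lim)
        then show "(\<lambda>n. R n e x) \<longlonglongrightarrow> R' e x" by (simp add: R'_def power2_eq_square mult.assoc)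
      qed
      show "AE x in lebesgue_on (?I e). norm (R n e x) \<le> b * M powr (p - 2) * (?u e x)\<^sup>2" for n
      proof (rule AE_I2)
        fix x assume xs: "x \<in> space (lebesgue_on (?I e))"
        then have x: "0 \<le> x" by (rule nonneg)
        have "\<bar>?u e x\<bar> powr (p - 2) \<le> M powr (p - 2)"
          using M[OF e, of x] xs p by (intro powr_mono2) auto
        moreover have "\<bar>R n e x\<bar> = \<rho>\<^sub>e e x * \<bar>?u e x\<bar> powr (p - 2) * \<bar>?u e x\<bar> * \<bar>f n e x\<bar>"
          using D(5)[of x] by (simp add: R_def abs_mult)
        ultimately have "\<bar>R n e x\<bar> \<le> b * M powr (p - 2) * \<bar>?u e x\<bar> * \<bar>?u e x\<bar>"
          using f_le[OF x] D(5,6)[of x] b0 by (auto intro!: mult_mono)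
        then show "norm (R n e x) \<le> b * M powr (p - 2) * (?u e x)\<^sup>2"
          by (simp add: mult.assoc flip: power2_eq_square)
      qed
    qed
  qed
  have "(\<lambda>n. \<Sum>e\<in>edges G. LINT x|lebesgue_on (?I e). A n e x) \<longlonglongrightarrow> (\<Sum>e\<in>edges G. LINT x|lebesgue_on (?I e). A' e x)"
    "(\<lambda>n. \<Sum>e\<in>edges G. LINT x|lebesgue_on (?I e). R n e x) \<longlonglongrightarrow> (\<Sum>e\<in>edges G. LINT x|lebesgue_on (?I e). R' e x)"
    by (intro tendsto_sum lim; assumption)+
  then have "(\<Sum>e\<in>edges G. LINT x|lebesgue_on (?I e). A' e x) = (\<Sum>e\<in>edges G. LINT x|lebesgue_on (?I e). R' e x)"
    unfolding AR using LIMSEQ_unique by blast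
  then show ?thesis unfolding A'_def R'_def .
qed

section \<open>Lower bounds for the Morse index\<close>

lemma square_integrable_on_cmult:
  "square_integrable_on f I \<Longrightarrow> square_integrable_on (\<lambda>x. c * f x) I"
  unfolding square_integrable_on_def by (auto simp: power_mult_distrib)

lemma square_integrable_on_add:
  assumes "square_integrable_on f I" "square_integrable_on g I"
  shows "square_integrable_on (\<lambda>x. f x + g x) I"
  unfolding square_integrable_on_def
proof
  have [measurable]: "f \<in> borel_measurable (lebesgue_on I)" "g \<in> borel_measurable (lebesgue_on I)"
    using assms by (auto simp: square_integrable_on_def)
  show "(\<lambda>x. f x + g x) \<in> borel_measurable (lebesgue_on I)" by measurable
  have "integrable (lebesgue_on I) (\<lambda>x. 2 * (f x)\<^sup>2 + 2 * (g x)\<^sup>2)"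
    using assms by (auto simp: square_integrable_on_def)
  moreover have "(\<lambda>x. (f x + g x)\<^sup>2) \<in> borel_measurable (lebesgue_on I)" by measurable
  moreover have "AE x in lebesgue_on I. norm ((f x + g x)\<^sup>2) \<le> norm (2 * (f x)\<^sup>2 + 2 * (g x)\<^sup>2)"
  proof (rule AE_I2)
    fix x
    have "(f x + g x)\<^sup>2 \<le> 2 * (f x)\<^sup>2 + 2 * (g x)\<^sup>2"
      using sum_squares_bound[of "f x" "g x"] by (simp add: power2_sum)
    then show "norm ((f x + g x)\<^sup>2) \<le> norm (2 * (f x)\<^sup>2 + 2 * (g x)\<^sup>2)" by simp
  qed
  ultimately show "integrable (lebesgue_on I) (\<lambda>x. (f x + g x)\<^sup>2)"
    by (rule Bochner_Integration.integrable_bound)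
qed

lemma square_integrable_on_sum:
  "finite S \<Longrightarrow> (\<And>i. i \<in> S \<Longrightarrow> square_integrable_on (f i) I) \<Longrightarrow>
   square_integrable_on (\<lambda>x. \<Sum>i\<in>S. c i * f i x) I"
proof (induction S rule: finite_induct)
  case empty
  then show ?case by (simp add: square_integrable_on_def)
next
  case (insert i S)
  then show ?case
    using square_integrable_on_add[OF square_integrable_on_cmult[of "f i" I "c i"]] by simp
qed

lemma continuous_on_extension_by_0:
  fixes F :: "real \<Rightarrow> real"
  assumes "continuous_on {s..t} F" "F s = 0" "F t = 0"
  shows "continuous_on S (\<lambda>x. indicator {s..t} x * F x)"
proof -
  have "continuous_on ({s..t} \<union> ({..s} \<union> {t..})) (\<lambda>x. if x \<in> {s..t} then F x else 0)"
    by (rule continuous_on_cases) (use assms in auto)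
  moreover have "{s..t} \<union> ({..s} \<union> {t..}) = UNIV" by auto
  moreover have "(\<lambda>x. if x \<in> {s..t} then F x else 0) = (\<lambda>x. indicator {s..t} x * F x)"
    by (auto simp: fun_eq_iff indicator_def)
  ultimately have "continuous_on UNIV (\<lambda>x. indicator {s..t} x * F x)" by (simp only:)
  then show ?thesis by (rule continuous_on_subset) simp
qed

lemma AE_lebesgue_on_not_in_finite:
  assumes "finite S" "I \<in> sets lebesgue"
  shows "AE x in lebesgue_on I. (x::real) \<notin> S"
proof -
  have "finite {x \<in> I. \<not> x \<notin> S}" using assms(1) by (rule finite_subset[rotated]) auto
  then show ?thesis using assms(2) negligible_finite by (simp add: AE_lebesgue_on_iff_negligible)
qed

lemma sum_of_square_if_orthogonal:
  fixes f :: "'i \<Rightarrow> real"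
  assumes "finite S" "\<And>i j. i \<in> S \<Longrightarrow> j \<in> S \<Longrightarrow> i \<noteq> j \<Longrightarrow> f i * f j = 0"
  shows "(\<Sum>i\<in>S. f i)\<^sup>2 = (\<Sum>i\<in>S. (f i)\<^sup>2)"
  using assms
proof (induction S rule: finite_induct)
  case (insert i S)
  have "f i * (\<Sum>j\<in>S. f j) = 0" unfolding sum_distrib_left using insert by (intro sum.neutral) auto
  moreover have "(\<Sum>i\<in>S. f i)\<^sup>2 = (\<Sum>i\<in>S. (f i)\<^sup>2)" using insert by auto
  ultimately show ?case using insert(1,2) by (simp add: power2_sum mult.assoc)
qed simp

text \<open>Functions supported on intervals with disjoint interiors diagonalise the quadratic form.
  If the form is negative on each of them, it is negative on their span, and this span has dimension
  \<open>N\<close>.\<close>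

theorem morse_index_ge:
  fixes G :: "('v, 'e) metric_graph" and F F' :: "nat \<Rightarrow> real \<Rightarrow> real" and \<alpha> \<beta> :: "nat \<Rightarrow> real"
  assumes G: "G \<in> graphs_fin" and e: "e \<in> edges G" and u: "u \<in> H1 G"
    and L: "W \<in> Linfty G" "\<rho> \<in> Linfty G"
    and ab: "\<And>i. i < N \<Longrightarrow> \<alpha> i < \<beta> i" "\<And>i. i < N \<Longrightarrow> {\<alpha> i..\<beta> i} \<subseteq> edge_interval G e"
    and disj: "\<And>i j. i < N \<Longrightarrow> j < N \<Longrightarrow> i \<noteq> j \<Longrightarrow> {\<alpha> i<..<\<beta> i} \<inter> {\<alpha> j<..<\<beta> j} = {}"
    and F: "\<And>i x. i < N \<Longrightarrow> x \<in> {\<alpha> i..\<beta> i} \<Longrightarrow> (F i has_real_derivative F' i x) (at x within {\<alpha> i..\<beta> i})"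
    and F': "\<And>i. i < N \<Longrightarrow> continuous_on {\<alpha> i..\<beta> i} (F' i)"
    and ends: "\<And>i. i < N \<Longrightarrow> F i (\<alpha> i) = 0" "\<And>i. i < N \<Longrightarrow> F i (\<beta> i) = 0"
    and V: "AE x in lebesgue_on (edge_interval G e).
        on_edge G W e x + lam - (p - 1) * on_edge G \<rho> e x * \<bar>on_edge G u e x\<bar> powr (p - 2) = V x"
      "locally_integrable_on V (edge_interval G e)"
    and Q: "\<And>i. i < N \<Longrightarrow> integral {\<alpha> i..\<beta> i} (\<lambda>x. (F' i x)\<^sup>2 + V x * (F i x)\<^sup>2) < 0"
  shows "enat N \<le> morse_index G p W lam \<rho> u"
proof -
  note G' = graphs_finD[OF G]
  define I where "I = edge_interval G e"
  have I: "closed_ray_or_segment I" unfolding I_def by (rule closed_ray_or_segment_edge_interval[OF G'(1) e])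
  note I' = closed_ray_or_segmentD[OF I]
  note abI = ab(2)[folded I_def]
  define f where "f = (\<lambda>i x. indicator {\<alpha> i..\<beta> i} x * F i x)"
  define d where "d = (\<lambda>i x. indicator {\<alpha> i..\<beta> i} x * F' i x)"
  have Fc: "continuous_on {\<alpha> i..\<beta> i} (F i)" if "i < N" for i using F[OF that] by (rule DERIV_continuous_on)
  have fc: "continuous_on S (f i)" if "i < N" for i S
    unfolding f_def by (rule continuous_on_extension_by_0[OF Fc[OF that] ends(1)[OF that] ends(2)[OF that]])
  have wd: "has_weak_derivative (f i) (d i) I" if "i < N" for i
    unfolding f_def d_def
    by (rule has_weak_derivative_C1_piece[OF I'(2) abI[OF that] less_imp_le[OF ab(1)[OF that]] F[OF that] F'[OF that]])
      (use ends that in auto)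
  have dsq: "square_integrable_on (d i) I" if i: "i < N" for i
    unfolding square_integrable_on_def
  proof
    have F'm: "F' i \<in> borel_measurable (lebesgue_on {\<alpha> i..\<beta> i})"
      by (rule continuous_imp_measurable_on_sets_lebesgue[OF F'[OF i]]) simp
    have "(\<lambda>x. if x \<in> {\<alpha> i..\<beta> i} then F' i x else 0) \<in> borel_measurable lebesgue"
      using F'm by (subst borel_measurable_if) auto
    then have "(\<lambda>x. if x \<in> {\<alpha> i..\<beta> i} then F' i x else 0) \<in> borel_measurable (lebesgue_on I)"
      by (rule measurable_restrict_space1)
    moreover have "(\<lambda>x. if x \<in> {\<alpha> i..\<beta> i} then F' i x else 0) = d i"
      by (auto simp: d_def fun_eq_iff indicator_def)
    ultimately show "d i \<in> borel_measurable (lebesgue_on I)" by simp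
    have "integrable (lebesgue_on {\<alpha> i..\<beta> i}) (\<lambda>x. (F' i x)\<^sup>2)"
      by (rule integrable_lebesgue_on_continuous) (intro continuous_intros F'[OF i])
    then have "integrable (lebesgue_on {\<alpha> i..\<beta> i}) (\<lambda>x. (d i x)\<^sup>2)"
      by (rule Bochner_Integration.integrable_cong[THEN iffD1, rotated 2]) (auto simp: d_def)
    then show "integrable (lebesgue_on I) (\<lambda>x. (d i x)\<^sup>2)"
      using lebesgue_on_supported(1)[OF abI[OF i] _ I'(2), of "\<lambda>x. (d i x)\<^sup>2"] by (auto simp: d_def)
  qed
  have \<alpha>0: "0 \<le> \<alpha> i" and \<beta>I: "\<beta> i \<in> I" if "i < N" for i
    using abI[OF that] ab(1)[OF that] I'(5)[of "\<alpha> i"] by (auto simp: subset_iff)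
  have f0: "f i 0 = 0" if "i < N" for i
    using \<alpha>0[OF that] ends(1)[OF that] by (cases "\<alpha> i = 0") (auto simp: f_def indicator_def)
  have fl: "f i x = 0" if "i < N" "ereal x = len G e" for i x
  proof -
    have "\<beta> i \<le> x" using \<beta>I[OF that(1)] that(2)[symmetric] by (simp add: I_def edge_interval_def)
    then show ?thesis using ends(2)[OF that(1)] by (cases "\<beta> i = x") (auto simp: f_def indicator_def)
  qed
  \<comment> \<open>The inserted 0 keeps the set nonempty when \<open>N = 0\<close>.\<close>
  define r where "r = Max (insert 0 (\<beta> ` {..<N}))"
  have rI: "r \<in> I"
  proof -
    have "r \<in> insert 0 (\<beta> ` {..<N})" unfolding r_def by (rule Max_in) auto
    then show ?thesis using \<beta>I I'(4) by auto
  qed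
  have fr: "f i x = 0" if "i < N" "r < x" for i x
  proof -
    have "\<beta> i \<le> r" unfolding r_def using that(1) by (intro Max_ge) auto
    then show ?thesis using that(2) by (auto simp: f_def)
  qed
  define \<Phi> where "\<Phi> = (\<lambda>i. edge_fun G e (f i))"
  define comb where "comb = (\<lambda>c x. \<Sum>i<N. c i * f i x)"
  define dcomb where "dcomb = (\<lambda>c x. \<Sum>i<N. c i * d i x)"
  have edge_comb: "edge_fun G e (comb c) = (\<lambda>z. \<Sum>i<N. c i * \<Phi> i z)" for c
    by (auto simp: fun_eq_iff edge_fun_def \<Phi>_def comb_def split: gpoint.split)
  have comb_end: "comb c x = 0" if "ereal x = len G e" for c x unfolding comb_def using fl that by simp
  have comb0: "comb c 0 = 0" for c unfolding comb_def using f0 by simp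
  have T: "edge_fun G e (comb c) \<in> H1 G \<inter> Cc G"
    "AE x in lebesgue_on I. edge_deriv G (edge_fun G e (comb c)) e x = dcomb c x"
    "\<And>e'. e' \<in> edges G \<Longrightarrow> e' \<noteq> e \<Longrightarrow>
      AE x in lebesgue_on (edge_interval G e'). edge_deriv G (edge_fun G e (comb c)) e' x = 0" for c
  proof -
    have c: "continuous_on I (comb c)" unfolding comb_def by (intro continuous_intros fc) auto
    have van: "comb c x = 0" if "x \<in> I" "r < x" for x unfolding comb_def using fr that by simp
    have w: "has_weak_derivative (comb c) (dcomb c) I"
      unfolding comb_def dcomb_def
      by (rule has_weak_derivative_sum[OF I])
        (use wd locally_integrable_on_continuous[OF fc] square_integrable_on_imp_locally_integrable_on[OF dsq I'(2)] in auto)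
    have s: "square_integrable_on (dcomb c) I"
      unfolding dcomb_def by (rule square_integrable_on_sum) (use dsq in auto)
    show "edge_fun G e (comb c) \<in> H1 G \<inter> Cc G"
      by (rule edge_fun_test_function(1)[where r = r and d = "dcomb c", OF G e])
        (unfold I_def[symmetric], (fact c comb0 comb_end rI van w s)+)
    show "AE x in lebesgue_on I. edge_deriv G (edge_fun G e (comb c)) e x = dcomb c x"
      unfolding I_def
      by (rule edge_fun_test_function(2)[where r = r and d = "dcomb c", OF G e])
        (unfold I_def[symmetric], (fact c comb0 comb_end rI van w s)+)
    show "AE x in lebesgue_on (edge_interval G e'). edge_deriv G (edge_fun G e (comb c)) e' x = 0"
      if "e' \<in> edges G" "e' \<noteq> e" for e'
      by (rule edge_fun_test_function(3)[where r = r and d = "dcomb c", OF G e _ _ _ _ _ _ _ that])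
        (unfold I_def[symmetric], (fact c comb0 comb_end rI van w s)+)
  qed
  define q where "q = (\<lambda>i x. (F' i x)\<^sup>2 + V x * (F i x)\<^sup>2)"
  have qi: "integrable (lebesgue_on {\<alpha> i..\<beta> i}) (q i)" if i: "i < N" for i
    unfolding q_def
  proof (intro Bochner_Integration.integrable_add integrable_lebesgue_on_mult_continuous)
    show "integrable (lebesgue_on {\<alpha> i..\<beta> i}) (\<lambda>x. (F' i x)\<^sup>2)"
      by (rule integrable_lebesgue_on_continuous) (intro continuous_intros F'[OF i])
    show "integrable (lebesgue_on {\<alpha> i..\<beta> i}) V"
      using V(2) abI[OF i] unfolding locally_integrable_on_def I_def by blast
    show "continuous_on {\<alpha> i..\<beta> i} (\<lambda>x. (F i x)\<^sup>2)" by (intro continuous_intros Fc[OF i])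
  qed
  have qI: "integrable (lebesgue_on I) (\<lambda>x. indicator {\<alpha> i..\<beta> i} x * q i x)"
    "(LINT x|lebesgue_on I. indicator {\<alpha> i..\<beta> i} x * q i x) = integral {\<alpha> i..\<beta> i} (q i)" if i: "i < N" for i
  proof -
    have eq: "integrable (lebesgue_on {\<alpha> i..\<beta> i}) (\<lambda>x. indicator {\<alpha> i..\<beta> i} x * q i x) =
        integrable (lebesgue_on {\<alpha> i..\<beta> i}) (q i)"
      "(LINT x|lebesgue_on {\<alpha> i..\<beta> i}. indicator {\<alpha> i..\<beta> i} x * q i x) = (LINT x|lebesgue_on {\<alpha> i..\<beta> i}. q i x)"
      by (rule Bochner_Integration.integrable_cong Bochner_Integration.integral_cong; simp)+
    note sup = lebesgue_on_supported[OF abI[OF i] _ I'(2), of "\<lambda>x. indicator {\<alpha> i..\<beta> i} x * q i x"]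
    show "integrable (lebesgue_on I) (\<lambda>x. indicator {\<alpha> i..\<beta> i} x * q i x)"
      using sup(1) eq(1) qi[OF i] by simp
    show "(LINT x|lebesgue_on I. indicator {\<alpha> i..\<beta> i} x * q i x) = integral {\<alpha> i..\<beta> i} (q i)"
      using sup(2) eq(2) lebesgue_integral_eq_integral[OF qi[OF i]] by simp
  qed
  have form: "morse_form G p W lam \<rho> u (edge_fun G e (comb c)) = (\<Sum>i<N. (c i)\<^sup>2 * integral {\<alpha> i..\<beta> i} (q i))" for c
  proof -
    let ?\<phi> = "edge_fun G e (comb c)"
    let ?g = "\<lambda>e x. (edge_deriv G ?\<phi> e x)\<^sup>2 + (on_edge G W e x + lam) * (on_edge G ?\<phi> e x)\<^sup>2 -
       (p - 1) * on_edge G \<rho> e x * \<bar>on_edge G u e x\<bar> powr (p - 2) * (on_edge G ?\<phi> e x)\<^sup>2"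
    have on: "on_edge G ?\<phi> e' x = (if e' = e then comb c x else 0)" if "x \<in> edge_interval G e'" for e' x
      by (rule on_edge_edge_fun[where f = "comb c", OF that comb0]) (rule comb_end)
    have other: "(LINT x|lebesgue_on (edge_interval G e'). ?g e' x) = 0" if e': "e' \<in> edges G" "e' \<noteq> e" for e'
    proof (rule integral_eq_zero_AE)
      have "AE x in lebesgue_on (edge_interval G e'). on_edge G ?\<phi> e' x = 0"
        using on e'(2) by (intro AE_I2) auto
      then show "AE x in lebesgue_on (edge_interval G e'). ?g e' x = 0"
        using T(3)[OF e'] by eventually_elim simp
    qed
    have "morse_form G p W lam \<rho> u ?\<phi> = (\<Sum>e'\<in>edges G. LINT x|lebesgue_on (edge_interval G e'). ?g e' x)"
      unfolding morse_form_def graph_integral_def infsum_finite[OF G'(2)] ..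
    also have "\<dots> = (LINT x|lebesgue_on I. ?g e x)"
      by (subst sum.remove[OF G'(2) e]) (simp add: other I_def)
    also have "\<dots> = (LINT x|lebesgue_on I. (\<Sum>i<N. (c i)\<^sup>2 * (indicator {\<alpha> i..\<beta> i} x * q i x)))"
    proof (rule integral_cong_AE)
      have [measurable]: "on_edge G W e \<in> borel_measurable (lebesgue_on I)" "on_edge G \<rho> e \<in> borel_measurable (lebesgue_on I)"
        using L e by (auto simp: Linfty_def I_def)
      have [measurable]: "on_edge G u e \<in> borel_measurable (lebesgue_on I)"
        "on_edge G ?\<phi> e \<in> borel_measurable (lebesgue_on I)" "edge_deriv G ?\<phi> e \<in> borel_measurable (lebesgue_on I)"
        using H1D(2)[OF G u e] H1D(2,3)[OF G _ e, of ?\<phi>] T(1)[of c] by (auto simp: square_integrable_on_def I_def)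
      show "?g e \<in> borel_measurable (lebesgue_on I)" by measurable
      have "integrable (lebesgue_on I) (\<lambda>x. \<Sum>i<N. (c i)\<^sup>2 * (indicator {\<alpha> i..\<beta> i} x * q i x))"
        by (rule Bochner_Integration.integrable_sum, rule integrable_mult_right, rule qI(1)) simp
      then show "(\<lambda>x. \<Sum>i<N. (c i)\<^sup>2 * (indicator {\<alpha> i..\<beta> i} x * q i x)) \<in> borel_measurable (lebesgue_on I)"
        by (rule borel_measurable_integrable)
      \<comment> \<open>Neighbouring closed intervals may share an endpoint; without the finitely
        many endpoints the pieces are pointwise orthogonal.\<close>
      have "AE x in lebesgue_on I. x \<notin> \<alpha> ` {..<N} \<union> \<beta> ` {..<N}"
        by (rule AE_lebesgue_on_not_in_finite) (use I'(2) in auto)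
      moreover have "AE x in lebesgue_on I. x \<in> I" by (rule AE_I2) simp
      ultimately show "AE x in lebesgue_on I. ?g e x = (\<Sum>i<N. (c i)\<^sup>2 * (indicator {\<alpha> i..\<beta> i} x * q i x))"
        using T(2)[of c] V(1)[folded I_def]
      proof eventually_elim
        case (elim x)
        have orth: "(indicator {\<alpha> i..\<beta> i} x :: real) * indicator {\<alpha> j..\<beta> j} x = 0" if "i < N" "j < N" "i \<noteq> j" for i j
        proof -
          have "x \<noteq> \<alpha> i" "x \<noteq> \<beta> i" "x \<noteq> \<alpha> j" "x \<noteq> \<beta> j" using elim(1) that by auto
          then show ?thesis using disj[OF that] by (auto simp: indicator_def)
        qed
        have cc: "(comb c x)\<^sup>2 = (\<Sum>i<N. (c i * f i x)\<^sup>2)" and dd: "(dcomb c x)\<^sup>2 = (\<Sum>i<N. (c i * d i x)\<^sup>2)"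
          unfolding comb_def dcomb_def
          by (rule sum_of_square_if_orthogonal; use orth in \<open>fastforce simp: f_def d_def\<close>)+
        have "?g e x = (dcomb c x)\<^sup>2 + V x * (comb c x)\<^sup>2"
          using elim on[of x e] by (simp add: I_def algebra_simps flip: elim(4))
        also have "\<dots> = (\<Sum>i<N. (c i * d i x)\<^sup>2 + V x * (c i * f i x)\<^sup>2)"
          unfolding cc dd by (simp add: sum.distrib sum_distrib_left)
        also have "\<dots> = (\<Sum>i<N. (c i)\<^sup>2 * (indicator {\<alpha> i..\<beta> i} x * q i x))"
          by (rule sum.cong) (auto simp: f_def d_def q_def indicator_def power_mult_distrib algebra_simps)
        finally show ?case .
      qed
    qed
    also have "\<dots> = (\<Sum>i<N. (c i)\<^sup>2 * integral {\<alpha> i..\<beta> i} (q i))"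
      using qI by (subst Bochner_Integration.integral_sum) auto
    finally show ?thesis .
  qed
  \<comment> \<open>A piece that vanished identically would make its integral nonnegative.
    Evaluation at the points \<open>y i\<close> obtained here shows linear independence, since at
    \<open>y i\<close> all pieces other than the one with index \<open>i\<close> vanish.\<close>
  have "\<exists>x\<in>{\<alpha> i<..<\<beta> i}. F i x \<noteq> 0" if i: "i < N" for i
  proof (rule ccontr)
    assume "\<not> ?thesis"
    then have "F i x = 0" if "x \<in> {\<alpha> i..\<beta> i}" for x
      using that ends[OF i] by (cases "x = \<alpha> i \<or> x = \<beta> i") auto
    then have "integral {\<alpha> i..\<beta> i} (q i) = integral {\<alpha> i..\<beta> i} (\<lambda>x. (F' i x)\<^sup>2)"
      by (intro Henstock_Kurzweil_Integration.integral_cong) (simp add: q_def)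
    also have "\<dots> \<ge> 0"
      by (rule Henstock_Kurzweil_Integration.integral_nonneg)
        (auto intro!: integrable_continuous_real continuous_intros F'[OF i])
    finally show False using Q[OF i] by (simp add: q_def)
  qed
  then obtain y where y: "\<And>i. i < N \<Longrightarrow> y i \<in> {\<alpha> i<..<\<beta> i}" "\<And>i. i < N \<Longrightarrow> F i (y i) \<noteq> 0" by metis
  have fy: "f j (y i) = (if j = i then F i (y i) else 0)" if ij: "i < N" "j < N" for i j
  proof (cases "j = i")
    case True
    then show ?thesis using y(1)[OF ij(1)] by (simp add: f_def)
  next
    case False
    have "y i \<notin> {\<alpha> j<..<\<beta> j}" using disj[OF ij] False y(1)[OF ij(1)] by blast
    then show ?thesis using False ends[OF ij(2)] by (cases "y i = \<alpha> j \<or> y i = \<beta> j") (auto simp: f_def)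
  qed
  define z where "z = (\<lambda>i. Inner e (y i) :: ('v, 'e) gpoint)"
  have \<Phi>z: "\<Phi> j (z i) = (if j = i then F i (y i) else 0)" if ij: "i < N" "j < N" for i j
  proof -
    have "0 < y i" "ereal (y i) < len G e"
    proof -
      show "0 < y i" using y(1)[OF ij(1)] \<alpha>0[OF ij(1)] by auto
      have "ereal (y i) < ereal (\<beta> i)" using y(1)[OF ij(1)] by simp
      also have "\<dots> \<le> len G e" using \<beta>I[OF ij(1)] by (simp add: I_def edge_interval_def)
      finally show "ereal (y i) < len G e" .
    qed
    then show ?thesis using fy[OF ij] by (simp add: \<Phi>_def z_def edge_fun_def)
  qed
  \<comment> \<open>\<open>Y\<close> contains the span of \<open>B\<close> and displays each of its
    elements through coefficients \<open>c\<close>, which is what the diagonal formula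
    \<open>form\<close> needs.\<close>
  define Y where "Y = range (\<lambda>c. edge_fun G e (comb c))"
  have subY: "fun_vs.subspace Y"
  proof (rule fun_vs.subspaceI)
    show "0 \<in> Y" unfolding Y_def edge_comb by (rule range_eqI[of _ _ "\<lambda>_. 0"]) (simp add: fun_eq_iff)
    show "v + w \<in> Y" if vw: "v \<in> Y" "w \<in> Y" for v w
    proof -
      obtain c where c: "v = edge_fun G e (comb c)" using vw(1) unfolding Y_def by blast
      obtain c' where "w = edge_fun G e (comb c')" using vw(2) unfolding Y_def by blast
      with c have "v + w = edge_fun G e (comb (\<lambda>i. c i + c' i))"
        by (simp add: edge_comb fun_eq_iff distrib_right sum.distrib)
      then show ?thesis by (simp add: Y_def)
    qed
    show "(\<lambda>x. k * v x) \<in> Y" if v: "v \<in> Y" for k v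
    proof -
      obtain c where "v = edge_fun G e (comb c)" using v unfolding Y_def by blast
      then have "(\<lambda>x. k * v x) = edge_fun G e (comb (\<lambda>i. k * c i))"
        by (simp add: edge_comb fun_eq_iff sum_distrib_left mult.assoc)
      then show ?thesis by (simp add: Y_def)
    qed
  qed
  define B where "B = \<Phi> ` {..<N}"
  have inj: "inj_on \<Phi> {..<N}"
  proof (rule inj_onI)
    fix i j assume ij: "i \<in> {..<N}" "j \<in> {..<N}" "\<Phi> i = \<Phi> j"
    then have "\<Phi> j (z i) = F i (y i)" using \<Phi>z[of i i] by (metis lessThan_iff)
    then show "i = j" using \<Phi>z[of i j] y(2)[of i] ij by (auto split: if_splits)
  qed
  have "\<Phi> i \<in> Y" if "i < N" for i
  proof -
    have "\<Phi> i = edge_fun G e (comb (\<lambda>j. if j = i then 1 else 0))"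
      using that by (simp add: edge_comb fun_eq_iff if_distrib[of "\<lambda>x. x * _"] cong: if_cong)
    then show ?thesis by (simp add: Y_def)
  qed
  then have "B \<subseteq> Y" by (auto simp: B_def)
  then have spY: "fun_vs.span B \<subseteq> Y" using subY by (rule fun_vs.span_minimal)
  have ind: "fun_vs.independent B"
  proof (rule fun_vs.independent_if_scalars_zero)
    show "finite B" by (simp add: B_def)
    fix g v assume 0: "(\<Sum>x\<in>B. (\<lambda>z. g x * x z)) = 0" and v: "v \<in> B"
    then obtain i where i: "i < N" "v = \<Phi> i" by (auto simp: B_def)
    have ev: "(\<Sum>x\<in>S. (\<lambda>z. g x * x z)) t = (\<Sum>x\<in>S. g x * x t)" if "finite S" for S t
      using that by (induction S rule: finite_induct) auto
    have "0 = (\<Sum>x\<in>B. g x * x (z i))" using ev[of B "z i"] 0 by (simp add: B_def)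
    also have "\<dots> = (\<Sum>j<N. g (\<Phi> j) * \<Phi> j (z i))" unfolding B_def by (simp add: sum.reindex[OF inj])
    also have "\<dots> = (\<Sum>j<N. if j = i then g (\<Phi> i) * F i (y i) else 0)"
      using \<Phi>z[OF i(1)] by (intro sum.cong) auto
    finally show "g v = 0" using i y(2)[OF i(1)] by simp
  qed
  have dim: "fun_vs.dim (fun_vs.span B) = N"
    using fun_vs.dim_span_eq_card_independent[OF ind] card_image[OF inj] by (simp add: B_def)
  have "subspace_dim (fun_vs.span B) = enat N"
  proof -
    have "\<exists>C. finite C \<and> fun_vs.span B \<subseteq> fun_vs.span C" by (rule exI[of _ B]) (simp add: B_def)
    then show ?thesis unfolding subspace_dim_def dim by simp
  qed
  moreover have "fun_vs.span B \<in> {X. fun_vs.subspace X \<and> X \<subseteq> H1 G \<inter> Cc G \<and>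
      (\<forall>\<phi> \<in> X - {0}. morse_form G p W lam \<rho> u \<phi> < 0)}"
  proof (intro CollectI conjI ballI)
    show "fun_vs.subspace (fun_vs.span B)" by (rule fun_vs.subspace_span)
    show "fun_vs.span B \<subseteq> H1 G \<inter> Cc G" using spY T(1) unfolding Y_def by blast
    fix \<phi> assume \<phi>: "\<phi> \<in> fun_vs.span B - {0}"
    then obtain c where c: "\<phi> = edge_fun G e (comb c)" using spY unfolding Y_def by blast
    have "\<exists>i<N. c i \<noteq> 0"
    proof (rule ccontr)
      assume "\<not> ?thesis"
      then have "\<phi> = 0" unfolding c edge_comb by (simp add: fun_eq_iff)
      then show False using \<phi> by simp
    qed
    then obtain i where i: "i < N" "c i \<noteq> 0" by blast
    have "(\<Sum>i<N. (c i)\<^sup>2 * integral {\<alpha> i..\<beta> i} (q i)) < (\<Sum>i<N. 0)"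
    proof (rule sum_strict_mono_ex1)
      show "\<forall>j\<in>{..<N}. (c j)\<^sup>2 * integral {\<alpha> j..\<beta> j} (q j) \<le> 0"
      proof
        fix j assume "j \<in> {..<N}"
        then have "integral {\<alpha> j..\<beta> j} (q j) \<le> 0" using Q[of j] by (simp add: q_def)
        then show "(c j)\<^sup>2 * integral {\<alpha> j..\<beta> j} (q j) \<le> 0" by (intro mult_nonneg_nonpos) simp_all
      qed
      have "(c i)\<^sup>2 * integral {\<alpha> i..\<beta> i} (q i) < 0"
        using Q[OF i(1)] i(2) by (intro mult_pos_neg) (simp_all add: q_def)
      then show "\<exists>j\<in>{..<N}. (c j)\<^sup>2 * integral {\<alpha> j..\<beta> j} (q j) < 0" using i(1) by blast
    qed simp
    then show "morse_form G p W lam \<rho> u \<phi> < 0" unfolding c form by simp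
  qed
  ultimately show ?thesis unfolding morse_index_def by (metis (no_types, lifting) SUP_upper)
qed

section \<open>Testing the second variation with multiples of the solution\<close>

lemma edge_solution_rhs_bound:
  assumes es: "edge_solution I p lam Wbar b W \<rho> u du" and p: "2 < p" and M: "\<bar>u x\<bar> \<le> M"
  shows "\<bar>(W x + lam - \<rho> x * \<bar>u x\<bar> powr (p - 2)) * u x\<bar> \<le> (Wbar + \<bar>lam\<bar> + b * M powr (p - 2)) * M"
    and "\<bar>\<rho> x * \<bar>u x\<bar> powr (p - 2)\<bar> \<le> b * M powr (p - 2)"
proof -
  note D = edge_solutionD[OF es]
  have "\<bar>u x\<bar> powr (p - 2) \<le> M powr (p - 2)" using M p by (intro powr_mono2) auto
  then show 1: "\<bar>\<rho> x * \<bar>u x\<bar> powr (p - 2)\<bar> \<le> b * M powr (p - 2)"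
    unfolding abs_mult using D(5,6)[of x] by (intro mult_mono) auto
  have "\<bar>W x + lam - \<rho> x * \<bar>u x\<bar> powr (p - 2)\<bar> \<le> Wbar + \<bar>lam\<bar> + b * M powr (p - 2)"
    using 1 D(4)[of x] by linarith
  then show "\<bar>(W x + lam - \<rho> x * \<bar>u x\<bar> powr (p - 2)) * u x\<bar> \<le> (Wbar + \<bar>lam\<bar> + b * M powr (p - 2)) * M"
    unfolding abs_mult using M by (intro mult_mono) linarith+
qed

lemma edge_solution_locally_integrable:
  assumes es: "edge_solution I p lam Wbar b W \<rho> u du" and p: "2 < p"
  shows "locally_integrable_on (\<lambda>x. \<rho> x * \<bar>u x\<bar> powr (p - 2)) I" "locally_integrable_on W I"
proof -
  note D = edge_solutionD[OF es]
  note [measurable] = D(2,3,10)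
  show "locally_integrable_on (\<lambda>x. \<rho> x * \<bar>u x\<bar> powr (p - 2)) I"
  proof (rule locally_integrable_on_bounded(1)[OF D(1)])
    show "\<exists>B. \<forall>z\<in>{0..x}. \<bar>\<rho> z * \<bar>u z\<bar> powr (p - 2)\<bar> \<le> B" if xI: "x \<in> I" for x
    proof -
      obtain M where M: "\<And>z. z \<in> {0..x} \<Longrightarrow> \<bar>u z\<bar> \<le> M"
        using continuous_on_locally_bounded[OF D(1,9) xI] by metis
      then show ?thesis using edge_solution_rhs_bound(2)[OF es p M] by blast
    qed
  qed measurable
  show "locally_integrable_on W I"
    by (rule locally_integrable_on_bounded(1)[OF D(1,2)]) (use D(4) in blast)
qed

text \<open>Because \<open>(u' \<eta> + u \<eta>')^2 = u' (u \<eta>^2)' + u^2 \<eta>'^2\<close>, the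
  form at \<open>u \<eta>\<close> contains the equation tested with \<open>u \<eta>^2\<close>. That
  part integrates to 0, which removes the potential and \<open>lam\<close>. The factor
  \<open>p - 2\<close> is what remains of \<open>p - 1\<close> after the equation has used up one
  copy of the nonlinear term.\<close>

lemma morse_integral_eq:
  assumes es: "edge_solution I p lam Wbar b W \<rho> u du" and p: "2 < p"
    and ab: "\<alpha> \<le> \<beta>" "{\<alpha>..\<beta>} \<subseteq> I"
    and \<eta>: "\<And>x. (\<eta> has_real_derivative \<eta>' x) (at x)" "continuous_on UNIV \<eta>'"
    and ends: "u \<alpha> * \<eta> \<alpha> = 0" "u \<beta> * \<eta> \<beta> = 0"
  shows "integral {\<alpha>..\<beta>} (\<lambda>x. (du x * \<eta> x + u x * \<eta>' x)\<^sup>2 +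
      (W x + lam - (p - 1) * \<rho> x * \<bar>u x\<bar> powr (p - 2)) * (u x * \<eta> x)\<^sup>2) =
    integral {\<alpha>..\<beta>} (\<lambda>x. (u x)\<^sup>2 * (\<eta>' x)\<^sup>2) -
      (p - 2) * integral {\<alpha>..\<beta>} (\<lambda>x. \<rho> x * \<bar>u x\<bar> powr (p - 2) * ((u x)\<^sup>2 * (\<eta> x)\<^sup>2))"
    and "(\<lambda>x. \<rho> x * \<bar>u x\<bar> powr (p - 2) * ((u x)\<^sup>2 * (\<eta> x)\<^sup>2)) integrable_on {\<alpha>..\<beta>}"
proof -
  note D = edge_solutionD[OF es]
  define h where "h = (\<lambda>x. (W x + lam - \<rho> x * \<bar>u x\<bar> powr (p - 2)) * u x)"
  define K where "K = (\<lambda>x. u x * (\<eta> x)\<^sup>2)"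
  define K' where "K' = (\<lambda>x. du x * (\<eta> x)\<^sup>2 + u x * (2 * \<eta> x * \<eta>' x))"
  have \<eta>c: "continuous_on S \<eta>" for S
    by (rule DERIV_continuous_on) (rule has_field_derivative_at_within[OF \<eta>(1)])
  have \<eta>'c: "continuous_on S \<eta>'" for S using \<eta>(2) continuous_on_subset by blast
  have uc: "continuous_on {\<alpha>..\<beta>} u" "continuous_on {\<alpha>..\<beta>} du"
    using D(8,9) ab(2) continuous_on_subset by blast+
  have aI: "\<alpha> \<in> I" "\<beta> \<in> I" using ab by auto
  have "0 \<le> \<alpha>" using closed_ray_or_segmentD(5)[OF D(1) aI(1)] .
  obtain M where M: "\<And>x. x \<in> {0..\<beta>} \<Longrightarrow> \<bar>u x\<bar> \<le> M"
    using continuous_on_locally_bounded[OF D(1,9) aI(2)] by metis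
  \<comment> \<open>The equation tested with \<open>K = u \<eta>^2\<close>; the factor known only
    through integrals of a bounded function is \<open>du\<close>.\<close>
  have "((\<lambda>x. h x * K x + du x * K' x) has_integral (du \<beta> * K \<beta> - du \<alpha> * K \<alpha>)) {\<alpha>..\<beta>}"
  proof (rule integration_by_parts_bounded[OF ab(1)])
    show "(h has_integral du y - du x) {x..y}" if "\<alpha> \<le> x" "x \<le> y" "y \<le> \<beta>" for x y
    proof -
      have "x \<in> I" "y \<in> I" using that ab(2) by auto
      then show ?thesis using D(7) that(2) unfolding second_antiderivative_on_def h_def by blast
    qed
    show "\<bar>h x\<bar> \<le> (Wbar + \<bar>lam\<bar> + b * M powr (p - 2)) * M" if "x \<in> {\<alpha>..\<beta>}" for x
      unfolding h_def by (rule edge_solution_rhs_bound(1)[OF es p M]) (use that \<open>0 \<le> \<alpha>\<close> in auto)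
    show "(K has_real_derivative K' x) (at x within {\<alpha>..\<beta>})" if x: "x \<in> {\<alpha>..\<beta>}" for x
    proof -
      have u': "(u has_real_derivative du x) (at x within {\<alpha>..\<beta>})"
        using D(7) x ab(2) DERIV_subset[of u "du x" x I "{\<alpha>..\<beta>}"] unfolding second_antiderivative_on_def by blast
      have "((\<lambda>x. (\<eta> x)\<^sup>2) has_real_derivative 2 * \<eta> x * \<eta>' x) (at x within {\<alpha>..\<beta>})"
        using has_field_derivative_at_within[OF \<eta>(1)] by (auto intro!: derivative_eq_intros)
      from DERIV_mult[OF u' this] show ?thesis unfolding K_def K'_def by (simp add: mult.commute add.commute)
    qed
    show "continuous_on {\<alpha>..\<beta>} K'" unfolding K'_def by (intro continuous_intros uc \<eta>c \<eta>'c)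
  qed
  moreover have "K \<alpha> = 0" "K \<beta> = 0" using ends by (auto simp: K_def)
  ultimately have A: "((\<lambda>x. h x * K x + du x * K' x) has_integral 0) {\<alpha>..\<beta>}" by simp
  define g where "g = (\<lambda>x. \<rho> x * \<bar>u x\<bar> powr (p - 2))"
  have "integrable (lebesgue_on {\<alpha>..\<beta>}) g"
    using edge_solution_locally_integrable(1)[OF es p] ab(2) unfolding locally_integrable_on_def g_def by blast
  then have "integrable (lebesgue_on {\<alpha>..\<beta>}) (\<lambda>x. g x * ((u x)\<^sup>2 * (\<eta> x)\<^sup>2))"
    by (rule integrable_lebesgue_on_mult_continuous) (intro continuous_intros uc \<eta>c)
  then have B: "(\<lambda>x. g x * ((u x)\<^sup>2 * (\<eta> x)\<^sup>2)) integrable_on {\<alpha>..\<beta>}"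
    by (rule integrable_on_lebesgue_on) simp
  then show "(\<lambda>x. \<rho> x * \<bar>u x\<bar> powr (p - 2) * ((u x)\<^sup>2 * (\<eta> x)\<^sup>2)) integrable_on {\<alpha>..\<beta>}"
    by (simp add: g_def)
  have C: "(\<lambda>x. (u x)\<^sup>2 * (\<eta>' x)\<^sup>2) integrable_on {\<alpha>..\<beta>}"
    by (intro integrable_continuous_real continuous_intros uc \<eta>'c)
  have "((\<lambda>x. (h x * K x + du x * K' x) + ((u x)\<^sup>2 * (\<eta>' x)\<^sup>2 - (p - 2) * (g x * ((u x)\<^sup>2 * (\<eta> x)\<^sup>2)))) has_integral
      (0 + (integral {\<alpha>..\<beta>} (\<lambda>x. (u x)\<^sup>2 * (\<eta>' x)\<^sup>2) - (p - 2) * integral {\<alpha>..\<beta>} (\<lambda>x. g x * ((u x)\<^sup>2 * (\<eta> x)\<^sup>2))))) {\<alpha>..\<beta>}"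
    by (intro has_integral_add has_integral_diff has_integral_mult_right A integrable_integral B C)
  moreover have "(h x * K x + du x * K' x) + ((u x)\<^sup>2 * (\<eta>' x)\<^sup>2 - (p - 2) * (g x * ((u x)\<^sup>2 * (\<eta> x)\<^sup>2)))
      = (du x * \<eta> x + u x * \<eta>' x)\<^sup>2 + (W x + lam - (p - 1) * \<rho> x * \<bar>u x\<bar> powr (p - 2)) * (u x * \<eta> x)\<^sup>2" for x
    unfolding h_def K_def K'_def g_def by (simp add: power2_eq_square algebra_simps)
  ultimately show "integral {\<alpha>..\<beta>} (\<lambda>x. (du x * \<eta> x + u x * \<eta>' x)\<^sup>2 +
      (W x + lam - (p - 1) * \<rho> x * \<bar>u x\<bar> powr (p - 2)) * (u x * \<eta> x)\<^sup>2) =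
    integral {\<alpha>..\<beta>} (\<lambda>x. (u x)\<^sup>2 * (\<eta>' x)\<^sup>2) -
      (p - 2) * integral {\<alpha>..\<beta>} (\<lambda>x. \<rho> x * \<bar>u x\<bar> powr (p - 2) * ((u x)\<^sup>2 * (\<eta> x)\<^sup>2))"
    unfolding g_def by (simp add: integral_unique)
qed

theorem morse_index_ge_multiples:
  fixes G :: "('v, 'e) metric_graph" and \<eta> \<eta>' :: "nat \<Rightarrow> real \<Rightarrow> real" and \<alpha> \<beta> :: "nat \<Rightarrow> real"
  assumes G: "G \<in> graphs_fin" and e: "e \<in> edges G" and u: "u \<in> H1 G"
    and L: "W \<in> Linfty G" "\<rho> \<in> Linfty G" and p: "2 < p"
    and AE: "AE x in lebesgue_on (edge_interval G e). on_edge G W e x = W\<^sub>e x"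
      "AE x in lebesgue_on (edge_interval G e). on_edge G \<rho> e x = \<rho>\<^sub>e x"
    and es: "edge_solution (edge_interval G e) p lam Wbar b W\<^sub>e \<rho>\<^sub>e (on_edge G u e) du"
    and ab: "\<And>i. i < N \<Longrightarrow> \<alpha> i < \<beta> i" "\<And>i. i < N \<Longrightarrow> {\<alpha> i..\<beta> i} \<subseteq> edge_interval G e"
    and disj: "\<And>i j. i < N \<Longrightarrow> j < N \<Longrightarrow> i \<noteq> j \<Longrightarrow> {\<alpha> i<..<\<beta> i} \<inter> {\<alpha> j<..<\<beta> j} = {}"
    and \<eta>: "\<And>i x. (\<eta> i has_real_derivative \<eta>' i x) (at x)" "\<And>i. continuous_on UNIV (\<eta>' i)"
    and ends: "\<And>i. i < N \<Longrightarrow> on_edge G u e (\<alpha> i) * \<eta> i (\<alpha> i) = 0" "\<And>i. i < N \<Longrightarrow> on_edge G u e (\<beta> i) * \<eta> i (\<beta> i) = 0"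
    and Q: "\<And>i. i < N \<Longrightarrow> integral {\<alpha> i..\<beta> i} (\<lambda>x. (on_edge G u e x)\<^sup>2 * (\<eta>' i x)\<^sup>2) <
      (p - 2) * integral {\<alpha> i..\<beta> i} (\<lambda>x. \<rho>\<^sub>e x * \<bar>on_edge G u e x\<bar> powr (p - 2) * ((on_edge G u e x)\<^sup>2 * (\<eta> i x)\<^sup>2))"
  shows "enat N \<le> morse_index G p W lam \<rho> u"
proof -
  let ?u = "on_edge G u e" and ?I = "edge_interval G e"
  note D = edge_solutionD[OF es]
  define V where "V = (\<lambda>x. W\<^sub>e x + lam - (p - 1) * \<rho>\<^sub>e x * \<bar>?u x\<bar> powr (p - 2))"
  have \<eta>c: "continuous_on S (\<eta> i)" for S i
    by (rule DERIV_continuous_on) (rule has_field_derivative_at_within[OF \<eta>(1)])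
  have \<eta>'c: "continuous_on S (\<eta>' i)" for S i using \<eta>(2) continuous_on_subset by blast
  show ?thesis
  proof (rule morse_index_ge[where F = "\<lambda>i x. ?u x * \<eta> i x" and F' = "\<lambda>i x. du x * \<eta> i x + ?u x * \<eta>' i x"
        and V = V and \<alpha> = \<alpha> and \<beta> = \<beta>, OF G e u L ab disj])
    show "((\<lambda>x. ?u x * \<eta> i x) has_real_derivative du x * \<eta> i x + ?u x * \<eta>' i x) (at x within {\<alpha> i..\<beta> i})"
      if "i < N" "x \<in> {\<alpha> i..\<beta> i}" for i x
    proof -
      have "(?u has_real_derivative du x) (at x within {\<alpha> i..\<beta> i})"
        using D(7) that(2) ab(2)[OF that(1)] DERIV_subset[of ?u "du x" x ?I "{\<alpha> i..\<beta> i}"]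
        unfolding second_antiderivative_on_def by blast
      from DERIV_mult[OF this has_field_derivative_at_within[OF \<eta>(1)[of i x]]]
      show ?thesis by (simp add: mult.commute add.commute)
    qed
    show "continuous_on {\<alpha> i..\<beta> i} (\<lambda>x. du x * \<eta> i x + ?u x * \<eta>' i x)" if "i < N" for i
      by (intro continuous_intros \<eta>c \<eta>'c continuous_on_subset[OF D(8) ab(2)[OF that]]
          continuous_on_subset[OF D(9) ab(2)[OF that]])
    show "AE x in lebesgue_on ?I. on_edge G W e x + lam - (p - 1) * on_edge G \<rho> e x * \<bar>?u x\<bar> powr (p - 2) = V x"
      using AE by eventually_elim (simp add: V_def)
    show "locally_integrable_on V ?I"
      using edge_solution_locally_integrable[OF es p] integrable_lebesgue_on_continuous[OF continuous_on_const, of _ _ lam]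
      unfolding locally_integrable_on_def V_def
      by (auto intro!: Bochner_Integration.integrable_add Bochner_Integration.integrable_diff simp: mult.assoc)
    show "integral {\<alpha> i..\<beta> i} (\<lambda>x. (du x * \<eta> i x + ?u x * \<eta>' i x)\<^sup>2 + V x * (?u x * \<eta> i x)\<^sup>2) < 0" if "i < N" for i
      using morse_integral_eq(1)[OF es p less_imp_le[OF ab(1)[OF that]] ab(2)[OF that] \<eta> ends(1)[OF that] ends(2)[OF that]]
        Q[OF that] unfolding V_def by simp
  qed (use ends in auto)
qed

text \<open>With \<open>\<eta> = 1\<close> between two zeros the gradient term is absent, and the
  form is minus \<open>p - 2\<close> times the nonlinear energy of the nodal interval.\<close>

lemma morse_index_ge_nodal_intervals:
  fixes G :: "('v, 'e) metric_graph" and \<alpha> \<beta> :: "nat \<Rightarrow> real"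
  assumes G: "G \<in> graphs_fin" and e: "e \<in> edges G" and u: "u \<in> H1 G"
    and L: "W \<in> Linfty G" "\<rho> \<in> Linfty G" and p: "2 < p"
    and AE: "AE x in lebesgue_on (edge_interval G e). on_edge G W e x = W\<^sub>e x"
      "AE x in lebesgue_on (edge_interval G e). on_edge G \<rho> e x = \<rho>\<^sub>e x"
    and es: "edge_solution (edge_interval G e) p lam Wbar b W\<^sub>e \<rho>\<^sub>e (on_edge G u e) du"
    and a: "0 < a" "\<And>x. a \<le> \<rho>\<^sub>e x"
    and ab: "\<And>i. i < N \<Longrightarrow> \<alpha> i < \<beta> i" "\<And>i. i < N \<Longrightarrow> {\<alpha> i..\<beta> i} \<subseteq> edge_interval G e"
    and disj: "\<And>i j. i < N \<Longrightarrow> j < N \<Longrightarrow> i \<noteq> j \<Longrightarrow> {\<alpha> i<..<\<beta> i} \<inter> {\<alpha> j<..<\<beta> j} = {}"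
    and ends: "\<And>i. i < N \<Longrightarrow> on_edge G u e (\<alpha> i) = 0" "\<And>i. i < N \<Longrightarrow> on_edge G u e (\<beta> i) = 0"
    and nz: "\<And>i. i < N \<Longrightarrow> \<exists>x\<in>{\<alpha> i<..<\<beta> i}. on_edge G u e x \<noteq> 0"
  shows "enat N \<le> morse_index G p W lam \<rho> u"
proof (rule morse_index_ge_multiples[where \<eta> = "\<lambda>i x. 1" and \<eta>' = "\<lambda>i x. 0" and \<alpha> = \<alpha> and \<beta> = \<beta>, OF G e u L p AE es ab disj])
  let ?u = "on_edge G u e" and ?I = "edge_interval G e"
  note D = edge_solutionD[OF es]
  fix i assume i: "i < N"
  have ii: "(\<lambda>x. \<rho>\<^sub>e x * \<bar>?u x\<bar> powr (p - 2) * ((?u x)\<^sup>2 * 1\<^sup>2)) integrable_on {\<alpha> i..\<beta> i}"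
    by (rule morse_integral_eq(2)[where \<eta> = "\<lambda>x. 1" and \<eta>' = "\<lambda>x. 0", OF es p less_imp_le[OF ab(1)[OF i]] ab(2)[OF i]])
      (use ends i in auto)
  have uc: "continuous_on {\<alpha> i..\<beta> i} ?u" by (rule continuous_on_subset[OF D(9) ab(2)[OF i]])
  have c: "continuous_on {\<alpha> i..\<beta> i} (\<lambda>x. a * \<bar>?u x\<bar> powr (p - 2) * (?u x)\<^sup>2)"
    by (intro continuous_intros continuous_on_powr' uc) (use p in auto)
  \<comment> \<open>Strict positivity is shown for the continuous lower bound with \<open>a\<close>
    in place of \<open>\<rho>\<close>, since a continuous nonnegative function with zero integral
    vanishes at every point.\<close>
  have "integral {\<alpha> i..\<beta> i} (\<lambda>x. a * \<bar>?u x\<bar> powr (p - 2) * (?u x)\<^sup>2) \<noteq> 0"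
  proof
    assume "integral {\<alpha> i..\<beta> i} (\<lambda>x. a * \<bar>?u x\<bar> powr (p - 2) * (?u x)\<^sup>2) = 0"
    then have "a * \<bar>?u x\<bar> powr (p - 2) * (?u x)\<^sup>2 = 0" if "x \<in> {\<alpha> i..\<beta> i}" for x
      using integral_eq_0_iff[OF c] ab(1)[OF i] a(1) that by auto
    then show False using nz[OF i] a(1) by fastforce
  qed
  moreover have "0 \<le> integral {\<alpha> i..\<beta> i} (\<lambda>x. a * \<bar>?u x\<bar> powr (p - 2) * (?u x)\<^sup>2)"
    by (rule Henstock_Kurzweil_Integration.integral_nonneg) (use c a(1) in \<open>auto intro: integrable_continuous_real\<close>)
  moreover have "integral {\<alpha> i..\<beta> i} (\<lambda>x. a * \<bar>?u x\<bar> powr (p - 2) * (?u x)\<^sup>2)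
      \<le> integral {\<alpha> i..\<beta> i} (\<lambda>x. \<rho>\<^sub>e x * \<bar>?u x\<bar> powr (p - 2) * ((?u x)\<^sup>2 * 1\<^sup>2))"
  proof (rule integral_le[OF integrable_continuous_real[OF c] ii])
    fix x
    have "a * (\<bar>?u x\<bar> powr (p - 2) * (?u x)\<^sup>2) \<le> \<rho>\<^sub>e x * (\<bar>?u x\<bar> powr (p - 2) * (?u x)\<^sup>2)"
      using a(2) by (intro mult_right_mono) auto
    then show "a * \<bar>?u x\<bar> powr (p - 2) * (?u x)\<^sup>2 \<le> \<rho>\<^sub>e x * \<bar>?u x\<bar> powr (p - 2) * ((?u x)\<^sup>2 * 1\<^sup>2)"
      by (simp add: mult.assoc)
  qed
  ultimately have "0 < integral {\<alpha> i..\<beta> i} (\<lambda>x. \<rho>\<^sub>e x * \<bar>?u x\<bar> powr (p - 2) * ((?u x)\<^sup>2 * 1\<^sup>2))" by linarith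
  then show "integral {\<alpha> i..\<beta> i} (\<lambda>x. (?u x)\<^sup>2 * 0\<^sup>2) <
      (p - 2) * integral {\<alpha> i..\<beta> i} (\<lambda>x. \<rho>\<^sub>e x * \<bar>?u x\<bar> powr (p - 2) * ((?u x)\<^sup>2 * 1\<^sup>2))"
    using p by simp
qed (use ends in auto)

text \<open>A parabola of half-width \<open>d\<close> takes the place of the tent, since a
  continuous derivative is required. Its slope is at most \<open>2 / d\<close>, so the gradient
  costs at most \<open>2 d M^2 (2 / d)^2 = 8 M^2 / d\<close>. The gain is counted on the
  \<open>\<delta>\<close>-neighbourhood of the peak only, where the slope bound \<open>S\<close>
  keeps \<open>|u|\<close> above \<open>m / 2\<close>.\<close>

lemma morse_index_ge_separated_peaks:
  fixes G :: "('v, 'e) metric_graph" and y :: "nat \<Rightarrow> real"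
  assumes G: "G \<in> graphs_fin" and e: "e \<in> edges G" and u: "u \<in> H1 G"
    and L: "W \<in> Linfty G" "\<rho> \<in> Linfty G" and p: "2 < p"
    and AE: "AE x in lebesgue_on (edge_interval G e). on_edge G W e x = W\<^sub>e x"
      "AE x in lebesgue_on (edge_interval G e). on_edge G \<rho> e x = \<rho>\<^sub>e x"
    and es: "edge_solution (edge_interval G e) p lam Wbar b W\<^sub>e \<rho>\<^sub>e (on_edge G u e) du"
    and a: "0 < a" "\<And>x. a \<le> \<rho>\<^sub>e x"
    and y: "\<And>i. i < N \<Longrightarrow> {y i - d..y i + d} \<subseteq> edge_interval G e" "\<And>i. i < N \<Longrightarrow> m \<le> \<bar>on_edge G u e (y i)\<bar>"
    and sep: "\<And>i j. i < N \<Longrightarrow> j < N \<Longrightarrow> i \<noteq> j \<Longrightarrow> 2 * d \<le> \<bar>y i - y j\<bar>"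
    and M: "\<And>x. x \<in> edge_interval G e \<Longrightarrow> \<bar>on_edge G u e x\<bar> \<le> M"
    and Du: "\<And>x. x \<in> edge_interval G e \<Longrightarrow> \<bar>du x\<bar> \<le> S"
    and pos: "0 < m" "0 < \<delta>" "2 * \<delta> \<le> d" "S * \<delta> \<le> m / 2"
    and big: "8 * M\<^sup>2 / d < (p - 2) * (a * (m / 2) powr (p - 2) * (m / 2)\<^sup>2 * \<delta>)"
  shows "enat N \<le> morse_index G p W lam \<rho> u"
proof (rule morse_index_ge_multiples[where \<eta> = "\<lambda>i x. 1 - ((x - y i) / d)\<^sup>2" and \<eta>' = "\<lambda>i x. - 2 * (x - y i) / d\<^sup>2"
      and \<alpha> = "\<lambda>i. y i - d" and \<beta> = "\<lambda>i. y i + d", OF G e u L p AE es])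
  let ?u = "on_edge G u e" and ?I = "edge_interval G e"
  note D = edge_solutionD[OF es]
  have d: "0 < d" using pos by linarith
  show "y i - d < y i + d" for i using d by simp
  show "{y i - d..y i + d} \<subseteq> ?I" if "i < N" for i using y(1)[OF that] .
  show "{y i - d<..<y i + d} \<inter> {y j - d<..<y j + d} = {}" if "i < N" "j < N" "i \<noteq> j" for i j
    using sep[OF that] by auto
  show \<eta>D: "((\<lambda>x. 1 - ((x - y i) / d)\<^sup>2) has_real_derivative - 2 * (x - y i) / d\<^sup>2) (at x)" for i x
    using d by (auto intro!: derivative_eq_intros simp: power2_eq_square field_simps)
  show \<eta>c: "continuous_on UNIV (\<lambda>x. - 2 * (x - y i) / d\<^sup>2)" for i
    using d by (auto intro!: continuous_intros)
  show e1: "?u (y i - d) * (1 - ((y i - d - y i) / d)\<^sup>2) = 0" for i using d by simp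
  show e2: "?u (y i + d) * (1 - ((y i + d - y i) / d)\<^sup>2) = 0" for i using d by simp
  fix i assume i: "i < N"
  define \<alpha> \<beta> where "\<alpha> = y i - d" and "\<beta> = y i + d"
  define \<eta> where "\<eta> = (\<lambda>x. 1 - ((x - y i) / d)\<^sup>2)"
  define \<eta>' where "\<eta>' = (\<lambda>x. - 2 * (x - y i) / d\<^sup>2)"
  define g where "g = (\<lambda>x. \<rho>\<^sub>e x * \<bar>?u x\<bar> powr (p - 2) * ((?u x)\<^sup>2 * (\<eta> x)\<^sup>2))"
  have ab: "\<alpha> < \<beta>" "{\<alpha>..\<beta>} \<subseteq> ?I" using d y(1)[OF i] by (auto simp: \<alpha>_def \<beta>_def)
  have gi: "g integrable_on {\<alpha>..\<beta>}"
    unfolding g_def \<eta>_def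
    by (rule morse_integral_eq(2)[OF es p less_imp_le[OF ab(1)] ab(2) \<eta>D \<eta>c])
      (use e1 e2 in \<open>simp_all only: \<alpha>_def \<beta>_def\<close>)
  have g0: "0 \<le> g x" for x unfolding g_def using D(5)[of x] by simp
  have uc: "continuous_on {\<alpha>..\<beta>} ?u" by (rule continuous_on_subset[OF D(9) ab(2)])
  have "integral {\<alpha>..\<beta>} (\<lambda>x. (?u x)\<^sup>2 * (\<eta>' x)\<^sup>2) \<le> integral {\<alpha>..\<beta>} (\<lambda>x. M\<^sup>2 * (2 / d)\<^sup>2)"
  proof (rule integral_le)
    show "(\<lambda>x. (?u x)\<^sup>2 * (\<eta>' x)\<^sup>2) integrable_on {\<alpha>..\<beta>}"
      by (intro integrable_continuous_real continuous_intros uc continuous_on_subset[OF \<eta>c[of i, folded \<eta>'_def]]) simp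
    fix x assume x: "x \<in> {\<alpha>..\<beta>}"
    have "\<bar>\<eta>' x\<bar> = 2 * \<bar>x - y i\<bar> / d\<^sup>2"
      by (simp only: \<eta>'_def abs_divide abs_power2 abs_mult abs_minus_cancel abs_numeral)
    also have "\<dots> \<le> 2 * d / d\<^sup>2" using x d by (intro divide_right_mono) (auto simp: \<alpha>_def \<beta>_def)
    also have "\<dots> = 2 / d" using d by (simp add: power2_eq_square)
    finally have "(\<eta>' x)\<^sup>2 \<le> (2 / d)\<^sup>2" using power_mono[of "\<bar>\<eta>' x\<bar>" "2 / d" 2] by simp
    moreover have "x \<in> ?I" using x ab(2) by blast
    then have "(?u x)\<^sup>2 \<le> M\<^sup>2" using M[of x] power_mono[of "\<bar>?u x\<bar>" M 2] by simp
    ultimately show "(?u x)\<^sup>2 * (\<eta>' x)\<^sup>2 \<le> M\<^sup>2 * (2 / d)\<^sup>2" by (intro mult_mono) auto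
  qed (rule integrable_const_ivl)
  also have "\<dots> = (2 * d) * (M\<^sup>2 * (2 / d)\<^sup>2)" using ab(1) by (simp add: \<alpha>_def \<beta>_def)
  also have "\<dots> = 8 * M\<^sup>2 / d" using d by (simp add: power2_eq_square)
  also note big
  also have "(p - 2) * (a * (m / 2) powr (p - 2) * (m / 2)\<^sup>2 * \<delta>) \<le> (p - 2) * integral {\<alpha>..\<beta>} g"
  proof (rule mult_left_mono)
    have sub: "{y i - \<delta>..y i + \<delta>} \<subseteq> {\<alpha>..\<beta>}" using pos by (auto simp: \<alpha>_def \<beta>_def)
    have gd: "g integrable_on {y i - \<delta>..y i + \<delta>}" by (rule integrable_on_subinterval[OF gi sub])
    \<comment> \<open>On the inner interval \<open>\<eta>\<close> is at least \<open>3 / 4\<close>,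
      so \<open>\<eta>^2\<close> is at least \<open>1 / 2\<close>; together with the length
      \<open>2 \<delta>\<close> this gives the factor \<open>\<delta>\<close> in
      \<open>big\<close>.\<close>
    define k where "k = a * (m / 2) powr (p - 2) * ((m / 2)\<^sup>2 * (1 / 2))"
    have "integral {y i - \<delta>..y i + \<delta>} (\<lambda>x. k) \<le> integral {y i - \<delta>..y i + \<delta>} g"
    proof (rule integral_le[OF integrable_const_ivl gd])
      fix x assume x: "x \<in> {y i - \<delta>..y i + \<delta>}"
      have inI: "z \<in> ?I" if "z \<in> {y i - \<delta>..y i + \<delta>}" for z using that sub ab(2) by blast
      have ux: "m / 2 \<le> \<bar>?u x\<bar>"
      proof -
        have lip: "\<bar>?u t - ?u s\<bar> \<le> m / 2" if st: "s \<in> {y i - \<delta>..y i + \<delta>}" "t \<in> {y i - \<delta>..y i + \<delta>}" "s \<le> t" "t - s \<le> \<delta>" for s t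
        proof (cases "s < t")
          case True
          have "second_antiderivative_on {s..t} ?u du (\<lambda>x. (W\<^sub>e x + lam - \<rho>\<^sub>e x * \<bar>?u x\<bar> powr (p - 2)) * ?u x)"
            by (rule second_antiderivative_on_subset[OF D(7)]) (use inI st in auto)
          then obtain w where w: "w \<in> {s..t}" "?u t - ?u s = du w * (t - s)"
            using second_antiderivative_on_MVT[OF _ True] by blast
          have "w \<in> ?I" by (rule inI) (use w st in auto)
          then have "\<bar>du w\<bar> * (t - s) \<le> S * \<delta>" using Du st by (intro mult_mono) (auto intro: order_trans[OF abs_ge_zero])
          then show ?thesis using w(2) True pos(4) by (simp add: abs_mult)
        qed (use st pos(1) in auto)
        have "\<bar>?u x - ?u (y i)\<bar> \<le> m / 2"
          using lip[of x "y i"] lip[of "y i" x] x pos(2) by (cases "x \<le> y i") (auto simp: abs_minus_commute)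
        then show ?thesis using y(2)[OF i] by linarith
      qed
      have half: "\<bar>(x - y i) / d\<bar> \<le> 1 / 2"
      proof -
        have "\<bar>x - y i\<bar> \<le> \<delta>" using x by auto
        then show ?thesis using pos(3) d by (simp add: abs_divide divide_le_eq)
      qed
      have "((x - y i) / d)\<^sup>2 \<le> (1 / 2)\<^sup>2"
        using power_mono[OF half abs_ge_zero, of 2] by (simp only: power2_abs)
      then have "3 / 4 \<le> \<eta> x" by (simp add: \<eta>_def power2_eq_square)
      then have "(3 / 4)\<^sup>2 \<le> (\<eta> x)\<^sup>2" by (intro power_mono) auto
      then have \<eta>x: "1 / 2 \<le> (\<eta> x)\<^sup>2" by (simp add: power2_eq_square)
      have "(m / 2) powr (p - 2) \<le> \<bar>?u x\<bar> powr (p - 2)" using ux pos(1) p by (intro powr_mono2) auto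
      moreover have "(m / 2)\<^sup>2 \<le> (?u x)\<^sup>2" using ux pos(1) power_mono[of "m / 2" "\<bar>?u x\<bar>" 2] by simp
      ultimately show "k \<le> g x"
        unfolding k_def g_def using a(1) a(2)[of x] \<eta>x pos(1) D(5)[of x] by (intro mult_mono) auto
    qed
    also have "\<dots> \<le> integral {\<alpha>..\<beta>} g" by (rule integral_subset_le[OF sub gd gi]) (use g0 in auto)
    finally show "a * (m / 2) powr (p - 2) * (m / 2)\<^sup>2 * \<delta> \<le> integral {\<alpha>..\<beta>} g"
      using pos(2) by (simp add: k_def mult.commute mult.left_commute)
  qed (use p in simp)
  finally show "integral {y i - d..y i + d} (\<lambda>x. (?u x)\<^sup>2 * (- 2 * (x - y i) / d\<^sup>2)\<^sup>2) < (p - 2) *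
      integral {y i - d..y i + d} (\<lambda>x. \<rho>\<^sub>e x * \<bar>?u x\<bar> powr (p - 2) * ((?u x)\<^sup>2 * (1 - ((x - y i) / d)\<^sup>2)\<^sup>2))"
    unfolding g_def \<eta>_def \<eta>'_def \<alpha>_def \<beta>_def .
qed

text \<open>Absorption of a sublinear power: if \<open>B \<le> x powr (1 - s)\<close>, the power
  term is at most \<open>x\<close>; otherwise \<open>x\<close> lies below
  \<open>B powr (1 / (1 - s))\<close>, the point where the two terms are equal, and the power is
  bounded by its value there.\<close>

lemma sublinear_powr_bound:
  fixes B s x :: real
  assumes "0 < B" "0 \<le> s" "s < 1" "0 < x"
  shows "B * x powr s - x \<le> B powr (1 / (1 - s))"
proof (cases "B \<le> x powr (1 - s)")
  case True
  then have "B * x powr s \<le> x powr (1 - s) * x powr s" by (intro mult_right_mono) auto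
  also have "\<dots> = x" using assms by (simp flip: powr_add)
  finally have "B * x powr s - x \<le> 0" by simp
  also have "0 \<le> B powr (1 / (1 - s))" by simp
  finally show ?thesis .
next
  case False
  define y where "y = B powr (1 / (1 - s))"
  have yB: "y powr (1 - s) = B" using assms by (simp add: y_def powr_powr)
  have "y > 0" using assms by (simp add: y_def)
  have "x < y"
  proof (rule ccontr)
    assume "\<not> x < y"
    then have "y powr (1 - s) \<le> x powr (1 - s)" using \<open>y > 0\<close> assms by (intro powr_mono2) auto
    then show False using False yB by simp
  qed
  then have "x powr s \<le> y powr s" using assms by (intro powr_mono2) auto
  then have "B * x powr s \<le> y powr (1 - s) * y powr s" using yB assms by simp
  also have "\<dots> = y" using \<open>y > 0\<close> by (simp flip: powr_add)
  finally show ?thesis using assms by (simp add: y_def)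
qed

text \<open>\<open>k\<close> may be negative: a peak in the right half of its window is followed to
  the left. Reversing the orientation changes the sign of the increment and of \<open>k\<close>
  together, so one formula covers both directions.\<close>

lemma has_integral_affine_substitution:
  fixes h :: "real \<Rightarrow> real"
  assumes k: "k \<noteq> 0" and st: "s \<le> t"
    and h: "\<And>x y. x \<in> J \<Longrightarrow> y \<in> J \<Longrightarrow> x \<le> y \<Longrightarrow> (h has_integral (H y - H x)) {x..y}"
    and J: "x0 + k * s \<in> J" "x0 + k * t \<in> J"
  shows "((\<lambda>y. k * h (x0 + k * y)) has_integral (H (x0 + k * t) - H (x0 + k * s))) {s..t}"
proof -
  let ?A = "{min (x0 + k * s) (x0 + k * t)..max (x0 + k * s) (x0 + k * t)}"
  have "?A = (\<lambda>y. k * y + x0) ` {s..t}"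
  proof (cases "0 \<le> k")
    case True
    then have "k * s \<le> k * t" using st by (rule mult_left_mono[rotated])
    then show ?thesis using True st
      by (simp add: image_affinity_atLeastAtMost min_def max_def add.commute[of x0 "k * s"] add.commute[of x0 "k * t"])
  next
    case False
    then have "k * t \<le> k * s" using st by (intro mult_left_mono_neg) auto
    then show ?thesis using False st
      by (simp add: image_affinity_atLeastAtMost min_def max_def add.commute[of x0 "k * s"] add.commute[of x0 "k * t"])
  qed
  moreover have "(1 / k) *\<^sub>R (k * y + x0) + - ((1 / k) *\<^sub>R x0) = y" for y
    using k by (simp add: field_simps)
  ultimately have img: "(\<lambda>x. (1 / k) *\<^sub>R x + - ((1 / k) *\<^sub>R x0)) ` ?A = {s..t}"
    by (simp only: image_image image_ident)
  have "(h has_integral (H (max (x0 + k * s) (x0 + k * t)) - H (min (x0 + k * s) (x0 + k * t))))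
      (cbox (min (x0 + k * s) (x0 + k * t)) (max (x0 + k * s) (x0 + k * t)))"
    unfolding box_real by (rule h) (use J in \<open>auto simp: min_def max_def\<close>)
  from has_integral_affinity[OF this k, of x0]
  have "((\<lambda>y. h (k * y + x0)) has_integral
      (1 / \<bar>k\<bar>) * (H (max (x0 + k * s) (x0 + k * t)) - H (min (x0 + k * s) (x0 + k * t)))) {s..t}"
    unfolding box_real img by simp
  from has_integral_mult_right[OF this, of k]
  have "((\<lambda>y. k * h (k * y + x0)) has_integral
      k * ((1 / \<bar>k\<bar>) * (H (max (x0 + k * s) (x0 + k * t)) - H (min (x0 + k * s) (x0 + k * t))))) {s..t}" .
  moreover have "k * ((1 / \<bar>k\<bar>) * (H (max (x0 + k * s) (x0 + k * t)) - H (min (x0 + k * s) (x0 + k * t))))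
      = H (x0 + k * t) - H (x0 + k * s)"
  proof (cases "0 < k")
    case True
    then have "k * s \<le> k * t" using st by simp
    then show ?thesis using True by (simp add: min_def max_def)
  next
    case False
    then have "k < 0" using k by simp
    then have "k * t \<le> k * s" using st by simp
    then show ?thesis using \<open>k < 0\<close> by (auto simp: min_def max_def)
  qed
  ultimately show ?thesis by (simp add: add.commute)
qed

lemma second_antiderivative_on_affine:
  assumes v: "second_antiderivative_on J u du h" and k: "k \<noteq> 0"
    and J: "\<And>y. y \<in> {0..R} \<Longrightarrow> x0 + k * y \<in> J"
  shows "second_antiderivative_on {0..R} (\<lambda>y. u (x0 + k * y) / M) (\<lambda>y. k * du (x0 + k * y) / M)
    (\<lambda>y. k\<^sup>2 * h (x0 + k * y) / M)"
  unfolding second_antiderivative_on_def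
proof (intro conjI ballI impI)
  fix t assume t: "t \<in> {0..R}"
  have g: "((\<lambda>y. x0 + k * y) has_real_derivative k) (at t within {0..R})"
    by (auto intro!: derivative_eq_intros)
  have "(u has_real_derivative du (x0 + k * t)) (at (x0 + k * t) within (\<lambda>y. x0 + k * y) ` {0..R})"
    by (rule DERIV_subset[of _ _ _ J]) (use v t J in \<open>auto simp: second_antiderivative_on_def\<close>)
  from DERIV_image_chain[OF this g]
  have "((\<lambda>y. u (x0 + k * y)) has_real_derivative du (x0 + k * t) * k) (at t within {0..R})"
    by (simp add: comp_def)
  from DERIV_cdivide[OF this, of M]
  show "((\<lambda>y. u (x0 + k * y) / M) has_real_derivative k * du (x0 + k * t) / M) (at t within {0..R})"
    by (simp add: mult.commute)
next
  fix s t assume st: "s \<in> {0..R}" "t \<in> {0..R}" "s \<le> t"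
  have "((\<lambda>y. k * h (x0 + k * y)) has_integral (du (x0 + k * t) - du (x0 + k * s))) {s..t}"
    by (rule has_integral_affine_substitution[OF k st(3) _ J[OF st(1)] J[OF st(2)]])
      (use v in \<open>auto simp: second_antiderivative_on_def\<close>)
  from has_integral_mult_right[OF this, of "k / M"]
  show "((\<lambda>y. k\<^sup>2 * h (x0 + k * y) / M) has_integral (k * du (x0 + k * t) / M - k * du (x0 + k * s) / M)) {s..t}"
    by (simp add: power2_eq_square right_diff_distrib diff_divide_distrib mult.assoc)
qed

text \<open>Let \<open>v y = u (x0 + k y) / M\<close> with \<open>|k| = 1 / \<omega>\<close> and
  \<open>\<omega>^2 = M powr (p - 2)\<close>. The linear coefficient is divided by
  \<open>\<omega>^2\<close>, hence at most \<open>\<epsilon>\<close>, while \<open>\<rho>\<close>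
  keeps its size, so \<open>v\<close> is an oscillator that starts at height at least
  \<open>1 / 2\<close>. Its zeros bound \<open>N\<close> nodal intervals. Only the height
  \<open>M / 2\<close> is asked for at \<open>x0\<close> because a point close to the supremum is
  easier to guarantee than a maximum.\<close>

lemma morse_index_ge_high_peak:
  fixes G :: "('v, 'e) metric_graph"
  assumes G: "G \<in> graphs_fin" and e: "e \<in> edges G" and u: "u \<in> H1 G"
    and L: "W \<in> Linfty G" "\<rho> \<in> Linfty G" and p: "2 < p"
    and AE: "AE x in lebesgue_on (edge_interval G e). on_edge G W e x = W\<^sub>e x"
      "AE x in lebesgue_on (edge_interval G e). on_edge G \<rho> e x = \<rho>\<^sub>e x"
    and es: "edge_solution (edge_interval G e) p lam Wbar b W\<^sub>e \<rho>\<^sub>e (on_edge G u e) du"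
    and a: "0 < a" "\<And>x. a \<le> \<rho>\<^sub>e x"
    and osc: "\<And>v dv g y. oscillator a b (p - 2) \<epsilon> {y..y + R} v dv g \<Longrightarrow> 1 / 2 \<le> \<bar>v y\<bar> \<Longrightarrow>
       \<exists>z. (\<forall>i\<le>N. y < z i \<and> z i \<le> y + R \<and> v (z i) = 0) \<and>
           (\<forall>i<N. z i < z (Suc i) \<and> (\<exists>x. z i < x \<and> x < z (Suc i) \<and> v x \<noteq> 0))"
    and R: "0 < R"
    and M: "0 < M" "\<And>x. x \<in> edge_interval G e \<Longrightarrow> \<bar>on_edge G u e x\<bar> \<le> M"
    and x0: "x0 \<in> {s..s + l}" "{s..s + l} \<subseteq> edge_interval G e" "M / 2 \<le> \<bar>on_edge G u e x0\<bar>" "0 < l"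
    and big: "Wbar + \<bar>lam\<bar> \<le> \<epsilon> * M powr (p - 2)" "4 * R\<^sup>2 \<le> l\<^sup>2 * M powr (p - 2)"
  shows "enat N \<le> morse_index G p W lam \<rho> u"
proof -
  let ?u = "on_edge G u e" and ?I = "edge_interval G e"
  note D = edge_solutionD[OF es]
  define \<omega> where "\<omega> = sqrt (M powr (p - 2))"
  have \<omega>: "0 < \<omega>" "\<omega>\<^sup>2 = M powr (p - 2)" using M(1) by (auto simp: \<omega>_def)
  have R\<omega>: "2 * R \<le> l * \<omega>"
  proof (rule power2_le_imp_le)
    show "(2 * R)\<^sup>2 \<le> (l * \<omega>)\<^sup>2" using big(2) \<omega>(2) by (simp add: power_mult_distrib)
  qed (use x0(4) \<omega>(1) in simp)
  then have R2: "R / \<omega> \<le> l / 2" using \<omega>(1) by (simp add: field_simps)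
  \<comment> \<open>At least half of the window lies on one side of \<open>x0\<close>. The sign of
    \<open>k\<close> points to that side, and \<open>R / \<omega> \<le> l / 2\<close> keeps the
    rescaled interval inside the window.\<close>
  define k where "k = (if x0 \<le> s + l / 2 then 1 / \<omega> else - (1 / \<omega>))"
  have k: "k \<noteq> 0" "k\<^sup>2 = 1 / \<omega>\<^sup>2" "\<bar>k\<bar> = 1 / \<omega>" using \<omega>(1) by (auto simp: k_def power2_eq_square)
  have kI: "x0 + k * y \<in> ?I" if y: "y \<in> {0..R}" for y
  proof -
    have "0 \<le> y / \<omega>" using y \<omega>(1) by auto
    moreover have "y / \<omega> \<le> R / \<omega>" using y \<omega>(1) by (intro divide_right_mono) auto
    then have "y / \<omega> \<le> l / 2" using R2 by linarith
    moreover have "k * y = (if x0 \<le> s + l / 2 then y / \<omega> else - (y / \<omega>))" by (simp add: k_def)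
    moreover have "s \<le> x0" "x0 \<le> s + l" using x0(1) by auto
    ultimately have "s \<le> x0 + k * y" "x0 + k * y \<le> s + l" by (smt (verit) field_sum_of_halves)+
    then have "x0 + k * y \<in> {s..s + l}" by simp
    then show ?thesis using x0(2) by blast
  qed
  define v where "v = (\<lambda>y. ?u (x0 + k * y) / M)"
  define dv where "dv = (\<lambda>y. k * du (x0 + k * y) / M)"
  define g where "g = (\<lambda>y. (W\<^sub>e (x0 + k * y) + lam) / \<omega>\<^sup>2 - \<rho>\<^sub>e (x0 + k * y) * \<bar>v y\<bar> powr (p - 2))"
  have uv: "\<bar>?u (x0 + k * y)\<bar> powr (p - 2) = \<omega>\<^sup>2 * \<bar>v y\<bar> powr (p - 2)" for y
  proof -
    have "\<bar>?u (x0 + k * y)\<bar> = M * \<bar>v y\<bar>" using M(1) by (simp add: v_def)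
    then show ?thesis using M(1) \<omega>(2) by (simp add: powr_mult)
  qed
  have "oscillator a b (p - 2) \<epsilon> {0..0 + R} v dv g"
    unfolding oscillator_def
  proof (intro conjI ballI)
    have "second_antiderivative_on {0..R} v dv
      (\<lambda>y. k\<^sup>2 * ((W\<^sub>e (x0 + k * y) + lam - \<rho>\<^sub>e (x0 + k * y) * \<bar>?u (x0 + k * y)\<bar> powr (p - 2)) * ?u (x0 + k * y)) / M)"
      unfolding v_def dv_def by (rule second_antiderivative_on_affine[OF D(7) k(1) kI])
    moreover have "k\<^sup>2 * ((W\<^sub>e (x0 + k * y) + lam - \<rho>\<^sub>e (x0 + k * y) * \<bar>?u (x0 + k * y)\<bar> powr (p - 2)) * ?u (x0 + k * y)) / M
        = g y * v y" for y
    proof -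
      have "k\<^sup>2 * (W\<^sub>e (x0 + k * y) + lam - \<rho>\<^sub>e (x0 + k * y) * \<bar>?u (x0 + k * y)\<bar> powr (p - 2)) = g y"
        unfolding uv g_def k(2) using \<omega>(1) by (simp add: field_simps)
      then show ?thesis by (simp add: v_def)
    qed
    ultimately show "second_antiderivative_on {0..0 + R} v dv (\<lambda>y. g y * v y)" by simp
    fix y assume "y \<in> {0..0 + R}"
    then have yI: "x0 + k * y \<in> ?I" using kI by simp
    show "\<bar>v y\<bar> \<le> 1" using M(2)[OF yI] M(1) by (simp add: v_def)
    have "\<bar>(W\<^sub>e (x0 + k * y) + lam) / \<omega>\<^sup>2\<bar> = \<bar>W\<^sub>e (x0 + k * y) + lam\<bar> / \<omega>\<^sup>2" by (simp only: abs_divide abs_power2)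
    also have "\<dots> \<le> (\<epsilon> * \<omega>\<^sup>2) / \<omega>\<^sup>2"
      using D(4)[of "x0 + k * y"] big(1) \<omega>(2) by (intro divide_right_mono) auto
    also have "\<dots> = \<epsilon>" using \<omega>(1) by simp
    finally have 1: "\<bar>(W\<^sub>e (x0 + k * y) + lam) / \<omega>\<^sup>2\<bar> \<le> \<epsilon>" .
    have 2: "a * \<bar>v y\<bar> powr (p - 2) \<le> \<rho>\<^sub>e (x0 + k * y) * \<bar>v y\<bar> powr (p - 2)"
      "\<rho>\<^sub>e (x0 + k * y) * \<bar>v y\<bar> powr (p - 2) \<le> b * \<bar>v y\<bar> powr (p - 2)"
      using a(2) D(6) by (auto intro!: mult_right_mono)
    show "g y \<le> \<epsilon> - a * \<bar>v y\<bar> powr (p - 2)" "- \<epsilon> - b * \<bar>v y\<bar> powr (p - 2) \<le> g y"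
      unfolding g_def using 1 2 by linarith+
  qed
  moreover have "1 / 2 \<le> \<bar>v 0\<bar>" using x0(3) M(1) by (simp add: v_def field_simps)
  ultimately obtain z where z: "\<And>i. i \<le> N \<Longrightarrow> 0 < z i \<and> z i \<le> R \<and> v (z i) = 0"
    "\<And>i. i < N \<Longrightarrow> z i < z (Suc i) \<and> (\<exists>x. z i < x \<and> x < z (Suc i) \<and> v x \<noteq> 0)"
    using osc[of 0 v dv g] by auto
  have mono: "z i \<le> z j" if "i \<le> j" "j \<le> N" for i j
    using that
  proof (induction j)
    case (Suc j)
    then show ?case using z(2)[of j] by (cases "i = Suc j") auto
  qed simp
  define t where "t = (\<lambda>i. x0 + k * z i)"
  have u0: "?u (t i) = 0" if "i \<le> N" for i using z(1)[OF that] M(1) by (simp add: v_def t_def)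
  have tI: "t i \<in> ?I" if "i \<le> N" for i unfolding t_def by (rule kI) (use z(1)[OF that] in auto)
  show ?thesis
  \<comment> \<open>For negative \<open>k\<close> the zeros \<open>t i\<close> occur in decreasing
    order, hence the minimum and maximum.\<close>
  proof (rule morse_index_ge_nodal_intervals[where \<alpha> = "\<lambda>i. min (t i) (t (Suc i))" and \<beta> = "\<lambda>i. max (t i) (t (Suc i))",
        OF G e u L p AE es a])
    show "min (t i) (t (Suc i)) < max (t i) (t (Suc i))" if "i < N" for i
    proof -
      have "z i \<noteq> z (Suc i)" using z(2)[OF that] by auto
      then have "t i \<noteq> t (Suc i)" using k(1) by (simp add: t_def)
      then show ?thesis by (auto simp: min_def max_def)
    qed
    show "{min (t i) (t (Suc i))..max (t i) (t (Suc i))} \<subseteq> ?I" if "i < N" for i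
    proof -
      have t: "t i \<in> ?I" "t (Suc i) \<in> ?I" using tI that by simp_all
      then have "max (t i) (t (Suc i)) \<in> ?I" by (simp add: max_def)
      then have "{0..max (t i) (t (Suc i))} \<subseteq> ?I" by (rule closed_ray_or_segmentD(6)[OF D(1)])
      moreover have "0 \<le> min (t i) (t (Suc i))" using t closed_ray_or_segmentD(5)[OF D(1)] by simp
      then have "{min (t i) (t (Suc i))..max (t i) (t (Suc i))} \<subseteq> {0..max (t i) (t (Suc i))}"
        unfolding atLeastatMost_subset_iff by simp
      ultimately show ?thesis by (rule order_trans[rotated])
    qed
    show "{min (t i) (t (Suc i))<..<max (t i) (t (Suc i))} \<inter> {min (t j) (t (Suc j))<..<max (t j) (t (Suc j))} = {}"
      if ij: "i < N" "j < N" "i \<noteq> j" for i j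
    proof -
      have *: "{min (t i) (t (Suc i))<..<max (t i) (t (Suc i))} \<inter> {min (t j) (t (Suc j))<..<max (t j) (t (Suc j))} = {}"
        if "i < j" "j < N" for i j
      proof -
        have zz: "z i \<le> z (Suc i)" "z (Suc i) \<le> z j" "z j \<le> z (Suc j)" using mono that by auto
        show ?thesis
        proof (cases "0 < k")
          case True
          then have "t i \<le> t (Suc i)" "t (Suc i) \<le> t j" "t j \<le> t (Suc j)" using zz by (auto simp: t_def)
          then show ?thesis by (auto simp: min_def max_def)
        next
          case False
          then have "k < 0" using k(1) by simp
          then have "t i \<ge> t (Suc i)" "t (Suc i) \<ge> t j" "t j \<ge> t (Suc j)" using zz by (auto simp: t_def)
          then show ?thesis by (auto simp: min_def max_def)
        qed
      qed
      show ?thesis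
      proof (cases "i < j")
        case False
        then have "j < i" using ij(3) by simp
        from *[OF this ij(1)] show ?thesis by (subst Int_commute)
      qed (rule *[OF _ ij(2)])
    qed
    show "?u (min (t i) (t (Suc i))) = 0" "?u (max (t i) (t (Suc i))) = 0" if "i < N" for i
      using u0[of i] u0[of "Suc i"] that by (auto simp: min_def max_def)
    show "\<exists>x\<in>{min (t i) (t (Suc i))<..<max (t i) (t (Suc i))}. ?u x \<noteq> 0" if i: "i < N" for i
    proof -
      obtain x where x: "z i < x" "x < z (Suc i)" "v x \<noteq> 0" using z(2)[OF i] by blast
      have "x0 + k * x \<in> {min (t i) (t (Suc i))<..<max (t i) (t (Suc i))}"
      proof (cases "0 < k")
        case True
        then have "k * z i < k * x" "k * x < k * z (Suc i)" using x by auto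
        then show ?thesis by (auto simp: t_def min_def max_def)
      next
        case False
        then have "k < 0" using k(1) by simp
        then have "k * z i > k * x" "k * x > k * z (Suc i)" using x by auto
        then show ?thesis by (auto simp: t_def min_def max_def)
      qed
      then show ?thesis using x(3) M(1) by (auto simp: v_def)
    qed
  qed
qed

text \<open>A separated family that cannot be enlarged comes within \<open>2 d\<close> of every
  point of \<open>V\<close> whose \<open>d\<close>-neighbourhood fits into \<open>I\<close>; the
  other points lie within \<open>d\<close> of an end of \<open>I\<close>. At most \<open>N\<close>
  intervals of length \<open>4 d\<close> and two of length \<open>d\<close> give the measure
  bound.\<close>

lemma cover_if_no_separated_family:
  fixes V :: "real set"
  assumes I: "closed_ray_or_segment I" and V: "V \<subseteq> I" and d: "0 < d"
    and none: "\<nexists>y :: nat \<Rightarrow> real. (\<forall>i<N. y i \<in> V \<and> {y i - d..y i + d} \<subseteq> I) \<and>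
      (\<forall>i<N. \<forall>j<N. i \<noteq> j \<longrightarrow> 2 * d \<le> \<bar>y i - y j\<bar>)"
  obtains C where "V \<subseteq> C" "C \<in> lmeasurable" "measure lebesgue C \<le> (4 * real N + 2) * d"
proof -
  define P where "P = (\<lambda>n. \<exists>y :: nat \<Rightarrow> real. (\<forall>i<n. y i \<in> V \<and> {y i - d..y i + d} \<subseteq> I) \<and>
      (\<forall>i<n. \<forall>j<n. i \<noteq> j \<longrightarrow> 2 * d \<le> \<bar>y i - y j\<bar>))"
  have "\<not> P N" using none by (simp add: P_def)
  \<comment> \<open>The least impossible size is positive, so its predecessor is the size of a
    family that admits no further point.\<close>
  then obtain n' where n': "n' \<le> N" "\<forall>i<n'. \<not> \<not> P i" "\<not> P n'"
    using ex_least_nat_le[of "\<lambda>n. \<not> P n" N] by blast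
  have "P 0" by (simp add: P_def)
  then obtain n where n: "n' = Suc n" using n'(3) by (cases n') auto
  then have "P n" using n'(2) by auto
  then obtain y :: "nat \<Rightarrow> real" where y: "\<And>i. i < n \<Longrightarrow> y i \<in> V \<and> {y i - d..y i + d} \<subseteq> I"
    "\<And>i j. i < n \<Longrightarrow> j < n \<Longrightarrow> i \<noteq> j \<Longrightarrow> 2 * d \<le> \<bar>y i - y j\<bar>" unfolding P_def by blast
  have near: "\<exists>i<n. \<bar>x - y i\<bar> < 2 * d" if x: "x \<in> V" "{x - d..x + d} \<subseteq> I" for x
  proof (rule ccontr)
    assume "\<not> ?thesis"
    then have far: "2 * d \<le> \<bar>x - y i\<bar>" if "i < n" for i using that by (meson not_less)
    have "P (Suc n)"
      unfolding P_def
    proof (rule exI[of _ "\<lambda>i. if i < n then y i else x"], intro conjI allI impI)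
      fix i assume "i < Suc n"
      show "(if i < n then y i else x) \<in> V" "{(if i < n then y i else x) - d..(if i < n then y i else x) + d} \<subseteq> I"
        using y(1)[of i] x by auto
      fix j assume "j < Suc n" "i \<noteq> j"
      then show "2 * d \<le> \<bar>(if i < n then y i else x) - (if j < n then y j else x)\<bar>"
        using y(2)[of i j] far[of i] far[of j] \<open>i < Suc n\<close> by (auto simp: abs_minus_commute less_Suc_eq)
    qed
    then show False using n'(3) n by simp
  qed
  \<comment> \<open>A ray has no right end; 0 is a default value, and the additional interval only
    enlarges the cover.\<close>
  define l where "l = (if I = {0..} then 0 else Sup I)"
  define C where "C = (\<Union>i<n. {y i - 2 * d..y i + 2 * d}) \<union> ({0..d} \<union> {l - d..l})"
  have "V \<subseteq> C"
  proof
    fix x assume x: "x \<in> V"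
    show "x \<in> C"
    proof (cases "{x - d..x + d} \<subseteq> I")
      case True
      then obtain i where "i < n" "\<bar>x - y i\<bar> < 2 * d" using near x by blast
      then show ?thesis unfolding C_def by (auto intro!: bexI[of _ i])
    next
      case False
      show ?thesis
      proof (cases "I = {0..}")
        case True
        then have "x < d" "0 \<le> x" using False V x by auto
        then show ?thesis by (auto simp: C_def)
      next
        case False
        then obtain l' where l': "I = {0..l'}" "0 < l'" using I by (auto simp: closed_ray_or_segment_def)
        then have "l = l'" using False by (simp add: l_def)
        moreover have "0 \<le> x" "x \<le> l'" using V x l' by auto
        moreover have "x < d \<or> l' - d < x" using \<open>\<not> {x - d..x + d} \<subseteq> I\<close> l' by auto
        ultimately show ?thesis by (auto simp: C_def)
      qed
    qed
  qed
  moreover have "C \<in> lmeasurable" unfolding C_def by (intro fmeasurable.Un fmeasurable.finite_UN) auto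
  moreover have "measure lebesgue C \<le> (4 * real N + 2) * d"
  proof -
    have "measure lebesgue C \<le> measure lebesgue (\<Union>i<n. {y i - 2 * d..y i + 2 * d}) + measure lebesgue ({0..d} \<union> {l - d..l})"
      unfolding C_def by (rule measure_Un_le) auto
    also have "measure lebesgue (\<Union>i<n. {y i - 2 * d..y i + 2 * d}) \<le> (\<Sum>i<n. measure lebesgue {y i - 2 * d..y i + 2 * d})"
      by (rule measure_UNION_le) auto
    also have "measure lebesgue ({0..d} \<union> {l - d..l}) \<le> measure lebesgue {0..d} + measure lebesgue {l - d..l}"
      by (rule measure_Un_le) auto
    finally have "measure lebesgue C \<le> (4 * real n + 2) * d"
      using d by (simp add: algebra_simps)
    also have "\<dots> \<le> (4 * real N + 2) * d" using n n'(1) d by (intro mult_right_mono) auto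
    finally show ?thesis .
  qed
  ultimately show thesis by (rule that)
qed

text \<open>Split at the level \<open>m\<close>: where \<open>|u| < m\<close> the nonlinear
  coefficient is at most \<open>k\<close>, and elsewhere, inside \<open>C\<close>, the integrand is
  at most \<open>b M^p\<close>, written as a product.\<close>

lemma edge_nonlinear_integral_bound:
  assumes es: "edge_solution I p lam Wbar b W \<rho> u du" and p: "2 < p" and b: "0 < b"
    and M: "\<And>x. x \<in> I \<Longrightarrow> \<bar>u x\<bar> \<le> M"
    and C: "{x \<in> I. m \<le> \<bar>u x\<bar>} \<subseteq> C" "C \<in> lmeasurable" and m: "0 \<le> m" "b * m powr (p - 2) \<le> k"
  shows "(LINT x|lebesgue_on I. \<rho> x * \<bar>u x\<bar> powr (p - 2) * (u x)\<^sup>2)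
    \<le> k * (LINT x|lebesgue_on I. (u x)\<^sup>2) + b * M powr (p - 2) * M\<^sup>2 * measure lebesgue C"
proof -
  note D = edge_solutionD[OF es]
  note Im = closed_ray_or_segmentD(2)[OF D(1)]
  define K where "K = b * M powr (p - 2) * M\<^sup>2"
  have K0: "0 \<le> K" using b by (simp add: K_def)
  have k0: "0 \<le> k" using m(2) b by (smt (verit) mult_nonneg_nonneg powr_ge_zero)
  have IC: "I \<inter> C \<in> lmeasurable" using C(2) Im by (simp add: fmeasurable_Int_fmeasurable inf_commute)
  have ind: "integrable (lebesgue_on I) (indicator C :: real \<Rightarrow> real)"
    "(LINT x|lebesgue_on I. indicator C x) = measure lebesgue (I \<inter> C)"
  proof -
    have "(\<lambda>x. indicator I x *\<^sub>R (indicator C x :: real)) = indicator (I \<inter> C)"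
      by (auto simp: fun_eq_iff indicator_def)
    note eq = this
    have ii: "integrable lebesgue (indicator (I \<inter> C) :: real \<Rightarrow> real)"
      using IC by (intro integrable_real_indicator) (auto simp: fmeasurable_def)
    have IS: "I \<inter> space lebesgue \<in> sets lebesgue" using Im by simp
    show "integrable (lebesgue_on I) (indicator C :: real \<Rightarrow> real)"
      unfolding integrable_restrict_space[OF IS] eq by (rule ii)
    show "(LINT x|lebesgue_on I. indicator C x) = measure lebesgue (I \<inter> C)"
      unfolding integral_restrict_space[OF IS] eq by simp
  qed
  have "(LINT x|lebesgue_on I. \<rho> x * \<bar>u x\<bar> powr (p - 2) * (u x)\<^sup>2)
      \<le> (LINT x|lebesgue_on I. k * (u x)\<^sup>2 + K * indicator C x)"
  proof (rule integral_mono_AE')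
    show "integrable (lebesgue_on I) (\<lambda>x. k * (u x)\<^sup>2 + K * indicator C x)" using ind(1) D(12) by auto
    show "AE x in lebesgue_on I. \<rho> x * \<bar>u x\<bar> powr (p - 2) * (u x)\<^sup>2 \<le> k * (u x)\<^sup>2 + K * indicator C x"
    proof (rule AE_I2)
      fix x assume "x \<in> space (lebesgue_on I)"
      then have x: "x \<in> I" by simp
      show "\<rho> x * \<bar>u x\<bar> powr (p - 2) * (u x)\<^sup>2 \<le> k * (u x)\<^sup>2 + K * indicator C x"
      proof (cases "m \<le> \<bar>u x\<bar>")
        case True
        then have "x \<in> C" using C(1) x by blast
        have 1: "\<rho> x * \<bar>u x\<bar> powr (p - 2) \<le> b * M powr (p - 2)"
          using edge_solution_rhs_bound(2)[OF es p M[OF x]] by simp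
        have 2: "(u x)\<^sup>2 \<le> M\<^sup>2" using power_mono[OF M[OF x] abs_ge_zero, of 2] by (simp only: power2_abs)
        have "\<rho> x * \<bar>u x\<bar> powr (p - 2) * (u x)\<^sup>2 \<le> K"
          unfolding K_def using b by (intro mult_mono[OF 1 2]) simp_all
        then show ?thesis using \<open>x \<in> C\<close> k0 by (simp add: add_increasing)
      next
        case False
        have "\<bar>u x\<bar> powr (p - 2) \<le> m powr (p - 2)" using False p by (intro powr_mono2) auto
        then have "\<rho> x * \<bar>u x\<bar> powr (p - 2) \<le> b * m powr (p - 2)"
          using D(5,6)[of x] b by (intro mult_mono) auto
        then have "\<rho> x * \<bar>u x\<bar> powr (p - 2) * (u x)\<^sup>2 \<le> k * (u x)\<^sup>2"
          using m(2) by (intro mult_right_mono) auto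
        then show ?thesis using K0 by (simp add: add_increasing2)
      qed
    qed
    show "AE x in lebesgue_on I. 0 \<le> k * (u x)\<^sup>2 + K * indicator C x"
      using k0 K0 by (intro AE_I2) simp
  qed
  also have "\<dots> = k * (LINT x|lebesgue_on I. (u x)\<^sup>2) + K * measure lebesgue (I \<inter> C)"
    using ind D(12) by simp
  also have "K * measure lebesgue (I \<inter> C) \<le> K * measure lebesgue C"
    using K0 C(2) IC by (intro mult_left_mono measure_mono_fmeasurable) auto
  finally show ?thesis by (simp add: K_def)
qed

section \<open>Bounds for the spectral parameter\<close>

text \<open>A solution reduced to its edges. Vertices are no longer visible; what is retained from
  them is the energy inequality, a hypothesis of the two bounds below. \<open>window\<close>
  expresses that all edges have length at least \<open>l\<close>.\<close>

locale edge_solutions =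
  fixes E :: "'e set" and I :: "'e \<Rightarrow> real set" and p lam Wbar b c l :: real
    and W \<rho> u du :: "'e \<Rightarrow> real \<Rightarrow> real"
  assumes finite_E: "finite E" and p: "2 < p" and b: "0 < b" and c: "0 < c" and l: "0 < l" and Wbar: "0 \<le> Wbar"
    and es: "e \<in> E \<Longrightarrow> edge_solution (I e) p lam Wbar b (W e) (\<rho> e) (u e) (du e)"
    and window: "e \<in> E \<Longrightarrow> x \<in> I e \<Longrightarrow> \<exists>s. {s..s + l} \<subseteq> I e \<and> x \<in> {s..s + l}"
    and mass: "(\<Sum>e\<in>E. LINT x|lebesgue_on (I e). (u e x)\<^sup>2) = c"
begin

definition kinetic :: real where
  "kinetic = (\<Sum>e\<in>E. LINT x|lebesgue_on (I e). (du e x)\<^sup>2)"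

definition nonlinear_energy :: real where
  "nonlinear_energy = (\<Sum>e\<in>E. LINT x|lebesgue_on (I e). \<rho> e x * \<bar>u e x\<bar> powr (p - 2) * (u e x)\<^sup>2)"

lemma kinetic_nonneg: "0 \<le> kinetic"
  unfolding kinetic_def by (intro sum_nonneg Bochner_Integration.integral_nonneg) simp

lemma sup_bound:
  assumes "e \<in> E" "x \<in> I e" "0 < \<tau>"
  shows "(u e x)\<^sup>2 \<le> (1 / l + 1 / \<tau>) * c + \<tau> * kinetic"
proof -
  obtain s where s: "{s..s + l} \<subseteq> I e" "x \<in> {s..s + l}" using window[OF assms(1,2)] by blast
  have "(LINT x|lebesgue_on (I e). (f e x)\<^sup>2) \<le> (\<Sum>e\<in>E. LINT x|lebesgue_on (I e). (f e x)\<^sup>2)"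
    for f :: "'e \<Rightarrow> real \<Rightarrow> real"
    by (rule member_le_sum[OF assms(1) _ finite_E]) (intro Bochner_Integration.integral_nonneg, simp)
  from this[of u] this[of du]
  have "(LINT x|lebesgue_on (I e). (u e x)\<^sup>2) \<le> c" "(LINT x|lebesgue_on (I e). (du e x)\<^sup>2) \<le> kinetic"
    by (simp_all add: mass kinetic_def)
  then have "(1 / l + 1 / \<tau>) * (LINT x|lebesgue_on (I e). (u e x)\<^sup>2) + \<tau> * (LINT x|lebesgue_on (I e). (du e x)\<^sup>2)
      \<le> (1 / l + 1 / \<tau>) * c + \<tau> * kinetic"
    using l assms(3) by (intro add_mono mult_left_mono) auto
  then show ?thesis using edge_solution_sup_bound[OF es[OF assms(1)] l s assms(3)] by linarith
qed

text \<open>This is \<open>sup_bound\<close> with \<open>\<tau> = 1\<close>. It is uniform over the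
  points and edges, but it depends on the kinetic energy; its task is to show that the solution is
  bounded at all.\<close>

definition uniform_bound :: real where
  "uniform_bound = sqrt ((1 / l + 1) * c + kinetic)"

lemma uniform_bound: "e \<in> E \<Longrightarrow> x \<in> I e \<Longrightarrow> \<bar>u e x\<bar> \<le> uniform_bound"
  unfolding uniform_bound_def using sup_bound[of e x 1] by (intro real_le_rsqrt) simp

lemma energy_lower_bound:
  "kinetic + (lam - Wbar) * c \<le> (\<Sum>e\<in>E. LINT x|lebesgue_on (I e). (du e x)\<^sup>2 + (W e x + lam) * (u e x)\<^sup>2)"
proof -
  have "(LINT x|lebesgue_on (I e). (du e x)\<^sup>2) + (lam - Wbar) * (LINT x|lebesgue_on (I e). (u e x)\<^sup>2)
      \<le> (LINT x|lebesgue_on (I e). (du e x)\<^sup>2 + (W e x + lam) * (u e x)\<^sup>2)" if e: "e \<in> E" for e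
  proof -
    note D = edge_solutionD[OF es[OF e]]
    note [measurable] = D(2,10)
    have Wu: "integrable (lebesgue_on (I e)) (\<lambda>x. (W e x + lam) * (u e x)\<^sup>2)"
    proof (rule Bochner_Integration.integrable_bound)
      show "integrable (lebesgue_on (I e)) (\<lambda>x. (Wbar + \<bar>lam\<bar>) * (u e x)\<^sup>2)" using D(12) by auto
      show "AE x in lebesgue_on (I e). norm ((W e x + lam) * (u e x)\<^sup>2) \<le> norm ((Wbar + \<bar>lam\<bar>) * (u e x)\<^sup>2)"
      proof (rule AE_I2)
        fix x
        have "\<bar>W e x + lam\<bar> \<le> \<bar>Wbar + \<bar>lam\<bar>\<bar>" using D(4)[of x] by linarith
        then show "norm ((W e x + lam) * (u e x)\<^sup>2) \<le> norm ((Wbar + \<bar>lam\<bar>) * (u e x)\<^sup>2)"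
          unfolding real_norm_def abs_mult by (intro mult_right_mono) auto
      qed
    qed measurable
    have "(LINT x|lebesgue_on (I e). (du e x)\<^sup>2) + (lam - Wbar) * (LINT x|lebesgue_on (I e). (u e x)\<^sup>2)
        = (LINT x|lebesgue_on (I e). (du e x)\<^sup>2 + (lam - Wbar) * (u e x)\<^sup>2)"
      using D(12,13) by simp
    also have "\<dots> \<le> (LINT x|lebesgue_on (I e). (du e x)\<^sup>2 + (W e x + lam) * (u e x)\<^sup>2)"
    proof (rule integral_mono)
      fix x
      have "lam - Wbar \<le> W e x + lam" using D(4)[of x] by linarith
      then show "(du e x)\<^sup>2 + (lam - Wbar) * (u e x)\<^sup>2 \<le> (du e x)\<^sup>2 + (W e x + lam) * (u e x)\<^sup>2"
        by (simp add: mult_right_mono)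
    qed (use D(12,13) Wu in auto)
    finally show ?thesis .
  qed
  then have "(\<Sum>e\<in>E. (LINT x|lebesgue_on (I e). (du e x)\<^sup>2) + (lam - Wbar) * (LINT x|lebesgue_on (I e). (u e x)\<^sup>2))
      \<le> (\<Sum>e\<in>E. LINT x|lebesgue_on (I e). (du e x)\<^sup>2 + (W e x + lam) * (u e x)\<^sup>2)"
    by (rule sum_mono)
  then show ?thesis by (simp add: sum.distrib sum_distrib_left[symmetric] mass kinetic_def)
qed

lemma nonlinear_energy_le:
  assumes M: "\<And>e x. e \<in> E \<Longrightarrow> x \<in> I e \<Longrightarrow> \<bar>u e x\<bar> \<le> M"
  shows "nonlinear_energy \<le> b * M powr (p - 2) * c"
proof -
  have "(LINT x|lebesgue_on (I e). \<rho> e x * \<bar>u e x\<bar> powr (p - 2) * (u e x)\<^sup>2)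
      \<le> b * M powr (p - 2) * (LINT x|lebesgue_on (I e). (u e x)\<^sup>2)" if e: "e \<in> E" for e
  proof -
    note D = edge_solutionD[OF es[OF e]]
    have "(LINT x|lebesgue_on (I e). \<rho> e x * \<bar>u e x\<bar> powr (p - 2) * (u e x)\<^sup>2)
        \<le> (LINT x|lebesgue_on (I e). b * M powr (p - 2) * (u e x)\<^sup>2)"
    proof (rule integral_mono_AE')
      show "AE x in lebesgue_on (I e). \<rho> e x * \<bar>u e x\<bar> powr (p - 2) * (u e x)\<^sup>2 \<le> b * M powr (p - 2) * (u e x)\<^sup>2"
        using abs_le_D1[OF edge_solution_rhs_bound(2)[OF es[OF e] p M[OF e]]] by (intro AE_I2 mult_right_mono) auto
      show "AE x in lebesgue_on (I e). 0 \<le> b * M powr (p - 2) * (u e x)\<^sup>2" using b by (intro AE_I2) simp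
    qed (use D(12) in auto)
    then show ?thesis by simp
  qed
  then have "nonlinear_energy \<le> (\<Sum>e\<in>E. b * M powr (p - 2) * (LINT x|lebesgue_on (I e). (u e x)\<^sup>2))"
    unfolding nonlinear_energy_def by (rule sum_mono)
  then show ?thesis by (simp add: sum_distrib_left[symmetric] mass)
qed

text \<open>By the Gagliardo--Nirenberg inequality the nonlinear energy grows like the power
  \<open>(p - 2) / 4 < 1\<close> of the kinetic energy, hence it is absorbed by the kinetic energy.\<close>

lemma subcritical_bound:
  assumes p6: "p < 6" and energy: "kinetic + (lam - Wbar) * c \<le> nonlinear_energy"
  shows "lam \<le> Wbar + (1 + (b * c * (c / l + 2 * sqrt c) powr ((p - 2) / 2)) powr (1 / (1 - (p - 2) / 4))) / c"
proof -
  \<comment> \<open>With \<open>K\<close> at least 1 the term of lower order can be multiplied by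
    \<open>sqrt K\<close>, also when the kinetic energy is small.\<close>
  define K where "K = kinetic + 1"
  define X where "X = c / l + 2 * sqrt c"
  have K: "1 \<le> K" using kinetic_nonneg by (simp add: K_def)
  have X: "0 < X" using c l by (simp add: X_def add_pos_pos)
  define M where "M = sqrt (X * sqrt K)"
  have M: "\<bar>u e x\<bar> \<le> M" if "e \<in> E" "x \<in> I e" for e x
    unfolding M_def
  proof (rule real_le_rsqrt)
    \<comment> \<open>This weight makes \<open>c / \<tau>\<close> and \<open>\<tau> * K\<close>
      equal, the Gagliardo--Nirenberg choice.\<close>
    define \<tau> where "\<tau> = sqrt c / sqrt K"
    have \<tau>: "0 < \<tau>" using c K by (simp add: \<tau>_def)
    have "(u e x)\<^sup>2 \<le> (1 / l + 1 / \<tau>) * c + \<tau> * K"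
      using sup_bound[OF that \<tau>] \<tau> by (simp add: K_def distrib_left)
    also have "\<dots> = c / l + c / \<tau> + \<tau> * K" by (simp add: distrib_right)
    also have "c / \<tau> = sqrt c * sqrt K"
    proof -
      have "sqrt c * sqrt c = c" using c by simp
      then show ?thesis using c K by (simp add: \<tau>_def field_simps)
    qed
    also have "\<tau> * K = sqrt c * sqrt K"
    proof -
      have "sqrt K * sqrt K = K" using K by simp
      then show ?thesis using K by (simp add: \<tau>_def field_simps)
    qed
    also have "c / l + sqrt c * sqrt K + sqrt c * sqrt K \<le> (c / l) * sqrt K + sqrt c * sqrt K + sqrt c * sqrt K"
    proof -
      have "c / l * 1 \<le> (c / l) * sqrt K" using c l K by (intro mult_left_mono) auto
      then show ?thesis by simp
    qed
    also have "\<dots> = X * sqrt K" by (simp add: X_def algebra_simps)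
    finally show "\<bar>u e x\<bar>\<^sup>2 \<le> X * sqrt K" by simp
  qed
  have "M powr (p - 2) = X powr ((p - 2) / 2) * K powr ((p - 2) / 4)"
  proof -
    have "M = (X * K powr (1 / 2)) powr (1 / 2)"
      using X K by (simp add: M_def powr_half_sqrt)
    then show ?thesis using X K by (simp add: powr_powr powr_mult)
  qed
  then have "kinetic + (lam - Wbar) * c \<le> (b * c * X powr ((p - 2) / 2)) * K powr ((p - 2) / 4)"
    using energy nonlinear_energy_le[OF M] by (simp add: mult_ac)
  moreover have "(b * c * X powr ((p - 2) / 2)) * K powr ((p - 2) / 4) - K
      \<le> (b * c * X powr ((p - 2) / 2)) powr (1 / (1 - (p - 2) / 4))"
    by (rule sublinear_powr_bound) (use b c X p p6 K in auto)
  ultimately have "(lam - Wbar) * c \<le> 1 + (b * c * X powr ((p - 2) / 2)) powr (1 / (1 - (p - 2) / 4))"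
    by (simp add: K_def)
  then have "lam - Wbar \<le> (1 + (b * c * X powr ((p - 2) / 2)) powr (1 / (1 - (p - 2) / 4))) / c"
    using c by (simp add: pos_le_divide_eq)
  then show ?thesis by (simp add: X_def)
qed

text \<open>For large \<open>lam\<close> the solution is at most of the size \<open>lam powr (1 / (p - 2))\<close>, and it is of this size only
  on boundedly many intervals of length \<open>1 / sqrt lam\<close>. Hence the mass there is of the order
  \<open>lam powr (2 / (p - 2) - 1 / 2)\<close>, which tends to \<open>0\<close> since \<open>6 < p\<close>.\<close>

lemma supercritical_bound:
  fixes N :: nat and \<epsilon> R a :: real
  assumes p6: "6 < p" and energy: "kinetic + (lam - Wbar) * c \<le> nonlinear_energy"
    and a: "0 < a" and osc: "0 < \<epsilon>" "0 < R"
    and dichotomy: "\<And>e. e \<in> E \<Longrightarrow> (\<forall>x. a \<le> \<rho> e x) \<or> (\<forall>x. \<rho> e x = 0)"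
    and no_high_peak: "\<And>e M x s. e \<in> E \<Longrightarrow> \<forall>x. a \<le> \<rho> e x \<Longrightarrow> 0 < M \<Longrightarrow> \<forall>x\<in>I e. \<bar>u e x\<bar> \<le> M \<Longrightarrow>
      x \<in> {s..s + l} \<Longrightarrow> {s..s + l} \<subseteq> I e \<Longrightarrow> M / 2 \<le> \<bar>u e x\<bar> \<Longrightarrow>
      Wbar + \<bar>lam\<bar> \<le> \<epsilon> * M powr (p - 2) \<Longrightarrow> 4 * R\<^sup>2 \<le> l\<^sup>2 * M powr (p - 2) \<Longrightarrow> False"
    and no_separated_peaks: "\<And>e y d m M S \<delta>. e \<in> E \<Longrightarrow> \<forall>x. a \<le> \<rho> e x \<Longrightarrow>
      \<forall>i<N. {y i - d..y i + d} \<subseteq> I e \<and> m \<le> \<bar>u e (y i)\<bar> \<Longrightarrow>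
      \<forall>i<N. \<forall>j<N. i \<noteq> j \<longrightarrow> 2 * d \<le> \<bar>y i - y j\<bar> \<Longrightarrow>
      \<forall>x\<in>I e. \<bar>u e x\<bar> \<le> M \<and> \<bar>du e x\<bar> \<le> S \<Longrightarrow>
      0 < m \<Longrightarrow> 0 < \<delta> \<Longrightarrow> 2 * \<delta> \<le> d \<Longrightarrow> S * \<delta> \<le> m / 2 \<Longrightarrow>
      8 * M\<^sup>2 / d < (p - 2) * (a * (m / 2) powr (p - 2) * (m / 2)\<^sup>2 * \<delta>) \<Longrightarrow> False"
  defines "A \<equiv> max (2 / \<epsilon>) (4 * R\<^sup>2 / l\<^sup>2)"
  defines "\<kappa> \<equiv> (2 * b * A) powr (1 / (p - 2))"
  defines "\<delta>0 \<equiv> 1 / (2 * \<kappa> * (4 + b * A))"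
  defines "L \<equiv> max (2 * \<delta>0) (64 * b * 2 powr (p - 2) * \<kappa>\<^sup>2 / ((p - 2) * a * \<delta>0) + 1)"
  defines "B \<equiv> 4 * (real (card E) * (b * A * A powr (2 / (p - 2)) * (4 * real N + 2) * L)) / c + 1"
  shows "lam \<le> max (max 1 Wbar) (max (1 / l\<^sup>2) (4 * Wbar + B powr (1 / (1 - (1 / 2 + 2 / (p - 2))))))"
proof (rule ccontr)
  assume "\<not> ?thesis"
  then have lam: "1 < lam" "Wbar < lam" "1 / l\<^sup>2 < lam"
    and big: "4 * Wbar + B powr (1 / (1 - (1 / 2 + 2 / (p - 2)))) < lam" by auto
  \<comment> \<open>Origin of the constants: \<open>M powr q = A * lam\<close> is the height from
    which on both largeness conditions of \<open>no_high_peak\<close> hold. \<open>\<kappa>\<close>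
    is the ratio \<open>M / m\<close>. \<open>\<delta>0\<close> and \<open>L\<close> are
    \<open>\<delta>\<close> and \<open>d\<close> in units of \<open>1 / r\<close>: the first makes
    \<open>S * \<delta>\<close> equal to \<open>m / 2\<close>, the second is so large that the gain
    of a peak exceeds its cost.\<close>
  define q where "q = p - 2"
  have q: "4 < q" using p6 by (simp add: q_def)
  define r where "r = sqrt lam"
  have r: "0 < r" "r * r = lam" using lam by (auto simp: r_def)
  have A: "0 < A" "2 \<le> A * \<epsilon>" "4 * R\<^sup>2 \<le> A * l\<^sup>2"
  proof -
    have 1: "2 / \<epsilon> \<le> A" "4 * R\<^sup>2 / l\<^sup>2 \<le> A" by (auto simp: A_def)
    then show "2 \<le> A * \<epsilon>" "4 * R\<^sup>2 \<le> A * l\<^sup>2" using osc l by (auto simp: divide_le_eq)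
    show "0 < A" using 1(1) osc by (smt (verit) divide_pos_pos)
  qed
  have \<kappa>: "0 < \<kappa>" using A b by (simp add: \<kappa>_def)
  have bA: "0 < b * A" using A b by simp
  have \<delta>0: "0 < \<delta>0" using \<kappa> bA by (simp add: \<delta>0_def add_pos_pos)
  have L: "2 * \<delta>0 \<le> L" "64 * b * 2 powr q * \<kappa>\<^sup>2 / (q * a * \<delta>0) < L"
    unfolding L_def q_def[symmetric] by (auto simp: less_max_iff_disj)
  then have L0: "0 < L" using \<delta>0 by linarith
  \<comment> \<open>\<open>M\<close> will bound \<open>|u|\<close> where
    \<open>\<rho> \<ge> a\<close>. The level \<open>m\<close> is chosen so that
    \<open>b * m powr q = lam / 2\<close>: below it the nonlinear term is at most half of the linear
    one and is absorbed in the energy inequality.\<close>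
  define M where "M = (A * lam) powr (1 / q)"
  define m where "m = (lam / (2 * b)) powr (1 / q)"
  have M: "0 < M" "M powr q = A * lam" using A lam q by (auto simp: M_def powr_powr)
  have m: "0 < m" "m powr q = lam / (2 * b)" using b lam q by (auto simp: m_def powr_powr)
  have Mm: "M = \<kappa> * m"
  proof -
    have "A * lam = (2 * b * A) * (lam / (2 * b))" using b by simp
    moreover have "((2 * b * A) * (lam / (2 * b))) powr (1 / q) = (2 * b * A) powr (1 / q) * (lam / (2 * b)) powr (1 / q)"
      by (rule powr_mult)
    ultimately show ?thesis unfolding M_def m_def \<kappa>_def q_def by (simp only:)
  qed
  have bound: "\<bar>u e x\<bar> \<le> M" if e: "e \<in> E" "\<forall>x. a \<le> \<rho> e x" and x: "x \<in> I e" for e x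
  proof (rule ccontr)
    assume "\<not> \<bar>u e x\<bar> \<le> M"
    define T where "T = (\<lambda>x. \<bar>u e x\<bar>) ` I e"
    define M' where "M' = Sup T"
    have bdd: "bdd_above T" unfolding T_def using uniform_bound[OF e(1)] by (intro bdd_aboveI2) auto
    have ne: "T \<noteq> {}" using x by (auto simp: T_def)
    have le: "\<bar>u e z\<bar> \<le> M'" if "z \<in> I e" for z
      unfolding M'_def by (rule cSup_upper[OF _ bdd]) (use that in \<open>simp add: T_def\<close>)
    have MM': "M < M'" using le[OF x] \<open>\<not> \<bar>u e x\<bar> \<le> M\<close> by linarith
    \<comment> \<open>On a half-line the supremum need not be attained, so a point at more than half
      of it is used.\<close>
    then have "M' / 2 < Sup T" using M(1) by (simp add: M'_def)
    then obtain t where "t \<in> T" "M' / 2 < t" unfolding less_cSup_iff[OF ne bdd] by blast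
    then obtain z where z: "z \<in> I e" "M' / 2 < \<bar>u e z\<bar>" by (auto simp: T_def)
    obtain s where s: "{s..s + l} \<subseteq> I e" "z \<in> {s..s + l}" using window[OF e(1) z(1)] by blast
    have AM: "A * lam \<le> M' powr (p - 2)"
      unfolding M(2)[symmetric] q_def[symmetric] using M(1) MM' q by (intro powr_mono2) auto
    have "Wbar + \<bar>lam\<bar> \<le> 2 * lam" using lam by simp
    also have "\<dots> \<le> (A * \<epsilon>) * lam" using A(2) lam by (intro mult_right_mono) auto
    also have "\<dots> \<le> \<epsilon> * M' powr (p - 2)" using mult_left_mono[OF AM, of \<epsilon>] osc by (simp add: mult_ac)
    finally have 1: "Wbar + \<bar>lam\<bar> \<le> \<epsilon> * M' powr (p - 2)" .
    have "4 * R\<^sup>2 \<le> (A * l\<^sup>2) * 1" using A(3) by simp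
    also have "\<dots> \<le> (A * l\<^sup>2) * lam" using A lam by (intro mult_left_mono) auto
    also have "\<dots> \<le> l\<^sup>2 * M' powr (p - 2)" using mult_left_mono[OF AM, of "l\<^sup>2"] by (simp add: mult_ac)
    finally have 2: "4 * R\<^sup>2 \<le> l\<^sup>2 * M' powr (p - 2)" .
    show False
      by (rule no_high_peak[OF e _ _ s(2,1) less_imp_le[OF z(2)] 1 2]) (use MM' M(1) le in auto)
  qed
  define S where "S = (4 + b * A) * r * M"
  have slope: "\<bar>du e x\<bar> \<le> S" if e: "e \<in> E" "\<forall>x. a \<le> \<rho> e x" and x: "x \<in> I e" for e x
  proof -
    note D = edge_solutionD[OF es[OF e(1)]]
    obtain s where s: "{s..s + l} \<subseteq> I e" "x \<in> {s..s + l}" using window[OF e(1) x] by blast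
    \<comment> \<open>On an interval of length \<open>1 / r\<close> the terms \<open>M / w\<close>
      and \<open>lam * M * w\<close> of the slope bound are of the same order \<open>r * M\<close>.
      The lower bound \<open>1 / l^2\<close> on \<open>lam\<close> ensures that the interval fits
      into the window.\<close>
    define w where "w = 1 / r"
    have "w \<le> l"
    proof (rule power2_le_imp_le)
      have "1 < lam * l\<^sup>2" using lam(3) l by (simp only: pos_divide_less_eq zero_less_power)
      then have "1 / lam \<le> l\<^sup>2" using lam(1) by (subst pos_divide_le_eq) (auto simp: mult.commute)
      moreover have "w\<^sup>2 = 1 / lam" using r(2) by (simp add: w_def power_divide power2_eq_square)
      ultimately show "w\<^sup>2 \<le> l\<^sup>2" by simp
    qed (use l in simp)
    \<comment> \<open>The interval of length \<open>w\<close> ends at \<open>x\<close> if it can,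
      and otherwise starts at the left end of the window.\<close>
    define s' where "s' = max s (x - w)"
    have w0: "0 < w" using r by (simp add: w_def)
    have sub: "{s'..s' + w} \<subseteq> I e" "x \<in> {s'..s' + w}"
      using s \<open>w \<le> l\<close> w0 by (auto simp: s'_def subset_iff)
    have "\<bar>du e x\<bar> \<le> 2 * M / (s' + w - s') + ((Wbar + \<bar>lam\<bar> + b * M powr (p - 2)) * M) * (s' + w - s')"
    proof (rule second_antiderivative_on_deriv_abs_le[OF second_antiderivative_on_subset[OF D(7) sub(1)] _ sub(2)])
      show "s' < s' + w" using w0 by simp
      fix z assume "z \<in> {s'..s' + w}"
      then have "z \<in> I e" using sub by blast
      then show "\<bar>u e z\<bar> \<le> M" by (rule bound[OF e])
      then show "\<bar>(W e z + lam - \<rho> e z * \<bar>u e z\<bar> powr (p - 2)) * u e z\<bar> \<le> (Wbar + \<bar>lam\<bar> + b * M powr (p - 2)) * M"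
        by (rule edge_solution_rhs_bound(1)[OF es[OF e(1)] p])
    qed
    also have "\<dots> = 2 * M * r + (Wbar + \<bar>lam\<bar> + b * M powr (p - 2)) * (M / r)" by (simp add: w_def)
    also have "\<dots> \<le> 2 * M * r + (2 * lam + b * (A * lam)) * (M / r)"
    proof -
      have "Wbar + \<bar>lam\<bar> + b * M powr (p - 2) \<le> 2 * lam + b * (A * lam)" using lam M(2) by (simp add: q_def)
      then have "(Wbar + \<bar>lam\<bar> + b * M powr (p - 2)) * (M / r) \<le> (2 * lam + b * (A * lam)) * (M / r)"
        using M(1) r(1) by (intro mult_right_mono) auto
      then show ?thesis by simp
    qed
    also have "(2 * lam + b * (A * lam)) * (M / r) = (2 + b * A) * (r * M)"
      using r(1) unfolding r(2)[symmetric] by (simp add: field_simps)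
    also have "2 * M * r + (2 + b * A) * (r * M) = S" by (simp add: S_def algebra_simps)
    finally show ?thesis .
  qed
  define d where "d = L / r"
  define \<delta> where "\<delta> = \<delta>0 / r"
  have d0: "0 < d" using L0 r by (simp add: d_def)
  have \<delta>: "0 < \<delta>" "2 * \<delta> \<le> d"
    using \<delta>0 r L(1) by (auto simp: d_def \<delta>_def divide_right_mono)
  have S\<delta>: "S * \<delta> \<le> m / 2"
  proof -
    have "S * \<delta> = (4 + b * A) * M * \<delta>0" using r(1) by (simp add: S_def \<delta>_def)
    also have "\<dots> = (4 + b * A) * \<kappa> * m / (2 * \<kappa> * (4 + b * A))" by (simp add: Mm \<delta>0_def)
    also have "\<dots> = m / 2"
    proof -
      have "k * \<kappa> * m / (2 * \<kappa> * k) = m / 2" if "0 < k" for k using that \<kappa> by simp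
      then show ?thesis using bA by simp
    qed
    finally show ?thesis by simp
  qed
  \<comment> \<open>Both sides are \<open>m^2 * r\<close> times a constant independent of
    \<open>lam\<close>, so one \<open>L\<close> serves all \<open>lam\<close>. The
    \<open>+ 1\<close> in \<open>L\<close> makes the inequality strict.\<close>
  have gain: "8 * M\<^sup>2 / d < (p - 2) * (a * (m / 2) powr (p - 2) * (m / 2)\<^sup>2 * \<delta>)"
  proof -
    have "(m / 2) powr (p - 2) = lam / (2 * b) / 2 powr q"
      using m by (simp add: powr_divide q_def[symmetric])
    then have rhs: "(p - 2) * (a * (m / 2) powr (p - 2) * (m / 2)\<^sup>2 * \<delta>)
        = (m\<^sup>2 * r) * (q * a * \<delta>0 / (8 * b * 2 powr q))"
      using r b unfolding r(2)[symmetric] by (simp add: q_def[symmetric] \<delta>_def power2_eq_square field_simps)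
    have lhs: "8 * M\<^sup>2 / d = (m\<^sup>2 * r) * (8 * \<kappa>\<^sup>2 / L)"
      by (simp add: Mm d_def power_mult_distrib)
    have "64 * b * 2 powr q * \<kappa>\<^sup>2 < L * (q * a * \<delta>0)"
      using L(2) q a \<delta>0 by (simp add: pos_divide_less_eq)
    then have "8 * \<kappa>\<^sup>2 / L < q * a * \<delta>0 / (8 * b * 2 powr q)"
      using L0 b by (simp add: field_simps)
    then show ?thesis unfolding lhs rhs using m(1) r(1) by (intro mult_strict_left_mono) auto
  qed
  define J where "J = b * M powr (p - 2) * M\<^sup>2 * ((4 * real N + 2) * d)"
  have J0: "0 \<le> J" using b d0 by (simp add: J_def)
  have edge: "(LINT x|lebesgue_on (I e). \<rho> e x * \<bar>u e x\<bar> powr (p - 2) * (u e x)\<^sup>2)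
      \<le> lam / 2 * (LINT x|lebesgue_on (I e). (u e x)\<^sup>2) + J" if e: "e \<in> E" for e
  proof -
    have u2: "0 \<le> (LINT x|lebesgue_on (I e). (u e x)\<^sup>2)" by simp
    consider "\<forall>x. \<rho> e x = 0" | "\<forall>x. a \<le> \<rho> e x" using dichotomy[OF e] by blast
    then show ?thesis
    proof cases
      case 1
      then have "(LINT x|lebesgue_on (I e). \<rho> e x * \<bar>u e x\<bar> powr (p - 2) * (u e x)\<^sup>2) = 0" by simp
      also have "0 \<le> lam / 2 * (LINT x|lebesgue_on (I e). (u e x)\<^sup>2) + J"
        using u2 J0 lam by (intro add_nonneg_nonneg mult_nonneg_nonneg) auto
      finally show ?thesis .
    next
      case 2
      define V where "V = {x \<in> I e. m \<le> \<bar>u e x\<bar>}"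
      have "\<nexists>y :: nat \<Rightarrow> real. (\<forall>i<N. y i \<in> V \<and> {y i - d..y i + d} \<subseteq> I e) \<and>
        (\<forall>i<N. \<forall>j<N. i \<noteq> j \<longrightarrow> 2 * d \<le> \<bar>y i - y j\<bar>)"
      proof
        assume "\<exists>y :: nat \<Rightarrow> real. (\<forall>i<N. y i \<in> V \<and> {y i - d..y i + d} \<subseteq> I e) \<and>
          (\<forall>i<N. \<forall>j<N. i \<noteq> j \<longrightarrow> 2 * d \<le> \<bar>y i - y j\<bar>)"
        then obtain y :: "nat \<Rightarrow> real" where
          y: "\<forall>i<N. y i \<in> V \<and> {y i - d..y i + d} \<subseteq> I e" "\<forall>i<N. \<forall>j<N. i \<noteq> j \<longrightarrow> 2 * d \<le> \<bar>y i - y j\<bar>" by blast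
        have y': "\<forall>i<N. {y i - d..y i + d} \<subseteq> I e \<and> m \<le> \<bar>u e (y i)\<bar>" using y(1) by (simp add: V_def)
        have "\<forall>x\<in>I e. \<bar>u e x\<bar> \<le> M \<and> \<bar>du e x\<bar> \<le> S" using bound[OF e 2] slope[OF e 2] by blast
        from no_separated_peaks[OF e 2 y' y(2) this m(1) \<delta> S\<delta> gain] show False .
      qed
      then obtain C where C: "V \<subseteq> C" "C \<in> lmeasurable" "measure lebesgue C \<le> (4 * real N + 2) * d"
        by (rule cover_if_no_separated_family[OF edge_solutionD(1)[OF es[OF e]] _ d0, rotated])
          (auto simp: V_def)
      have "b * m powr (p - 2) \<le> lam / 2" using m(2) b by (simp add: q_def)
      from edge_nonlinear_integral_bound[OF es[OF e] p b bound[OF e 2] C(1)[unfolded V_def] C(2) less_imp_le[OF m(1)] this]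
      have "(LINT x|lebesgue_on (I e). \<rho> e x * \<bar>u e x\<bar> powr (p - 2) * (u e x)\<^sup>2)
        \<le> lam / 2 * (LINT x|lebesgue_on (I e). (u e x)\<^sup>2) + b * M powr (p - 2) * M\<^sup>2 * measure lebesgue C" .
      also have "b * M powr (p - 2) * M\<^sup>2 * measure lebesgue C \<le> J"
        unfolding J_def using C(3) b by (intro mult_left_mono) auto
      finally show ?thesis by simp
    qed
  qed
  have "nonlinear_energy \<le> (\<Sum>e\<in>E. lam / 2 * (LINT x|lebesgue_on (I e). (u e x)\<^sup>2) + J)"
    unfolding nonlinear_energy_def by (rule sum_mono[OF edge])
  also have "\<dots> = lam / 2 * c + real (card E) * J"
    by (simp only: sum.distrib sum_distrib_left[symmetric] mass sum_constant)
  finally have "(lam / 2 - Wbar) * c \<le> real (card E) * J"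
    using energy kinetic_nonneg by (simp add: algebra_simps)
  \<comment> \<open>In \<open>J\<close> the factor \<open>M powr q\<close> contributes the exponent
    1, \<open>M^2\<close> contributes \<open>2 / q\<close> and the width \<open>d\<close>
    contributes \<open>- 1 / 2\<close>.\<close>
  define \<theta> where "\<theta> = 1 / 2 + 2 / q"
  have \<theta>: "0 \<le> \<theta>" "\<theta> < 1" using q by (auto simp: \<theta>_def field_simps)
  have Jeq: "J = b * A * A powr (2 / q) * (4 * real N + 2) * L * lam powr \<theta>"
  proof -
    have "M\<^sup>2 = (A * lam) powr (2 / q)"
      using A lam M(1) by (simp add: M_def power2_eq_square flip: powr_add)
    also have "\<dots> = A powr (2 / q) * lam powr (2 / q)" using A lam by (simp add: powr_mult)
    finally have M2: "M\<^sup>2 = A powr (2 / q) * lam powr (2 / q)" .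
    have "lam powr \<theta> = r * lam powr (2 / q)"
      using lam by (simp add: \<theta>_def powr_add powr_half_sqrt r_def)
    moreover have "J = b * (A * lam) * (A powr (2 / q) * lam powr (2 / q)) * ((4 * real N + 2) * (L / r))"
      unfolding J_def d_def M2 using M(2) by (simp add: q_def)
    moreover have "lam / r = r" using r by (simp add: field_simps)
    ultimately show ?thesis by (metis (no_types, opaque_lifting) mult.assoc mult.commute times_divide_eq_right)
  qed
  define B0 where "B0 = real (card E) * (b * A * A powr (2 / q) * (4 * real N + 2) * L) / c"
  have B0: "0 \<le> B0" using b A L0 c by (simp add: B0_def)
  \<comment> \<open>Four times \<open>lam / 2 - Wbar \<le> B0 * lam powr \<theta>\<close> leaves one
    spare \<open>lam\<close> for absorbing the power; the added 1 keeps \<open>B\<close>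
    positive.\<close>
  have B: "B = 4 * B0 + 1" by (simp add: B_def B0_def q_def)
  have "(lam / 2 - Wbar) * c \<le> (B0 * lam powr \<theta>) * c"
    using \<open>(lam / 2 - Wbar) * c \<le> real (card E) * J\<close> c by (simp add: Jeq B0_def mult_ac)
  then have "lam / 2 - Wbar \<le> B0 * lam powr \<theta>" using c by simp
  moreover have "B * lam powr \<theta> - lam \<le> B powr (1 / (1 - \<theta>))"
    by (rule sublinear_powr_bound) (use B B0 \<theta> lam in auto)
  moreover have "4 * (B0 * lam powr \<theta>) \<le> B * lam powr \<theta>" by (simp add: B distrib_right)
  moreover have "4 * Wbar + B powr (1 / (1 - \<theta>)) < lam" using big by (simp add: \<theta>_def q_def)
  ultimately show False by linarith
qed

end

section \<open>Assembling the edges of the graph\<close>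

lemma edge_interval_window:
  assumes "l \<le> len G e" "0 < l" "x \<in> edge_interval G e"
  shows "\<exists>s. {s..s + l} \<subseteq> edge_interval G e \<and> x \<in> {s..s + l}"
proof (cases "len G e")
  case (real L)
  then have "edge_interval G e = {0..L}" "l \<le> L" using assms(1) by (auto simp: edge_interval_def)
  then show ?thesis using assms(2,3) by (intro exI[of _ "min x (L - l)"]) (auto simp: min_def)
next
  case PInf
  then have "edge_interval G e = {0..}" by (auto simp: edge_interval_def)
  then show ?thesis using assms(2,3) by (intro exI[of _ x]) auto
qed (use assms in simp)

theorem corollary1p4:
  fixes G :: "('v, 'e) metric_graph"
    and p Wbar a b c mstar :: real
    and W \<rho> u :: "nat \<Rightarrow> ('v, 'e) gpoint \<Rightarrow> real"
    and lam :: "nat \<Rightarrow> real"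
  assumes "G \<in> graphs_fin"
    and "p > 2" and "p \<noteq> 6"
    and "\<And>n. W n \<in> Linfty G" and "\<And>n. \<rho> n \<in> Linfty G"
    and "\<And>n. AE_on_graph G (\<lambda>x. \<bar>W n x\<bar> \<le> Wbar)"
    and "b > 0"
    and "\<And>n. AE_on_graph G (\<lambda>x. 0 \<le> \<rho> n x \<and> \<rho> n x \<le> b)"
    and "0 < a" and "a < b"
    and "\<And>e. e \<in> edges G \<Longrightarrow>
           (\<forall>n. AE_on_edge G e (\<lambda>x. \<rho> n x \<ge> a)) \<or> (\<forall>n. AE_on_edge G e (\<lambda>x. \<rho> n x = 0))"
    and "\<And>n. u n \<in> H1 G"
    and "\<And>n. weak_solution G p (W n) (lam n) (\<rho> n) (u n)"
    and "c > 0" and "mstar > 0"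
    and "\<And>n. graph_integral G (\<lambda>e x. \<bar>on_edge G (u n) e x\<bar>\<^sup>2) = c"
    and "\<And>n. ereal_of_enat (morse_index G p (W n) (lam n) (\<rho> n) (u n)) \<le> ereal mstar"
  shows "bdd_above (range lam)"
proof -
  note G = assms(1) and p = assms(2) and W = assms(4) and \<rho> = assms(5) and b = assms(7) and a = assms(9)
    and u = assms(12) and sol = assms(13) and c = assms(14)
  note G' = graphs_finD[OF G]
  let ?I = "edge_interval G"
  have "0 < (INF e\<in>edges G. len G e)" using G by (simp add: graphs_fin_def graphs_def)
  \<comment> \<open>The infimum of the lengths may be infinite, as for a graph made of half-lines,
    so a real number strictly below it is used.\<close>
  then obtain l where l: "0 < ereal l" "ereal l < (INF e\<in>edges G. len G e)" using ereal_dense2 by blast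
  have l0: "0 < l" using l(1) by simp
  have l_le: "ereal l \<le> len G e" if "e \<in> edges G" for e
    using l(2) INF_lower[OF that, of "len G"] by (meson less_imp_le order_trans)
  obtain N :: nat where N: "mstar < real N" using reals_Archimedean2 by blast
  have morse: False if "enat N \<le> morse_index G p (W n) (lam n) (\<rho> n) (u n)" for n
  proof -
    have "ereal_of_enat (enat N) \<le> ereal_of_enat (morse_index G p (W n) (lam n) (\<rho> n) (u n))"
      using that by (simp only: ereal_of_enat_le_iff)
    also have "\<dots> \<le> ereal mstar" by (rule assms(17))
    finally show False using N by simp
  qed
  \<comment> \<open>\<open>Wbar\<close> carries no sign condition; its absolute value is
    nonnegative, as the locale asks.\<close>
  define Wb where "Wb = \<bar>Wbar\<bar>"
  define good where "good = (\<lambda>e. \<forall>n. AE_on_edge G e (\<lambda>x. \<rho> n x \<ge> a))"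
  \<comment> \<open>Clamping changes the coefficients only on null sets and makes their bounds hold
    everywhere. On an edge that is not \<open>good\<close> the alternative forces
    \<open>\<rho> n\<close> to vanish almost everywhere.\<close>
  define We where "We = (\<lambda>n e x. max (- Wb) (min Wb (on_edge G (W n) e x)))"
  define re where "re = (\<lambda>n e x. if good e then max a (min b (on_edge G (\<rho> n) e x)) else 0)"
  have We: "\<bar>We n e x\<bar> \<le> Wb" for n e x by (auto simp: We_def Wb_def)
  have re: "0 \<le> re n e x \<and> re n e x \<le> b" for n e x using a assms(10) by (auto simp: re_def)
  have AEW: "AE x in lebesgue_on (?I e). on_edge G (W n) e x = We n e x" if e: "e \<in> edges G" for n e
  proof -
    have "AE x in lebesgue_on (?I e). \<bar>on_edge G (W n) e x\<bar> \<le> Wbar"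
      using assms(6)[of n] e unfolding AE_on_graph_def AE_on_edge_def on_edge_def by blast
    then show ?thesis by eventually_elim (auto simp: We_def Wb_def)
  qed
  have AEr: "AE x in lebesgue_on (?I e). on_edge G (\<rho> n) e x = re n e x" if e: "e \<in> edges G" for n e
  proof (cases "good e")
    case True
    then have "AE x in lebesgue_on (?I e). a \<le> on_edge G (\<rho> n) e x"
      unfolding good_def AE_on_edge_def on_edge_def by blast
    moreover have "AE x in lebesgue_on (?I e). 0 \<le> on_edge G (\<rho> n) e x \<and> on_edge G (\<rho> n) e x \<le> b"
      using assms(8)[of n] e unfolding AE_on_graph_def AE_on_edge_def on_edge_def by blast
    ultimately show ?thesis by eventually_elim (use True in \<open>auto simp: re_def\<close>)
  next
    case False
    then have "AE_on_edge G e (\<lambda>x. \<rho> n x = 0)" using assms(11)[OF e] unfolding good_def by blast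
    then have "AE x in lebesgue_on (?I e). on_edge G (\<rho> n) e x = 0"
      unfolding AE_on_edge_def on_edge_def .
    then show ?thesis using False by (simp add: re_def)
  qed
  have meas: "We n e \<in> borel_measurable (lebesgue_on (?I e))" "re n e \<in> borel_measurable (lebesgue_on (?I e))"
    if e: "e \<in> edges G" for n e
  proof -
    have [measurable]: "on_edge G (W n) e \<in> borel_measurable (lebesgue_on (?I e))"
      "on_edge G (\<rho> n) e \<in> borel_measurable (lebesgue_on (?I e))"
      using W[of n] \<rho>[of n] e by (auto simp: Linfty_def)
    show "We n e \<in> borel_measurable (lebesgue_on (?I e))" unfolding We_def by measurable
    show "re n e \<in> borel_measurable (lebesgue_on (?I e))" unfolding re_def by (cases "good e") simp_all
  qed
  have "\<exists>du. edge_solution (?I e) p (lam n) Wb b (We n e) (re n e) (on_edge G (u n) e) du \<and>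
      (AE x in lebesgue_on (?I e). edge_deriv G (u n) e x = du x)" if e: "e \<in> edges G" for n e
    by (rule edge_solution_if_weak_solution[OF G p sol W \<rho> e AEW[OF e] AEr[OF e] meas[OF e] We re]) blast
  then have "\<forall>n e. \<exists>du. e \<in> edges G \<longrightarrow>
      edge_solution (?I e) p (lam n) Wb b (We n e) (re n e) (on_edge G (u n) e) du \<and>
      (AE x in lebesgue_on (?I e). edge_deriv G (u n) e x = du x)" by blast
  then obtain du where "\<forall>n e. e \<in> edges G \<longrightarrow>
      edge_solution (?I e) p (lam n) Wb b (We n e) (re n e) (on_edge G (u n) e) (du n e) \<and>
      (AE x in lebesgue_on (?I e). edge_deriv G (u n) e x = du n e x)" by (simp only: choice_iff) blast
  then have es: "\<And>n e. e \<in> edges G \<Longrightarrow>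
      edge_solution (?I e) p (lam n) Wb b (We n e) (re n e) (on_edge G (u n) e) (du n e)"
    and AEdu: "\<And>n e. e \<in> edges G \<Longrightarrow> AE x in lebesgue_on (?I e). edge_deriv G (u n) e x = du n e x"
    by blast+
  have S: "edge_solutions (edges G) ?I p (lam n) Wb b c l (We n) (re n) (on_edge G (u n)) (du n)" for n
  proof
    show "\<exists>s. {s..s + l} \<subseteq> ?I e \<and> x \<in> {s..s + l}" if "e \<in> edges G" "x \<in> ?I e" for e x
      by (rule edge_interval_window[OF l_le[OF that(1)] l0 that(2)])
    show "(\<Sum>e\<in>edges G. LINT x|lebesgue_on (?I e). (on_edge G (u n) e x)\<^sup>2) = c"
      using assms(16)[of n] by (simp add: graph_integral_def infsum_finite[OF G'(2)])
  qed (use G'(2) p b c l0 es in \<open>auto simp: Wb_def\<close>)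
  \<comment> \<open>\<open>uniform_bound\<close> varies with \<open>n\<close>; it only supplies the
    boundedness of \<open>u n\<close> that \<open>energy_identity\<close> needs for its
    limit.\<close>
  have energy: "edge_solutions.kinetic (edges G) ?I (du n) + (lam n - Wb) * c
      \<le> edge_solutions.nonlinear_energy (edges G) ?I p (re n) (on_edge G (u n))" for n
    using edge_solutions.energy_lower_bound[OF S[of n]]
      energy_identity[OF G p sol W \<rho> AEW AEr AEdu es edge_solutions.uniform_bound[OF S[of n]]]
    unfolding edge_solutions.nonlinear_energy_def[OF S[of n]] by simp
  show ?thesis
  proof (cases "p < 6")
    case True
    show ?thesis
      by (rule bdd_aboveI2, rule edge_solutions.subcritical_bound[OF S True energy])
  next
    case False
    then have p6: "6 < p" using assms(3) by simp
    have pos: "0 < p - 2" "0 < (1 / 2 :: real)" using p by auto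
    show ?thesis
    \<comment> \<open>The height \<open>1 / 2\<close> is what rescaling by \<open>M\<close> leaves
      of a point with \<open>|u| \<ge> M / 2\<close>. The zeros \<open>z 0\<close> to
      \<open>z N\<close> bound \<open>N\<close> nodal intervals, and \<open>N\<close> exceeds the
      bound on the Morse index.\<close>
    proof (rule oscillator_zeros[where N = N, OF a b pos])
      fix R \<epsilon> :: real
      assume R: "0 < R" and \<epsilon>: "0 < \<epsilon>"
        and osc: "\<And>v dv g y. oscillator a b (p - 2) \<epsilon> {y..y + R} v dv g \<Longrightarrow> 1 / 2 \<le> \<bar>v y\<bar> \<Longrightarrow>
          \<exists>z. (\<forall>i\<le>N. y < z i \<and> z i \<le> y + R \<and> v (z i) = 0) \<and>
            (\<forall>i<N. z i < z (Suc i) \<and> (\<exists>x. z i < x \<and> x < z (Suc i) \<and> v x \<noteq> 0))"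
      have dichotomy: "(\<forall>x. a \<le> re n e x) \<or> (\<forall>x. re n e x = 0)" if "e \<in> edges G" for n e
        by (cases "good e") (auto simp: re_def)
      have high: False if e: "e \<in> edges G" and good: "\<forall>x. a \<le> re n e x" and M: "0 < M" "\<forall>x\<in>?I e. \<bar>on_edge G (u n) e x\<bar> \<le> M"
        and x: "x \<in> {s..s + l}" "{s..s + l} \<subseteq> ?I e" "M / 2 \<le> \<bar>on_edge G (u n) e x\<bar>"
        and big: "Wb + \<bar>lam n\<bar> \<le> \<epsilon> * M powr (p - 2)" "4 * R\<^sup>2 \<le> l\<^sup>2 * M powr (p - 2)" for n e M x s
        by (rule morse[of n], rule morse_index_ge_high_peak[OF G e u W \<rho> p AEW[OF e] AEr[OF e] es[OF e] a _ osc R M(1) _ x l0 big])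
          (use good M(2) in auto)
      have peaks: False if e: "e \<in> edges G" and good: "\<forall>x. a \<le> re n e x"
        and y: "\<forall>i<N. {y i - d..y i + d} \<subseteq> ?I e \<and> m \<le> \<bar>on_edge G (u n) e (y i)\<bar>"
          "\<forall>i<N. \<forall>j<N. i \<noteq> j \<longrightarrow> 2 * d \<le> \<bar>y i - y j\<bar>"
        and M: "\<forall>x\<in>?I e. \<bar>on_edge G (u n) e x\<bar> \<le> M \<and> \<bar>du n e x\<bar> \<le> S"
        and pos: "0 < m" "0 < \<delta>" "2 * \<delta> \<le> d" "S * \<delta> \<le> m / 2"
        and big: "8 * M\<^sup>2 / d < (p - 2) * (a * (m / 2) powr (p - 2) * (m / 2)\<^sup>2 * \<delta>)" for n e y d m M S \<delta>
      proof (rule morse[of n], rule morse_index_ge_separated_peaks[OF G e u W \<rho> p AEW[OF e] AEr[OF e] es[OF e] a _ _ _ _ _ _ pos big])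
      qed (use good y M in auto)
      show ?thesis
        by (rule bdd_aboveI2, rule edge_solutions.supercritical_bound[OF S p6 energy a \<epsilon> R dichotomy high peaks])
    qed
  qed
qed

end
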